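(* Let $N$ be a positive integer and let $A,B$ be finite multisets of complex numbers. Suppose that $A$ equals the multiset sum $A=A_1+A_2$ and $B$ equals the multiset sum $B=B_1+B_2$ (finite multisets $A_1,A_2,B_1,B_2$). Then $$\mathcal{M}_N(A,B;0)=\sum_{\lambda}\mathcal{M}_N(A_1,B_1;\lambda)\,\mathcal{M}_N(A_2,B_2;-\lambda),$$ where the sum is over all dominant weights $\lambda$ of length $N$, and for $\lambda=(\lambda_1,\dots,\lambda_N)$ we write $-\lambda=(-\lambda_N,-\lambda_{N-1},\dots,-\lambda_1)$. Moreover, the summand on the right-hand side is nonzero for at most finitely many $\lambda$.
   Context: A dominant weight of length $n$ is an $n$-tuple $\lambda=(\lambda_1,\dots,\lambda_n)$ of integers with $\lambda_1\ge\lambda_2\ge\cdots\ge\lambda_n$. The generalized Schur function is $s_\lambda(x_1,\dots,x_n)=\det\big(x_j^{n-k+\lambda_k}\big)_{1\le j,k\le n}/\det\big(x_j^{n-k}\big)_{1\le j,k\le n}$. For a positive integer $N$, finite multisets $A,B$ of complex numbers and a dominant weight $\lambda$ of length $N$, the twisted moment is $$\mathcal{M}_N(A,B;\lambda)=\int_{U(N)}\prod_{\alpha\in A}\det(I-\alpha g^* )\prod_{\beta\in B}\det(I-\beta g)\, s_\lambda(t_1,\dots,t_N)\,dg,$$ where products count multiplicity, $dg$ is the Haar probability measure on the unitary group $U(N)$, $I$ is the $N\times N$ identity, $g^*$ the conjugate transpose, and $t_1,\dots,t_N$ are the eigenvalues of $g$ with multiplicity. $0$ denotes the zero dominant weight $(0,\dots,0)$.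 The multiset sum $C+D$ has multiplicity of each element equal to the sum of its multiplicities in $C$ and $D$. *)

theory Defs
  imports "Jordan_Normal_Form.Determinant" "HOL-Analysis.Analysis"
begin

no_notation Matrix.vec_index (infixl \<open>$\<close> 100)

text \<open>The group U(N) is modelled on matrices indexed by a finite type \<open>'n\<close>, with
  \<open>N = CARD('n)\<close>. Weights and variables of Schur functions are indexed from 0, so the exponent
  \<open>n - k\<close> of the 1-based formula becomes \<open>n - 1 - k\<close>.\<close>

definition dominant_weights :: "nat \<Rightarrow> int list set" where
  "dominant_weights n = {l. length l = n \<and> sorted_wrt (\<ge>) l}"

definition neg_weight :: "int list \<Rightarrow> int list" where
  "neg_weight l = rev (map uminus l)"

definition schur_num :: "int list \<Rightarrow> (nat \<Rightarrow> complex) \<Rightarrow> complex" where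
  "schur_num l x = (let n = length l in
     Determinant.det (Matrix.mat n n (\<lambda>(j, k). x j powi (int (n - 1 - k) + l ! k))))"

definition schur_den :: "nat \<Rightarrow> (nat \<Rightarrow> complex) \<Rightarrow> complex" where
  "schur_den n x = Determinant.det (Matrix.mat n n (\<lambda>(j, k). x j ^ (n - 1 - k)))"

text \<open>The quotient of determinants is a Laurent polynomial. Where two variables coincide the
  quotient reads 0/0, and the value of the Laurent polynomial is the limit of the quotient along
  points with pairwise distinct variables. Only the first \<open>length l\<close> variables matter.\<close>

definition schur :: "int list \<Rightarrow> (nat \<Rightarrow> complex) \<Rightarrow> complex" where
  "schur l x =
     (if inj_on x {..<length l} then schur_num l x / schur_den (length l) x
      else Lim (at x within {y. inj_on y {..<length l}})
             (\<lambda>y. schur_num l y / schur_den (length l) y))"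

definition conj_transpose :: "complex^'n^'n \<Rightarrow> complex^'n^'n" where
  "conj_transpose g = (\<chi> i j. cnj (g $ j $ i))"

definition unitary_group :: "(complex^'n^'n) set" where
  "unitary_group = {g. g ** conj_transpose g = Finite_Cartesian_Product.mat 1 \<and>
                       conj_transpose g ** g = Finite_Cartesian_Product.mat 1}"

definition haar_prob_measure :: "(complex^'n^'n) measure \<Rightarrow> bool" where
  "haar_prob_measure \<mu> \<longleftrightarrow>
     sets \<mu> = sets (restrict_space borel unitary_group) \<and>
     emeasure \<mu> (space \<mu>) = 1 \<and>
     (\<forall>h\<in>unitary_group. \<forall>E\<in>sets \<mu>. emeasure \<mu> ((\<lambda>g. h ** g) ` E) = emeasure \<mu> E)"

text \<open>The eigenvalues with algebraic multiplicity: the roots of \<open>det (X I - g)\<close>.\<close>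

definition eigenvalue_mset :: "complex^'n^'n \<Rightarrow> complex multiset" where
  "eigenvalue_mset g =
     proots (Determinants.det (Finite_Cartesian_Product.mat [:0, 1:] - (\<chi> i j. [:g $ i $ j:])))"

text \<open>As \<open>schur l\<close> is symmetric in its variables, the chosen enumeration is irrelevant.\<close>

definition schur_eigenvalues :: "int list \<Rightarrow> complex^'n^'n \<Rightarrow> complex" where
  "schur_eigenvalues l g = schur l ((!) (SOME ts. mset ts = eigenvalue_mset g))"

definition twisted_moment ::
  "(complex^'n^'n) measure \<Rightarrow> complex multiset \<Rightarrow> complex multiset \<Rightarrow> int list \<Rightarrow> complex" where
  "twisted_moment \<mu> A B l =
     (LINT g|\<mu>.
        (\<Prod>\<alpha>\<in>#A. Determinants.det (Finite_Cartesian_Product.mat 1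
                     - Finite_Cartesian_Product.mat \<alpha> ** conj_transpose g)) *
        (\<Prod>\<beta>\<in>#B. Determinants.det (Finite_Cartesian_Product.mat 1
                     - Finite_Cartesian_Product.mat \<beta> ** g)) *
        schur_eigenvalues l g)"

end

theory Submission
  imports Defs "HOL-Computational_Algebra.Fundamental_Theorem_Algebra"
begin

text \<open>
  Write \<open>\<rho> = (N - 1, \<dots>, 0)\<close>. The twisted moment \<open>M(A, B; \<lambda>)\<close> is the Toeplitz minor
  \<open>det q(\<rho>\<^sub>j - \<rho>\<^sub>k - \<lambda>\<^sub>k)\<close>, where \<open>q\<close> are the Laurent coefficients of the product of all
  \<open>1 - \<alpha> / x\<close> and \<open>1 - \<beta> x\<close>. These coefficients are multiplicative (as a convolution) in
  \<open>(A, B)\<close>, so the theorem is the Cauchy--Binet formula for a product of two banded Toeplitz matrices.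

  The Toeplitz formula follows, by multilinear expansion of alternants, from the fact that a Schur
  function has Haar integral 0 unless its exponents \<open>\<lambda> + \<rho>\<close> are a permutation of \<open>\<rho>\<close>. To prove this
  without the Weyl integration formula, a Schur function is written as an average over points \<open>w\<^sub>i\<close> on
  circles of the functions \<open>F(g) = det(g)\<^sup>-\<^sup>m det(w\<^sub>1 - g) \<cdots> det(w\<^sub>r - g)\<close>, by Fourier inversion of a
  Vandermonde determinant of size \<open>N + r\<close>. Applying \<open>\<Sum> (w\<^sub>i \<partial>\<^sub>i)\<^sup>2\<close> to this determinant multiplies the
  Schur function by a number depending on \<open>|\<lambda> + \<rho>|\<^sup>2\<close>, and multiplies \<open>F\<close> by a function of the traces of
  \<open>g (w\<^sub>i - g)\<^sup>-\<^sup>1\<close> and their products. For the reflection \<open>h\<close> with eigenvalue \<open>z\<close> on the line of \<open>v\<close>,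
  and for \<open>h = z\<close>, a power of \<open>z\<close> times \<open>F(h g)\<close> is a polynomial in \<open>z\<close>, so invariance of Haar measure
  determines the integrals of its first and second derivatives at \<open>z = 1\<close>; for suitable combinations of
  vectors \<open>v\<close> these are exactly the integrals of \<open>F\<close> times those traces.
\<close>

subsection \<open>Determinants of families\<close>

definition fdet :: "nat \<Rightarrow> (nat \<Rightarrow> nat \<Rightarrow> 'a::comm_ring_1) \<Rightarrow> 'a" where
  "fdet n f = Determinant.det (Matrix.mat n n (\<lambda>(j, k). f j k))"

lemma permutes_less: "p permutes {..<n} \<Longrightarrow> k < n \<Longrightarrow> p k < n" for n :: nat
  using permutes_in_image[of p "{..<n}" k] by simp

lemma fdet_leibniz:
  "fdet n f = (\<Sum>p | p permutes {..<n}. signof p * (\<Prod>j<n. f j (p j)))"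
proof -
  have "fdet n f = (\<Sum>p | p permutes {0..<n}. signof p *
      (\<Prod>i = 0..<n. Matrix.mat n n (\<lambda>(j, k). f j k) $$ (i, p i)))"
    unfolding fdet_def by (rule det_def') simp
  also have "\<dots> = (\<Sum>p | p permutes {..<n}. signof p * (\<Prod>j<n. f j (p j)))"
    unfolding atLeast0LessThan
    by (intro sum.cong prod.cong refl arg_cong2[where f = "(*)"]) (auto simp: permutes_less)
  finally show ?thesis .
qed

lemma fdet_cong:
  assumes "\<And>j k. j < n \<Longrightarrow> k < n \<Longrightarrow> f j k = g j k"
  shows "fdet n f = fdet n g"
  unfolding fdet_def by (rule arg_cong[where f = Determinant.det], rule eq_matI) (auto simp: assms)

lemma fdet_transpose: "fdet n (\<lambda>j k. f k j) = fdet n f"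
proof -
  have "transpose_mat (Matrix.mat n n (\<lambda>(j, k). f j k)) = Matrix.mat n n (\<lambda>(j, k). f k j)"
    by (rule eq_matI) auto
  then show ?thesis
    unfolding fdet_def using Determinant.det_transpose[of "Matrix.mat n n (\<lambda>(j, k). f j k)" n] by simp
qed

lemma fdet_permute_rows:
  assumes "p permutes {..<n}"
  shows "fdet n (\<lambda>j k. f (p j) k) = signof p * fdet n f"
proof -
  have "Matrix.mat n n (\<lambda>(i, j). Matrix.mat n n (\<lambda>(j, k). f j k) $$ (p i, j)) =
      Matrix.mat n n (\<lambda>(j, k). f (p j) k)"
    by (rule eq_matI) (auto simp: permutes_less[OF assms])
  then show ?thesis
    unfolding fdet_def
    using Determinant.det_permute_rows[of "Matrix.mat n n (\<lambda>(j, k). f j k)" n p] assms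
    by (simp add: atLeast0LessThan)
qed

lemma fdet_permute_cols:
  assumes "p permutes {..<n}"
  shows "fdet n (\<lambda>j k. f j (p k)) = signof p * fdet n f"
  using fdet_permute_rows[OF assms, of "\<lambda>j k. f k j"]
    fdet_transpose[of n "\<lambda>j k. f j (p k)"] fdet_transpose[of n f] by simp

lemma fdet_identical_cols:
  assumes "i < n" "k < n" "i \<noteq> k" "\<And>j. j < n \<Longrightarrow> f j i = f j k"
  shows "fdet n f = 0"
  unfolding fdet_def
  by (rule Determinant.det_identical_columns[of _ n i k]) (use assms in \<open>auto intro!: eq_vecI\<close>)

lemma fdet_zero_row:
  assumes "j < n" "\<And>k. k < n \<Longrightarrow> f j k = 0"
  shows "fdet n f = 0"
proof -
  have "(\<Prod>i<n. f i (p i)) = 0" if "p permutes {..<n}" for p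
    using assms permutes_less[OF that, of j] by (intro prod_zero) auto
  then show ?thesis unfolding fdet_leibniz by simp
qed

lemma fdet_zero_col:
  assumes "k < n" "\<And>j. j < n \<Longrightarrow> f j k = 0"
  shows "fdet n f = 0"
  using fdet_zero_row[of k n "\<lambda>j k. f k j"] fdet_transpose[of n f] assms by simp

lemma fdet_mult: "fdet n (\<lambda>j k. \<Sum>l<n. f j l * g l k) = fdet n f * fdet n g"
proof -
  have "Matrix.mat n n (\<lambda>(j, k). f j k) * Matrix.mat n n (\<lambda>(j, k). g j k) =
    Matrix.mat n n (\<lambda>(j, k). \<Sum>l<n. f j l * g l k)"
    by (rule eq_matI) (auto simp: scalar_prod_def atLeast0LessThan)
  then show ?thesis
    unfolding fdet_def
    using Determinant.det_mult[of "Matrix.mat n n (\<lambda>(j, k). f j k)" n "Matrix.mat n n (\<lambda>(j, k). g j k)"]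
    by simp
qed

lemma fdet_scale_rows: "fdet n (\<lambda>j k. c j * f j k) = (\<Prod>j<n. c j) * fdet n f"
  unfolding fdet_leibniz by (simp add: prod.distrib sum_distrib_left mult_ac)

lemma fdet_scale_cols: "fdet n (\<lambda>j k. c k * f j k) = (\<Prod>k<n. c k) * fdet n f"
  using fdet_scale_rows[of n c "\<lambda>j k. f k j"] fdet_transpose[of n "\<lambda>j k. c k * f j k"]
    fdet_transpose[of n f] by simp

lemma fdet_sum_rows:
  assumes "\<And>j. j < n \<Longrightarrow> finite (S j)"
  shows "fdet n (\<lambda>j k. \<Sum>s\<in>S j. f s j k) = (\<Sum>\<phi>\<in>PiE {..<n} S. fdet n (\<lambda>j k. f (\<phi> j) j k))"
proof -
  have "fdet n (\<lambda>j k. \<Sum>s\<in>S j. f s j k) = (\<Sum>p | p permutes {..<n}. signof p *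
     (\<Sum>\<phi>\<in>PiE {..<n} S. \<Prod>j<n. f (\<phi> j) j (p j)))"
    unfolding fdet_leibniz using assms by (subst prod_sum_PiE) auto
  also have "\<dots> = (\<Sum>\<phi>\<in>PiE {..<n} S. fdet n (\<lambda>j k. f (\<phi> j) j k))"
    unfolding fdet_leibniz sum_distrib_left by (rule sum.swap)
  finally show ?thesis .
qed

lemma fdet_sum_cols:
  assumes "\<And>k. k < n \<Longrightarrow> finite (S k)"
  shows "fdet n (\<lambda>j k. \<Sum>s\<in>S k. f s j k) = (\<Sum>\<phi>\<in>PiE {..<n} S. fdet n (\<lambda>j k. f (\<phi> k) j k))"
proof -
  have "fdet n (\<lambda>j k. \<Sum>s\<in>S k. f s j k) = fdet n (\<lambda>j k. \<Sum>s\<in>S j. f s k j)"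
    by (rule fdet_transpose[symmetric])
  also have "\<dots> = (\<Sum>\<phi>\<in>PiE {..<n} S. fdet n (\<lambda>j k. f (\<phi> j) k j))"
    by (rule fdet_sum_rows[OF assms])
  also have "\<dots> = (\<Sum>\<phi>\<in>PiE {..<n} S. fdet n (\<lambda>j k. f (\<phi> k) j k))"
    by (rule sum.cong[OF refl], rule fdet_transpose)
  finally show ?thesis .
qed

lemma fdet_block_lower:
  fixes f :: "nat \<Rightarrow> nat \<Rightarrow> 'a::idom"
  assumes "\<And>j k. j < r \<Longrightarrow> r \<le> k \<Longrightarrow> k < r + n \<Longrightarrow> f j k = 0"
  shows "fdet (r + n) f = fdet r f * fdet n (\<lambda>j k. f (r + j) (r + k))"
proof -
  let ?A = "Matrix.mat r r (\<lambda>(j, k). f j k)" and ?C = "Matrix.mat n r (\<lambda>(j, k). f (r + j) k)"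
    and ?D = "Matrix.mat n n (\<lambda>(j, k). f (r + j) (r + k))"
  have "Matrix.mat (r + n) (r + n) (\<lambda>(j, k). f j k) = four_block_mat ?A (0\<^sub>m r n) ?C ?D"
    by (rule eq_matI) (auto simp: assms)
  then show ?thesis
    unfolding fdet_def by (simp add: det_four_block_mat_upper_right_zero[of _ r _ n])
qed

lemma fdet_upper_triangular:
  assumes "\<And>j k. k < j \<Longrightarrow> j < n \<Longrightarrow> f j k = 0"
  shows "fdet n f = (\<Prod>j<n. f j j)"
proof -
  have "fdet n f = prod_list (diag_mat (Matrix.mat n n (\<lambda>(j, k). f j k)))"
    unfolding fdet_def by (rule det_upper_triangular[of _ n]) (auto simp: assms upper_triangular_def)
  also have "diag_mat (Matrix.mat n n (\<lambda>(j, k). f j k)) = map (\<lambda>j. f j j) [0..<n]"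
    by (auto simp: diag_mat_def)
  also have "prod_list \<dots> = (\<Prod>j<n. f j j)"
    by (simp add: prod.distinct_set_conv_list[symmetric] atLeast0LessThan)
  finally show ?thesis .
qed

lemma fdet_identity: "fdet n (\<lambda>j k. of_bool (j = k)) = 1"
  by (subst fdet_upper_triangular) auto

lemma fdet_row_linear:
  assumes "a < n"
  obtains C where "\<And>g. fdet n (\<lambda>j k. if j = a then g k else f j k) = (\<Sum>k<n. g k * C k)"
proof
  define C where "C = (\<lambda>k. \<Sum>p | p permutes {..<n}.
      signof p * (of_bool (p a = k) * (\<Prod>j\<in>{..<n} - {a}. f j (p j))))"
  fix g
  have leibniz_term: "(\<Prod>j<n. if j = a then g (p j) else f j (p j)) =
      (\<Sum>k<n. g k * (of_bool (p a = k) * (\<Prod>j\<in>{..<n} - {a}. f j (p j))))" (is "?P = _")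
    if "p permutes {..<n}" for p
  proof -
    have "?P = g (p a) * (\<Prod>j\<in>{..<n} - {a}. f j (p j))"
      using assms by (subst prod.remove[of _ a]) (auto intro!: prod.cong)
    also have "\<dots> = (\<Sum>k<n. if k = p a then g k * (\<Prod>j\<in>{..<n} - {a}. f j (p j)) else 0)"
      using permutes_less[OF that assms] by simp
    also have "\<dots> = (\<Sum>k<n. g k * (of_bool (p a = k) * (\<Prod>j\<in>{..<n} - {a}. f j (p j))))"
      by (rule sum.cong) auto
    finally show ?thesis .
  qed
  show "fdet n (\<lambda>j k. if j = a then g k else f j k) = (\<Sum>k<n. g k * C k)"
    unfolding fdet_leibniz C_def sum_distrib_left
    by (subst sum.swap) (simp add: leibniz_term sum_distrib_left mult.left_commute)
qed

lemma sum_fdet_scale_row: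
  "(\<Sum>a<n. fdet n (\<lambda>j k. (if j = a then c k else 1) * f j k)) = (\<Sum>k<n. c k) * fdet n f"
proof -
  have "(\<Sum>a<n. \<Prod>j<n. (if j = a then c (p j) else 1) * f j (p j)) =
      (\<Sum>k<n. c k) * (\<Prod>j<n. f j (p j))" if "p permutes {..<n}" for p
  proof -
    have "(\<Prod>j<n. if j = a then c (p j) else 1) = c (p a)" if "a < n" for a
      using that by simp
    then have "(\<Sum>a<n. \<Prod>j<n. (if j = a then c (p j) else 1) * f j (p j)) =
        (\<Sum>a<n. c (p a)) * (\<Prod>j<n. f j (p j))"
      by (simp add: prod.distrib sum_distrib_right)
    also have "(\<Sum>a<n. c (p a)) = (\<Sum>k<n. c k)"
      by (rule sum.reindex_bij_betw[OF permutes_imp_bij[OF that]])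
    finally show ?thesis .
  qed
  note sum_leibniz_term = this
  have "(\<Sum>a<n. fdet n (\<lambda>j k. (if j = a then c k else 1) * f j k)) =
      (\<Sum>p | p permutes {..<n}. signof p *
        (\<Sum>a<n. \<Prod>j<n. (if j = a then c (p j) else 1) * f j (p j)))"
    unfolding fdet_leibniz sum_distrib_left by (rule sum.swap)
  also have "\<dots> = (\<Sum>k<n. c k) * fdet n f"
    unfolding fdet_leibniz by (simp add: sum_leibniz_term sum_distrib_left mult.left_commute)
  finally show ?thesis .
qed

subsection \<open>Logarithmic derivatives of products of linear factors\<close>

lemma pderiv_prod_linear:
  fixes \<alpha> \<beta> :: "'t \<Rightarrow> 'a::field"
  assumes "\<And>t. t \<in> T \<Longrightarrow> \<alpha> t + \<beta> t * z \<noteq> 0"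
  defines "P \<equiv> \<Prod>t\<in>T. [:\<alpha> t, \<beta> t:]" and "q \<equiv> \<lambda>t. \<beta> t / (\<alpha> t + \<beta> t * z)"
  shows "poly (pderiv P) z = poly P z * (\<Sum>t\<in>T. q t)"
    and "poly (pderiv (pderiv P)) z = poly P z * ((\<Sum>t\<in>T. q t)\<^sup>2 - (\<Sum>t\<in>T. (q t)\<^sup>2))"
proof -
  have "poly (pderiv P) z = poly P z * (\<Sum>t\<in>T. q t) \<and>
    poly (pderiv (pderiv P)) z = poly P z * ((\<Sum>t\<in>T. q t)\<^sup>2 - (\<Sum>t\<in>T. (q t)\<^sup>2))"
    unfolding P_def using assms(1)
  proof (induction T rule: infinite_finite_induct)
    case (insert t T)
    let ?Q = "\<Prod>t\<in>T. [:\<alpha> t, \<beta> t:]" and ?L = "[:\<alpha> t, \<beta> t:]"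
    define l where "l = poly ?L z"
    have slope: "\<beta> t = l * q t"
      using insert.prems[of t] by (simp add: q_def l_def mult.commute)
    have product_rule: "pderiv (?L * R) = smult (\<beta> t) R + ?L * pderiv R" for R
      unfolding pderiv_mult by (simp add: pderiv_pCons)
    have deriv: "poly (pderiv (?L * R)) z = l * (q t * poly R z + poly (pderiv R) z)" for R
    proof -
      have "poly (pderiv (?L * R)) z = \<beta> t * poly R z + l * poly (pderiv R) z"
        by (simp only: product_rule poly_add poly_mult poly_smult l_def)
      then show ?thesis by (simp only: slope distrib_left mult.assoc)
    qed
    have "poly (pderiv (pderiv (?L * ?Q))) z =
        \<beta> t * poly (pderiv ?Q) z + poly (pderiv (?L * pderiv ?Q)) z"
      by (simp only: product_rule[of ?Q] pderiv_add pderiv_smult poly_add poly_smult)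
    also have "\<dots> = l * (2 * q t * poly (pderiv ?Q) z + poly (pderiv (pderiv ?Q)) z)"
      unfolding deriv by (simp only: slope) (simp add: algebra_simps)
    finally have deriv2: "poly (pderiv (pderiv (?L * ?Q))) z =
        l * (2 * q t * poly (pderiv ?Q) z + poly (pderiv (pderiv ?Q)) z)" .
    have IH: "poly (pderiv ?Q) z = poly ?Q z * (\<Sum>t\<in>T. q t)"
      "poly (pderiv (pderiv ?Q)) z = poly ?Q z * ((\<Sum>t\<in>T. q t)\<^sup>2 - (\<Sum>t\<in>T. (q t)\<^sup>2))"
      using insert by auto
    show ?case
      unfolding prod.insert[OF insert(1,2)] sum.insert[OF insert(1,2)] deriv deriv2 IH poly_mult
        l_def[symmetric]
      by (simp add: power2_eq_square algebra_simps)
  qed auto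
  then show "poly (pderiv P) z = poly P z * (\<Sum>t\<in>T. q t)"
    "poly (pderiv (pderiv P)) z = poly P z * ((\<Sum>t\<in>T. q t)\<^sup>2 - (\<Sum>t\<in>T. (q t)\<^sup>2))"
    by auto
qed

lemma pderiv_sum: "pderiv (sum f I) = (\<Sum>i\<in>I. pderiv (f i))"
  by (induction I rule: infinite_finite_induct) (simp_all add: pderiv_add)

lemma euler_operator_poly:
  fixes P :: "'a::idom poly"
  assumes "degree P < n"
  shows "z * poly (pderiv P) z = (\<Sum>k<n. of_nat k * z ^ k * coeff P k)"
    and "z\<^sup>2 * poly (pderiv (pderiv P)) z = (\<Sum>k<n. of_nat k * (of_nat k - 1) * z ^ k * coeff P k)"
proof -
  have P: "P = (\<Sum>k<n. monom (coeff P k) k)"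
    using poly_as_sum_of_monoms'[of P "n - 1"] assms
    by (simp add: lessThan_Suc_atMost[symmetric])
  have "z * (of_nat k * z ^ (k - 1)) = of_nat k * z ^ k" for k
    by (cases k) (simp_all only: of_nat_0 mult_zero_left mult_zero_right power_Suc diff_Suc_1 mult.left_commute)
  then have monom: "z * poly (pderiv (monom c k)) z = of_nat k * z ^ k * c" for c k
    by (simp add: pderiv_monom poly_monom mult_ac)
  have "z\<^sup>2 * (of_nat k * of_nat (k - 1) * z ^ (k - 1 - 1)) = of_nat k * (of_nat k - 1) * z ^ k" for k
  proof -
    consider "k = 0" | "k = 1" | l where "k = Suc (Suc l)" by (metis One_nat_def not0_implies_Suc)
    then show ?thesis by cases (simp_all add: power2_eq_square algebra_simps)
  qed
  then have monom2: "z\<^sup>2 * poly (pderiv (pderiv (monom c k))) z = of_nat k * (of_nat k - 1) * z ^ k * c" for c k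
    by (simp add: pderiv_monom poly_monom mult_ac)
  show "z * poly (pderiv P) z = (\<Sum>k<n. of_nat k * z ^ k * coeff P k)"
    by (subst P) (simp only: pderiv_sum poly_sum sum_distrib_left monom)
  show "z\<^sup>2 * poly (pderiv (pderiv P)) z = (\<Sum>k<n. of_nat k * (of_nat k - 1) * z ^ k * coeff P k)"
    by (subst P) (simp only: pderiv_sum poly_sum sum_distrib_left monom2)
qed

subsection \<open>Averages over roots of unity\<close>

definition unit_root :: "nat \<Rightarrow> nat \<Rightarrow> complex" where
  "unit_root M s = cis (2 * pi * real s / real M)"

lemma norm_unit_root [simp]: "norm (unit_root M s) = 1"
  by (simp add: unit_root_def)

lemma unit_root_average:
  fixes c :: complex
  assumes "c \<noteq> 0" "p < M" "q < M"
  shows "(\<Sum>s<M. (c * unit_root M s) ^ p / (c * unit_root M s) ^ q) / of_nat M = of_bool (p = q)"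
proof -
  define \<omega> where "\<omega> = unit_root M 1"
  define \<eta> where "\<eta> = \<omega> ^ p / \<omega> ^ q"
  have power_\<omega>: "\<omega> ^ s = unit_root M s" for s
    unfolding \<omega>_def unit_root_def Complex.DeMoivre by (simp add: mult.commute)
  have "\<omega> \<noteq> 0" by (simp add: \<omega>_def unit_root_def)
  have "(c * unit_root M s) ^ p / (c * unit_root M s) ^ q = c ^ p / c ^ q * \<eta> ^ s" for s
    by (simp add: \<eta>_def power_mult_distrib power_divide flip: power_\<omega> power_mult)
      (simp add: mult.commute)
  then have sum: "(\<Sum>s<M. (c * unit_root M s) ^ p / (c * unit_root M s) ^ q) = c ^ p / c ^ q * (\<Sum>s<M. \<eta> ^ s)"
    by (simp add: sum_distrib_left)
  show ?thesis
  proof (cases "p = q")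
    case True
    then have "\<eta> = 1" using \<open>\<omega> \<noteq> 0\<close> by (simp add: \<eta>_def)
    then show ?thesis using True assms unfolding sum by simp
  next
    case False
    have "inj_on (unit_root M) {..<M}"
      using Complex.bij_betw_roots_unity[of M] assms(2) unfolding unit_root_def[abs_def] by (auto simp: bij_betw_def)
    then have "\<omega> ^ p \<noteq> \<omega> ^ q" using False assms by (auto simp: power_\<omega> dest: inj_onD)
    then have "\<eta> \<noteq> 1" using \<open>\<omega> \<noteq> 0\<close> by (simp add: \<eta>_def)
    moreover have "\<omega> ^ M = 1" using assms(2) by (simp add: power_\<omega> unit_root_def)
    moreover have "\<eta> ^ M = (\<omega> ^ M) ^ p / (\<omega> ^ M) ^ q"
      unfolding \<eta>_def power_divide power_mult[symmetric] by (simp only: mult.commute)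
    ultimately show ?thesis using False unfolding sum by (simp add: geometric_sum)
  qed
qed

lemma coeff_circle_average:
  fixes P :: "complex poly"
  assumes "degree P < M" "k < M"
  shows "coeff P k = (\<Sum>s<M. poly P (unit_root M s) / unit_root M s ^ k) / of_nat M"
proof -
  have "poly P z = (\<Sum>l<M. coeff P l * z ^ l)" for z
    unfolding poly_altdef using assms(1) by (intro sum.mono_neutral_left) (auto simp: coeff_eq_0)
  then have "(\<Sum>s<M. poly P (unit_root M s) / unit_root M s ^ k) / of_nat M =
      (\<Sum>s<M. \<Sum>l<M. coeff P l * (unit_root M s ^ l / unit_root M s ^ k)) / of_nat M"
    by (simp add: sum_divide_distrib)
  also have "\<dots> = (\<Sum>l<M. coeff P l * ((\<Sum>s<M. unit_root M s ^ l / unit_root M s ^ k) / of_nat M))"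
    by (subst sum.swap) (simp add: sum_distrib_left sum_divide_distrib)
  also have "\<dots> = (\<Sum>l<M. coeff P l * of_bool (l = k))"
    using unit_root_average[of 1 _ M k] assms(2) by (intro sum.cong) auto
  also have "\<dots> = coeff P k"
    using assms(2) by (simp add: of_bool_def if_distrib cong: if_cong)
  finally show ?thesis ..
qed

subsection \<open>Vandermonde determinants\<close>

definition vandermonde :: "nat \<Rightarrow> (nat \<Rightarrow> 'a::comm_ring_1) \<Rightarrow> 'a" where
  "vandermonde n x = fdet n (\<lambda>j k. x j ^ k)"

lemma vandermonde_0 [simp]: "vandermonde 0 x = 1"
  by (simp add: vandermonde_def fdet_leibniz)

lemma vandermonde_cong: "(\<And>j. j < n \<Longrightarrow> x j = y j) \<Longrightarrow> vandermonde n x = vandermonde n y"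
  unfolding vandermonde_def by (rule fdet_cong) simp

lemma vandermonde_permute:
  "p permutes {..<n} \<Longrightarrow> vandermonde n (\<lambda>j. x (p j)) = signof p * vandermonde n x"
  unfolding vandermonde_def using fdet_permute_rows[of p n "\<lambda>j k. x j ^ k"] .

lemma vandermonde_Suc:
  fixes x :: "nat \<Rightarrow> 'a::idom"
  shows "vandermonde (Suc n) x = vandermonde n x * (\<Prod>i<n. x n - x i)"
proof -
  define P where "P = (\<Prod>i<n. [:- x i, 1:])"
  define p where "p = (\<lambda>k. if k < n then monom 1 k else P)"
  have degree_p: "degree (p k) = k" and lead_p: "coeff (p k) k = 1" if "k < Suc n" for k
  proof -
    have "degree P = n" unfolding P_def by (simp add: degree_prod_eq_sum_degree)
    moreover from this have "coeff P n = 1" using lead_coeff_prod[of "\<lambda>i. [:- x i, 1:]" "{..<n}"]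
      by (simp add: P_def)
    ultimately show "degree (p k) = k" "coeff (p k) k = 1"
      using that by (auto simp: p_def degree_monom_eq less_Suc_eq)
  qed
  have poly_p: "poly (p k) (x j) = (\<Sum>l<Suc n. x j ^ l * coeff (p k) l)" if "k < Suc n" for j k
  proof -
    have "poly (p k) (x j) = (\<Sum>l\<le>k. coeff (p k) l * x j ^ l)"
      by (simp add: poly_altdef degree_p that)
    also have "\<dots> = (\<Sum>l<Suc n. coeff (p k) l * x j ^ l)"
      by (rule sum.mono_neutral_left) (use that in \<open>auto simp: coeff_eq_0 degree_p\<close>)
    finally show ?thesis by (simp only: mult.commute)
  qed
  have "fdet (Suc n) (\<lambda>j k. poly (p k) (x j)) =
      vandermonde (Suc n) x * fdet (Suc n) (\<lambda>l k. coeff (p k) l)"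
    unfolding vandermonde_def fdet_mult[symmetric] by (rule fdet_cong) (rule poly_p)
  also have "fdet (Suc n) (\<lambda>l k. coeff (p k) l) = (\<Prod>k<Suc n. coeff (p k) k)"
    by (rule fdet_upper_triangular) (simp add: coeff_eq_0 degree_p)
  also have "\<dots> = 1" by (rule prod.neutral) (use lead_p in auto)
  finally have "vandermonde (Suc n) x = fdet (n + 1) (\<lambda>j k. poly (p k) (x j))" by simp
  also have "\<dots> = fdet n (\<lambda>j k. poly (p k) (x j)) * fdet 1 (\<lambda>j k. poly (p (n + k)) (x (n + j)))"
    by (rule fdet_block_lower) (auto simp: p_def P_def poly_prod)
  also have "fdet n (\<lambda>j k. poly (p k) (x j)) = vandermonde n x"
    unfolding vandermonde_def by (rule fdet_cong) (simp add: p_def poly_monom)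
  also have "fdet 1 (\<lambda>j k. poly (p (n + k)) (x (n + j))) = (\<Prod>i<n. x n - x i)"
    by (simp add: fdet_upper_triangular p_def P_def poly_prod)
  finally show ?thesis .
qed

lemma vandermonde_nonzero:
  fixes x :: "nat \<Rightarrow> 'a::idom"
  assumes "inj_on x {..<n}"
  shows "vandermonde n x \<noteq> 0"
  using assms
proof (induction n)
  case (Suc n)
  then have "x n \<noteq> x i" if "i < n" for i using that by (auto dest: inj_onD)
  with Suc show ?case by (auto simp: vandermonde_Suc inj_on_def)
qed simp

definition append_seq :: "nat \<Rightarrow> (nat \<Rightarrow> 'a) \<Rightarrow> (nat \<Rightarrow> 'a) \<Rightarrow> nat \<Rightarrow> 'a" where
  "append_seq r w x j = (if j < r then w j else x (j - r))"

lemma append_seq_simps [simp]: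
  "j < r \<Longrightarrow> append_seq r w x j = w j" "append_seq r w x (r + j) = x j"
  by (simp_all add: append_seq_def)

lemma lessThan_add_eq: "{..<r + n} = {..<r} \<union> (+) r ` {..<n}" for r n :: nat
proof (intro equalityI subsetI)
  fix j assume "j \<in> {..<r + n}"
  then show "j \<in> {..<r} \<union> (+) r ` {..<n}"
    by (cases "j < r") (auto intro!: image_eqI[of _ _ "j - r"])
qed auto

lemma vandermonde_append:
  fixes w x :: "nat \<Rightarrow> 'a::idom"
  shows "vandermonde (r + n) (append_seq r w x) =
    vandermonde r w * vandermonde n x * (\<Prod>a<n. \<Prod>i<r. x a - w i)"
proof (induction n)
  case 0
  show ?case by (simp add: vandermonde_cong[of r "append_seq r w x" w])
next
  case (Suc n)
  have "(\<Prod>i<r+n. x n - append_seq r w x i) = (\<Prod>i<r. x n - w i) * (\<Prod>i<n. x n - x i)"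
    unfolding lessThan_add_eq by (subst prod.union_disjoint) (auto simp: prod.reindex)
  with Suc show ?case by (simp add: vandermonde_Suc mult_ac)
qed

lemma vandermonde_fun_upd:
  fixes x :: "nat \<Rightarrow> 'a::idom"
  assumes a: "a < n"
  obtains K where "\<And>z. vandermonde n (x(a := z)) = K * (\<Prod>b\<in>{..<n} - {a}. z - x b)"
proof -
  obtain m where n: "n = Suc m" using a by (cases n) auto
  define p where "p = Transposition.transpose a m"
  have p: "p permutes {..<n}" unfolding p_def by (rule permutes_swap_id) (use a n in auto)
  have bij: "bij_betw p {..<m} ({..<n} - {a})"
    by (rule bij_betwI[of _ _ _ p]) (use a n in \<open>auto simp: p_def Transposition.transpose_def\<close>)
  have "vandermonde n (x(a := z)) =
      signof p * vandermonde m (\<lambda>j. x (p j)) * (\<Prod>b\<in>{..<n} - {a}. z - x b)" for z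
  proof -
    have "vandermonde n (\<lambda>j. (x(a := z)) (p j)) = vandermonde m (\<lambda>j. x (p j)) * (\<Prod>i<m. z - x (p i))"
      unfolding n vandermonde_Suc using a n
      by (intro arg_cong2[where f = "(*)"] vandermonde_cong prod.cong)
        (auto simp: p_def Transposition.transpose_def)
    also have "(\<Prod>i<m. z - x (p i)) = (\<Prod>b\<in>{..<n} - {a}. z - x b)"
      by (rule prod.reindex_bij_betw[OF bij])
    finally have "signof p * vandermonde n (x(a := z)) =
        vandermonde m (\<lambda>j. x (p j)) * (\<Prod>b\<in>{..<n} - {a}. z - x b)"
      unfolding vandermonde_permute[OF p] .
    moreover have "vandermonde n (x(a := z)) = signof p * (signof p * vandermonde n (x(a := z)))"
      by (simp add: sign_def)
    ultimately show ?thesis by (simp only: mult.assoc)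
  qed
  then show ?thesis by (rule that)
qed

definition pole_sum :: "'i set \<Rightarrow> ('i \<Rightarrow> 'a::field) \<Rightarrow> 'a \<Rightarrow> 'a" where
  "pole_sum B x z = (\<Sum>b\<in>B. z / (z - x b))"

definition pole_quad :: "'i set \<Rightarrow> ('i \<Rightarrow> 'a::field) \<Rightarrow> 'a \<Rightarrow> 'a" where
  "pole_quad B x z = (pole_sum B x z)\<^sup>2 - (\<Sum>b\<in>B. (z / (z - x b))\<^sup>2)"

lemma vandermonde_weighted_row:
  fixes x :: "nat \<Rightarrow> 'a::field_char_0"
  assumes a: "a < n"
  obtains K where "vandermonde n x = poly (smult K (\<Prod>b\<in>{..<n} - {a}. [:- x b, 1:])) (x a)"
    and "degree (smult K (\<Prod>b\<in>{..<n} - {a}. [:- x b, 1:])) < n"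
    and "\<And>c. fdet n (\<lambda>j k. (if j = a then c k else 1) * x j ^ k) =
      (\<Sum>k<n. c k * x a ^ k * coeff (smult K (\<Prod>b\<in>{..<n} - {a}. [:- x b, 1:])) k)"
proof -
  obtain K where K: "\<And>z. vandermonde n (x(a := z)) = K * (\<Prod>b\<in>{..<n} - {a}. z - x b)"
    by (rule vandermonde_fun_upd[OF a, of x]) (rule that)
  obtain C where C: "\<And>g. fdet n (\<lambda>j k. if j = a then g k else x j ^ k) = (\<Sum>k<n. g k * C k)"
    by (rule fdet_row_linear[OF a, of "\<lambda>j k. x j ^ k"]) (rule that)
  define P where "P = smult K (\<Prod>b\<in>{..<n} - {a}. [:- x b, 1:])"
  have vandermonde_poly: "vandermonde n (x(a := z)) = poly P z" for z
    by (simp add: K P_def poly_prod)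
  have "poly P z = poly (\<Sum>k<n. monom (C k) k) z" for z
  proof -
    have "poly P z = fdet n (\<lambda>j k. if j = a then z ^ k else x j ^ k)"
      unfolding vandermonde_poly[symmetric] vandermonde_def by (rule fdet_cong) simp
    then show ?thesis by (simp add: C poly_sum poly_monom mult.commute)
  qed
  then have expansion: "P = (\<Sum>k<n. monom (C k) k)"
    by (simp add: poly_eq_poly_eq_iff[symmetric] fun_eq_iff)
  have "vandermonde n x = poly P (x a)"
    unfolding vandermonde_poly[symmetric] by simp
  moreover have "degree P < n"
    unfolding expansion using a by (intro degree_sum_less) (auto intro: le_less_trans[OF degree_monom_le])
  moreover have "fdet n (\<lambda>j k. (if j = a then c k else 1) * x j ^ k) =
      (\<Sum>k<n. c k * x a ^ k * coeff P k)" for c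
  proof -
    have "fdet n (\<lambda>j k. (if j = a then c k else 1) * x j ^ k) =
        fdet n (\<lambda>j k. if j = a then c k * x a ^ k else x j ^ k)"
      by (rule fdet_cong) simp
    also have "\<dots> = (\<Sum>k<n. c k * x a ^ k * coeff P k)"
      unfolding C by (rule sum.cong) (simp_all add: expansion coeff_sum)
    finally show ?thesis .
  qed
  ultimately show ?thesis unfolding P_def by (rule that)
qed

lemma vandermonde_quadratic_row:
  fixes x :: "nat \<Rightarrow> 'a::field_char_0"
  assumes a: "a < n" and distinct: "\<And>b. b < n \<Longrightarrow> b \<noteq> a \<Longrightarrow> x a \<noteq> x b"
  shows "fdet n (\<lambda>j k. (if j = a then of_nat k * (of_nat k - 1) + \<beta> * of_nat k + \<gamma> else 1) * x j ^ k) =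
    vandermonde n x * (pole_quad ({..<n} - {a}) x (x a) + \<beta> * pole_sum ({..<n} - {a}) x (x a) + \<gamma>)"
proof -
  let ?B = "{..<n} - {a}"
  define P where "P = (\<Prod>b\<in>?B. [:- x b, 1:])"
  obtain K where poly: "vandermonde n x = poly (smult K P) (x a)" and degree: "degree (smult K P) < n"
    and row: "\<And>c. fdet n (\<lambda>j k. (if j = a then c k else 1) * x j ^ k) =
      (\<Sum>k<n. c k * x a ^ k * coeff (smult K P) k)"
    by (rule vandermonde_weighted_row[OF a, of x, folded P_def]) (rule that)
  have factor_nonzero: "- x b + 1 * x a \<noteq> 0" if "b \<in> ?B" for b
    using distinct[of b] that by auto
  have sum: "vandermonde n x * pole_sum ?B x (x a) = x a * poly (pderiv (smult K P)) (x a)"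
    using pderiv_prod_linear(1)[of ?B "\<lambda>b. - x b" "\<lambda>_. 1" "x a", OF factor_nonzero]
    by (simp add: poly pderiv_smult pole_sum_def sum_distrib_left mult_ac P_def[symmetric])
  have quad: "vandermonde n x * pole_quad ?B x (x a) = (x a)\<^sup>2 * poly (pderiv (pderiv (smult K P))) (x a)"
  proof -
    have "pole_quad ?B x (x a) =
        (x a)\<^sup>2 * ((\<Sum>b\<in>?B. 1 / (x a - x b))\<^sup>2 - (\<Sum>b\<in>?B. (1 / (x a - x b))\<^sup>2))"
      unfolding pole_quad_def pole_sum_def right_diff_distrib power_mult_distrib[symmetric] sum_distrib_left
      by simp
    then show ?thesis
      using pderiv_prod_linear(2)[of ?B "\<lambda>b. - x b" "\<lambda>_. 1" "x a", OF factor_nonzero]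
      by (simp add: poly pderiv_smult P_def[symmetric])
  qed
  have "vandermonde n x = (\<Sum>k<n. x a ^ k * coeff (smult K P) k)"
    using row[of "\<lambda>_. 1"] by (simp add: vandermonde_def)
  then show ?thesis
    unfolding row distrib_left mult.left_commute[of _ \<beta>] sum quad euler_operator_poly[OF degree]
      mult.commute[of _ \<gamma>]
    by (simp only: distrib_right sum.distrib sum_distrib_left mult.assoc)
qed

lemma sum_quadratic_poles:
  fixes x :: "nat \<Rightarrow> 'a::field_char_0"
  assumes "inj_on x {..<n}"
  shows "(\<Sum>a<n. pole_quad ({..<n} - {a}) x (x a) + \<beta> * pole_sum ({..<n} - {a}) x (x a) + \<gamma>) =
    (\<Sum>k<n. of_nat k * (of_nat k - 1) + \<beta> * of_nat k + \<gamma>)"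
proof -
  have "vandermonde n x *
      (\<Sum>a<n. pole_quad ({..<n} - {a}) x (x a) + \<beta> * pole_sum ({..<n} - {a}) x (x a) + \<gamma>) =
    (\<Sum>a<n. fdet n (\<lambda>j k. (if j = a then of_nat k * (of_nat k - 1) + \<beta> * of_nat k + \<gamma> else 1) * x j ^ k))"
    unfolding sum_distrib_left
    by (intro sum.cong refl vandermonde_quadratic_row[symmetric]) (use inj_onD[OF assms] in auto)
  also have "\<dots> = vandermonde n x * (\<Sum>k<n. of_nat k * (of_nat k - 1) + \<beta> * of_nat k + \<gamma>)"
    unfolding sum_fdet_scale_row vandermonde_def by (rule mult.commute)
  finally show ?thesis
    using vandermonde_nonzero[OF assms] by simp
qed

subsection \<open>Alternants and their circle averages\<close>

definition staircase :: "nat \<Rightarrow> nat \<Rightarrow> int" where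
  "staircase n k = int (n - 1 - k)"

definition alternant :: "nat \<Rightarrow> (nat \<Rightarrow> int) \<Rightarrow> (nat \<Rightarrow> complex) \<Rightarrow> complex" where
  "alternant n e x = fdet n (\<lambda>j k. x j powi e k)"

lemma schur_num_alternant:
  "schur_num l = alternant (length l) (\<lambda>k. staircase (length l) k + l ! k)"
  by (rule ext) (simp add: schur_num_def alternant_def fdet_def staircase_def Let_def)

lemma schur_den_alternant: "schur_den n = alternant n (staircase n)"
  by (rule ext) (simp add: schur_den_def alternant_def fdet_def staircase_def)

definition reversal :: "nat \<Rightarrow> nat \<Rightarrow> nat" where
  "reversal n k = (if k < n then n - 1 - k else k)"

lemma reversal_permutes: "reversal n permutes {..<n}"
  by (rule bij_imp_permutes) (auto simp: reversal_def intro: bij_betwI[of _ _ _ "reversal n"])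

lemma schur_den_vandermonde: "schur_den n x = signof (reversal n) * vandermonde n x"
proof -
  have "schur_den n x = fdet n (\<lambda>j k. x j ^ reversal n k)"
    unfolding schur_den_def fdet_def[symmetric] by (rule fdet_cong) (simp add: reversal_def)
  then show ?thesis
    using fdet_permute_cols[OF reversal_permutes, of n "\<lambda>j k. x j ^ k"] by (simp add: vandermonde_def)
qed

lemma schur_den_nonzero: "inj_on x {..<n} \<Longrightarrow> schur_den n x \<noteq> 0"
  by (simp add: schur_den_vandermonde vandermonde_nonzero sign_def)

lemma alternant_not_inj:
  assumes "\<not> inj_on e {..<n}"
  shows "alternant n e x = 0"
proof -
  from assms obtain i k where "i < n" "k < n" "i \<noteq> k" "e i = e k"
    by (auto simp: inj_on_def)
  then show ?thesis unfolding alternant_def by (intro fdet_identical_cols[of i n k]) auto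
qed

lemma permutes_extending_inj:
  fixes r n :: nat
  assumes inj: "inj_on E {..<n}" and image: "E ` {..<n} \<subseteq> {..<r + n}"
  obtains p where "p permutes {..<r + n}" "\<And>k. k < n \<Longrightarrow> p (r + k) = E k"
proof -
  let ?C = "{..<r + n} - E ` {..<n}"
  have "card ?C = r"
    using image by (simp add: card_Diff_subset card_image[OF inj])
  then obtain h where h: "bij_betw h {..<r} ?C"
    using finite_same_card_bij[of "{..<r}" ?C] by auto
  define p where "p = (\<lambda>j. if j < r + n then append_seq r h E j else j)"
  have "bij_betw p {..<r} ?C"
    using h by (rule bij_betw_cong[THEN iffD1, rotated]) (simp add: p_def)
  moreover have "bij_betw p ((+) r ` {..<n}) (E ` {..<n})"
  proof (rule bij_betw_imageI)
    show "inj_on p ((+) r ` {..<n})" by (auto simp: p_def inj_on_def dest: inj_onD[OF inj])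
    show "p ` (+) r ` {..<n} = E ` {..<n}"
      unfolding image_image by (rule image_cong) (auto simp: p_def)
  qed
  ultimately have "bij_betw p {..<r + n} {..<r + n}"
    using bij_betw_combine[of p "{..<r}" ?C "(+) r ` {..<n}" "E ` {..<n}"] image
    by (simp add: lessThan_add_eq[symmetric] Un_absorb2 Diff_disjoint Int_commute)
  then have "p permutes {..<r + n}" by (rule bij_imp_permutes) (simp add: p_def)
  then show ?thesis by (rule that) (simp add: p_def)
qed

definition circle_index :: "nat \<Rightarrow> nat \<Rightarrow> (nat \<Rightarrow> nat) set" where
  "circle_index r n = PiE {..<r + n} (\<lambda>i. if i < r then {..<r + n} else {0})"

definition circle_point :: "nat \<Rightarrow> nat \<Rightarrow> (nat \<Rightarrow> nat) \<Rightarrow> nat \<Rightarrow> complex" where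
  "circle_point r n \<tau> i = of_nat (i + 2) * unit_root (r + n) (\<tau> i)"

definition circle_coeff :: "nat \<Rightarrow> nat \<Rightarrow> (nat \<Rightarrow> nat) \<Rightarrow> (nat \<Rightarrow> nat) \<Rightarrow> complex" where
  "circle_coeff r n p \<tau> = (\<Prod>i<r+n. if i < r then 1 / (circle_point r n \<tau> i ^ p i * of_nat (r + n)) else 1) * signof p"

lemma norm_circle_point: "norm (circle_point r n \<tau> i) = real i + 2"
  unfolding circle_point_def norm_mult norm_of_nat norm_unit_root by simp

lemma inj_circle_point: "inj_on (circle_point r n \<tau>) I"
  by (rule inj_onI) (metis norm_circle_point add_right_cancel of_nat_eq_iff)

text \<open>Averaging the \<open>i\<close>-th of the first \<open>r\<close> rows of \<open>vandermonde (r + n) (append_seq r w x)\<close> against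
  \<open>w i ^ p i\<close> replaces it by the \<open>p i\<close>-th unit vector. The circles have different radii, so that the
  points \<open>w i\<close> are always distinct.\<close>

lemma weighted_alternant_circle_average:
  fixes d :: "nat \<Rightarrow> nat \<Rightarrow> complex"
  assumes p: "p permutes {..<r + n}"
  shows "(\<Prod>i<r. d i (p i)) * fdet n (\<lambda>j k. x j ^ p (r + k)) =
    (\<Sum>\<tau>\<in>circle_index r n. circle_coeff r n p \<tau> *
      fdet (r + n) (\<lambda>j k. (if j < r then d j k else 1) * append_seq r (circle_point r n \<tau>) x j ^ k))"
proof -
  define M where "M = r + n"
  define W where "W = (\<lambda>i s. complex_of_nat (i + 2) * unit_root M s)"
  define S where "S = (\<lambda>i. if i < r then {..<M} else {0})"
  define g where "g = (\<lambda>s j k. if j < r then d j (p k) * (W j s ^ p k / W j s ^ p j) / of_nat M else x (j - r) ^ p k)"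
  let ?y = "\<lambda>\<tau>. append_seq r (circle_point r n \<tau>) x"
  have row_average: "(\<Sum>s\<in>S j. g s j k) = (if j < r then d j (p j) * of_bool (j = k) else x (j - r) ^ p k)"
    if "j < M" "k < M" for j k
  proof (cases "j < r")
    case True
    have "complex_of_nat (j + 2) \<noteq> 0" unfolding of_nat_eq_0_iff by simp
    then have "(\<Sum>s<M. W j s ^ p k / W j s ^ p j) / of_nat M = of_bool (p k = p j)"
      using unit_root_average[of "of_nat (j + 2)" "p k" M "p j"] permutes_less[OF p] that
      by (simp add: W_def M_def)
    moreover have "(\<Sum>s\<in>S j. g s j k) = d j (p k) * ((\<Sum>s<M. W j s ^ p k / W j s ^ p j) / of_nat M)"
      using True by (simp add: S_def g_def sum_distrib_left sum_divide_distrib)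
    ultimately show ?thesis using True permutes_inj[OF p] by (auto dest: injD)
  qed (simp add: S_def g_def)
  have "(\<Prod>i<r. d i (p i)) * fdet n (\<lambda>j k. x j ^ p (r + k)) =
      fdet r (\<lambda>j k. d j (p j) * of_bool (j = k)) * fdet n (\<lambda>j k. x j ^ p (r + k))"
    by (simp add: fdet_scale_rows fdet_identity)
  also have "\<dots> = fdet M (\<lambda>j k. if j < r then d j (p j) * of_bool (j = k) else x (j - r) ^ p k)"
    unfolding M_def by (subst fdet_block_lower) (auto intro!: arg_cong2[where f = "(*)"] fdet_cong)
  also have "\<dots> = fdet M (\<lambda>j k. \<Sum>s\<in>S j. g s j k)"
    by (rule fdet_cong) (rule row_average[symmetric])
  also have "\<dots> = (\<Sum>\<tau>\<in>circle_index r n. fdet M (\<lambda>j k. g (\<tau> j) j k))"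
    unfolding circle_index_def M_def[symmetric] S_def[symmetric]
    by (rule fdet_sum_rows) (simp add: S_def)
  also have "\<dots> = (\<Sum>\<tau>\<in>circle_index r n. circle_coeff r n p \<tau> *
      fdet (r + n) (\<lambda>j k. (if j < r then d j k else 1) * ?y \<tau> j ^ k))"
  proof (rule sum.cong[OF refl])
    fix \<tau>
    let ?a = "\<lambda>j. if j < r then 1 / (circle_point r n \<tau> j ^ p j * of_nat (r + n)) else 1"
    have "fdet M (\<lambda>j k. g (\<tau> j) j k) =
        fdet (r + n) (\<lambda>j k. ?a j * ((if j < r then d j (p k) else 1) * ?y \<tau> j ^ p k))"
      unfolding M_def by (rule fdet_cong) (auto simp: g_def W_def M_def append_seq_def circle_point_def)
    then show "fdet M (\<lambda>j k. g (\<tau> j) j k) = circle_coeff r n p \<tau> *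
        fdet (r + n) (\<lambda>j k. (if j < r then d j k else 1) * ?y \<tau> j ^ k)"
      using fdet_permute_cols[OF p, of "\<lambda>j k. (if j < r then d j k else 1) * ?y \<tau> j ^ k"]
      by (simp only: fdet_scale_rows circle_coeff_def mult.assoc)
  qed
  finally show ?thesis .
qed

lemma alternant_circle_average:
  assumes "p permutes {..<r + n}"
  shows "fdet n (\<lambda>j k. x j ^ p (r + k)) =
    (\<Sum>\<tau>\<in>circle_index r n. circle_coeff r n p \<tau> * vandermonde (r + n) (append_seq r (circle_point r n \<tau>) x))"
  using weighted_alternant_circle_average[OF assms, of "\<lambda>_ _. 1"] by (simp add: vandermonde_def)

subsection \<open>The Casimir operator on alternants\<close>

definition energy :: "nat \<Rightarrow> 'a::comm_ring_1 \<Rightarrow> 'a" where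
  "energy n t = t * (t - (of_nat n - 1))"

lemma of_int_energy: "of_int (energy n t) = energy n (of_int t)"
  by (simp add: energy_def)

definition pole_ratio :: "(nat \<Rightarrow> complex) \<Rightarrow> (nat \<Rightarrow> complex) \<Rightarrow> nat \<Rightarrow> nat \<Rightarrow> complex" where
  "pole_ratio w x i a = x a / (w i - x a)"

definition casimir_defect :: "nat \<Rightarrow> nat \<Rightarrow> nat \<Rightarrow> (nat \<Rightarrow> complex) \<Rightarrow> (nat \<Rightarrow> complex) \<Rightarrow> complex" where
  "casimir_defect n m r w x = (let s = pole_ratio w x in
     ((\<Sum>i<r. \<Sum>a<n. s i a)\<^sup>2 - (\<Sum>i<r. \<Sum>a<n. (s i a)\<^sup>2)) -
     (\<Sum>i<r. \<Sum>j\<in>{..<r} - {i}. (\<Sum>a<n. s i a) * (\<Sum>a<n. s j a) + (\<Sum>a<n. s i a * s j a)) +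
     (of_nat n - 2 * of_nat m) * (\<Sum>i<r. \<Sum>a<n. s i a) - of_nat (m\<^sup>2 * n))"

lemma sum_off_diagonal:
  fixes f :: "'i \<Rightarrow> 'i \<Rightarrow> 'a::ab_group_add"
  assumes "finite I"
  shows "(\<Sum>i\<in>I. \<Sum>j\<in>I - {i}. f i j) = (\<Sum>i\<in>I. \<Sum>j\<in>I. f i j) - (\<Sum>i\<in>I. f i i)"
  using assms by (simp add: sum_diff1 flip: sum_subtractf)

lemma sum_off_diagonal_swap:
  fixes f :: "'i \<Rightarrow> 'i \<Rightarrow> 'a::ab_group_add"
  assumes "finite I"
  shows "(\<Sum>i\<in>I. \<Sum>j\<in>I - {i}. f i j) = (\<Sum>i\<in>I. \<Sum>j\<in>I - {i}. f j i)"
  unfolding sum_off_diagonal[OF assms] by (subst sum.swap) simp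

text \<open>The poles at \<open>w i = w j\<close> cancel in pairs.\<close>

lemma sum_pole_sum_mult_pole_sum:
  fixes w x :: "nat \<Rightarrow> complex"
  assumes "inj_on w {..<r}" "\<And>i a. i < r \<Longrightarrow> a < n \<Longrightarrow> w i \<noteq> x a"
  shows "2 * (\<Sum>i<r. pole_sum ({..<r} - {i}) w (w i) * pole_sum {..<n} x (w i)) =
    (\<Sum>i<r. \<Sum>j\<in>{..<r} - {i}. of_nat n - (\<Sum>a<n. pole_ratio w x i a * pole_ratio w x j a))"
proof -
  define t where "t = (\<lambda>i a. w i / (w i - x a))"
  have pair: "w i / (w i - w j) * t i a + w j / (w j - w i) * t j a =
      1 - pole_ratio w x i a * pole_ratio w x j a"
    if "i < r" "j < r" "i \<noteq> j" "a < n" for i j a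
  proof -
    have "w i - w j \<noteq> 0" "w i - x a \<noteq> 0" "w j - x a \<noteq> 0"
      using assms that by (auto dest: inj_onD)
    moreover have "w j / (w j - w i) = - (w j / (w i - w j))"
      by (metis minus_diff_eq divide_minus_right)
    ultimately show ?thesis
      unfolding t_def pole_ratio_def by (simp add: divide_simps) (simp add: algebra_simps)
  qed
  have "(\<Sum>i<r. pole_sum ({..<r} - {i}) w (w i) * pole_sum {..<n} x (w i)) =
      (\<Sum>i<r. \<Sum>j\<in>{..<r} - {i}. \<Sum>a<n. w i / (w i - w j) * t i a)" (is "?S = ?D")
    by (simp add: pole_sum_def sum_product t_def)
  moreover have "?D = (\<Sum>i<r. \<Sum>j\<in>{..<r} - {i}. \<Sum>a<n. w j / (w j - w i) * t j a)"
    by (rule sum_off_diagonal_swap) simp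
  ultimately have "2 * ?S = (\<Sum>i<r. \<Sum>j\<in>{..<r} - {i}. \<Sum>a<n.
      w i / (w i - w j) * t i a + w j / (w j - w i) * t j a)"
    by (simp add: sum.distrib)
  also have "\<dots> = (\<Sum>i<r. \<Sum>j\<in>{..<r} - {i}. \<Sum>a<n. 1 - pole_ratio w x i a * pole_ratio w x j a)"
    by (intro sum.cong refl pair) auto
  finally show ?thesis by (simp add: sum_subtractf)
qed

lemma pole_sum_ratio:
  assumes "\<And>a. a < n \<Longrightarrow> w i \<noteq> x a"
  defines "s \<equiv> pole_ratio w x i"
  shows "pole_sum {..<n} x (w i) = of_nat n + (\<Sum>a<n. s a)"
    and "pole_quad {..<n} x (w i) = of_nat n * (of_nat n - 1) + (2 * of_nat n - 2) * (\<Sum>a<n. s a) +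
      ((\<Sum>a<n. s a)\<^sup>2 - (\<Sum>a<n. (s a)\<^sup>2))"
proof -
  have shift: "w i / (w i - x a) = 1 + s a" if "a < n" for a
    using assms(1)[OF that] by (simp add: s_def pole_ratio_def field_simps)
  show sum: "pole_sum {..<n} x (w i) = of_nat n + (\<Sum>a<n. s a)"
    unfolding pole_sum_def by (simp add: shift sum.distrib)
  have "(\<Sum>a<n. (w i / (w i - x a))\<^sup>2) = (\<Sum>a<n. 1 + 2 * s a + (s a)\<^sup>2)"
    by (rule sum.cong) (simp_all add: shift power2_eq_square algebra_simps)
  then have "(\<Sum>a<n. (w i / (w i - x a))\<^sup>2) = of_nat n + 2 * (\<Sum>a<n. s a) + (\<Sum>a<n. (s a)\<^sup>2)"
    by (simp add: sum.distrib sum_distrib_left)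
  then show "pole_quad {..<n} x (w i) = of_nat n * (of_nat n - 1) + (2 * of_nat n - 2) * (\<Sum>a<n. s a) +
      ((\<Sum>a<n. s a)\<^sup>2 - (\<Sum>a<n. (s a)\<^sup>2))"
    unfolding pole_quad_def sum by (simp add: power2_eq_square algebra_simps)
qed

lemma pole_sum_append:
  "i < r \<Longrightarrow> pole_sum ({..<r + n} - {i}) (append_seq r w x) z =
    pole_sum ({..<r} - {i}) w z + pole_sum {..<n} x z" (is "_ \<Longrightarrow> ?sum")
  "i < r \<Longrightarrow> pole_quad ({..<r + n} - {i}) (append_seq r w x) z =
    pole_quad ({..<r} - {i}) w z + 2 * (pole_sum ({..<r} - {i}) w z * pole_sum {..<n} x z) +
    pole_quad {..<n} x z" (is "_ \<Longrightarrow> ?quad")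
proof -
  have split: "(\<Sum>b\<in>{..<r + n} - {i}. g (append_seq r w x b)) =
      (\<Sum>b\<in>{..<r} - {i}. g (w b)) + (\<Sum>b<n. g (x b))" if "i < r" for g :: "_ \<Rightarrow> 'a"
  proof -
    have "{..<r + n} - {i} = ({..<r} - {i}) \<union> (+) r ` {..<n}"
      using that unfolding lessThan_add_eq by auto
    then show ?thesis
      by (subst \<open>_ = _\<close>, subst sum.union_disjoint) (auto simp: sum.reindex)
  qed
  show "i < r \<Longrightarrow> ?sum" unfolding pole_sum_def by (rule split)
  then show "i < r \<Longrightarrow> ?quad"
    unfolding pole_quad_def using split[of "\<lambda>b. (z / (z - b))\<^sup>2"]
    by (simp add: power2_sum)
qed

lemma sum_shifted_energy:
  "(\<Sum>k<n. energy n (of_nat k + d) - energy n (of_nat k)) = (of_nat n * d\<^sup>2 :: 'a::comm_ring_1)"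
proof -
  have "energy n (of_nat k + d) - energy n (of_nat k) = 2 * d * of_nat k + (d\<^sup>2 - d * (of_nat n - 1))" for k
    by (simp add: energy_def power2_eq_square algebra_simps)
  then have "(\<Sum>k<n. energy n (of_nat k + d) - energy n (of_nat k)) =
      d * (2 * (\<Sum>k<n. of_nat k)) + of_nat n * (d\<^sup>2 - d * (of_nat n - 1))"
    by (simp add: sum.distrib sum_distrib_left mult_ac)
  also have "2 * (\<Sum>k<n. of_nat k) = (of_nat n * (of_nat n - 1) :: 'a)"
    by (induction n) (simp_all add: algebra_simps)
  finally show ?thesis by (simp add: power2_eq_square algebra_simps)
qed

lemma sum_quadratic_poles_append:
  fixes w x :: "nat \<Rightarrow> 'a::field"
  shows "(\<Sum>i<r. pole_quad ({..<r + n} - {i}) (append_seq r w x) (w i) +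
      \<beta> * pole_sum ({..<r + n} - {i}) (append_seq r w x) (w i) + \<gamma>) =
    (\<Sum>i<r. pole_quad ({..<r} - {i}) w (w i) + \<beta> * pole_sum ({..<r} - {i}) w (w i) + \<gamma>) +
    2 * (\<Sum>i<r. pole_sum ({..<r} - {i}) w (w i) * pole_sum {..<n} x (w i)) +
    (\<Sum>i<r. pole_quad {..<n} x (w i) + \<beta> * pole_sum {..<n} x (w i))"
proof -
  have "pole_quad ({..<r + n} - {i}) (append_seq r w x) (w i) +
        \<beta> * pole_sum ({..<r + n} - {i}) (append_seq r w x) (w i) + \<gamma> =
      (pole_quad ({..<r} - {i}) w (w i) + \<beta> * pole_sum ({..<r} - {i}) w (w i) + \<gamma>) +
      2 * (pole_sum ({..<r} - {i}) w (w i) * pole_sum {..<n} x (w i)) +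
      (pole_quad {..<n} x (w i) + \<beta> * pole_sum {..<n} x (w i))" if "i < r" for i
    unfolding pole_sum_append[OF that] distrib_left by (simp only: add_ac)
  then show ?thesis
    unfolding sum_distrib_left sum.distrib[symmetric] by (intro sum.cong refl) simp
qed

lemma casimir_defect_eq:
  "casimir_defect n m r w x =
    (\<Sum>i<r. (\<Sum>a<n. pole_ratio w x i a)\<^sup>2 - (\<Sum>a<n. (pole_ratio w x i a)\<^sup>2)) -
    (\<Sum>i<r. \<Sum>j\<in>{..<r} - {i}. \<Sum>a<n. pole_ratio w x i a * pole_ratio w x j a) +
    (of_nat n - 2 * of_nat m) * (\<Sum>i<r. \<Sum>a<n. pole_ratio w x i a) - of_nat m ^ 2 * of_nat n"
  unfolding casimir_defect_def Let_def sum.distrib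
    sum_off_diagonal[OF finite_lessThan, where f = "\<lambda>i j. (\<Sum>a<n. pole_ratio w x i a) * (\<Sum>a<n. pole_ratio w x j a)"]
  by (simp add: sum_product[symmetric] power2_eq_square sum_subtractf)

text \<open>For \<open>\<beta>\<close> and \<open>\<gamma>\<close> as below, \<open>k (k - 1) + \<beta> k + \<gamma> = energy n (k - m)\<close>.\<close>

lemma sum_energy_poles:
  fixes w x :: "nat \<Rightarrow> complex" and m :: nat
  assumes inj: "inj_on w {..<r}" and disjoint: "\<And>i a. i < r \<Longrightarrow> a < n \<Longrightarrow> w i \<noteq> x a"
  defines "y \<equiv> append_seq r w x" and "\<beta> \<equiv> 2 - of_nat n - 2 * of_nat m"
    and "\<gamma> \<equiv> of_nat m * (of_nat m + of_nat n - 1)"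
  shows "(\<Sum>i<r. pole_quad ({..<r + n} - {i}) y (w i) + \<beta> * pole_sum ({..<r + n} - {i}) y (w i) + \<gamma>) =
    (\<Sum>k<r+n. energy n (of_nat k - of_nat m)) - (\<Sum>k<n. energy n (of_nat k)) + casimir_defect n m r w x"
proof -
  define S where "S = (\<lambda>i. \<Sum>a<n. pole_ratio w x i a)"
  define Q where "Q = (\<lambda>i. \<Sum>a<n. (pole_ratio w x i a)\<^sup>2)"
  define R where "R = (\<Sum>i<r. \<Sum>j\<in>{..<r} - {i}. \<Sum>a<n. pole_ratio w x i a * pole_ratio w x j a)"
  let ?N = "of_nat n :: complex" and ?r = "of_nat r :: complex" and ?m = "of_nat m :: complex"
  have energy: "of_nat k * (of_nat k - 1) + \<beta> * of_nat k + \<gamma> = energy n (of_nat k - ?m)" for k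
    by (simp add: \<beta>_def \<gamma>_def energy_def algebra_simps)
  have energy_split: "(\<Sum>k<r+n. energy n (of_nat k - ?m)) - (\<Sum>k<n. energy n (of_nat k)) =
      (\<Sum>k<r. energy n (of_nat k - ?m)) + ?N * (?r - ?m)\<^sup>2"
    unfolding lessThan_add_eq using sum_shifted_energy[of n "?r - ?m"]
    by (subst sum.union_disjoint) (auto simp: sum.reindex sum_subtractf algebra_simps)
  have mixed_part: "pole_quad {..<n} x (w i) + \<beta> * pole_sum {..<n} x (w i) =
      ?N * (?N - 1) + \<beta> * ?N + (?N - 2 * ?m) * S i + ((S i)\<^sup>2 - Q i)" if "i < r" for i
    using disjoint[OF that] by (simp add: pole_sum_ratio S_def Q_def \<beta>_def algebra_simps)
  have mixed_sum: "(\<Sum>i<r. pole_quad {..<n} x (w i) + \<beta> * pole_sum {..<n} x (w i)) =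
      ?r * (?N * (?N - 1) + \<beta> * ?N) + (?N - 2 * ?m) * (\<Sum>i<r. S i) + (\<Sum>i<r. (S i)\<^sup>2 - Q i)"
    by (simp add: mixed_part sum.distrib sum_distrib_left[symmetric])
  have cross_terms: "2 * (\<Sum>i<r. pole_sum ({..<r} - {i}) w (w i) * pole_sum {..<n} x (w i)) =
      ?r * (?r - 1) * ?N - R"
    using sum_pole_sum_mult_pole_sum[OF inj disjoint]
    by (cases r) (simp_all add: R_def sum_subtractf)
  have defect: "casimir_defect n m r w x =
      (\<Sum>i<r. (S i)\<^sup>2 - Q i) - R + (?N - 2 * ?m) * (\<Sum>i<r. S i) - ?m\<^sup>2 * ?N"
    by (simp add: casimir_defect_eq S_def Q_def R_def)
  show ?thesis
    unfolding y_def sum_quadratic_poles_append sum_quadratic_poles[OF inj] energy cross_terms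
      energy_split mixed_sum defect
    by (simp add: \<beta>_def power2_eq_square algebra_simps)
qed

lemma energy_row_circle_average:
  fixes m :: nat and x :: "nat \<Rightarrow> complex"
  assumes p: "p permutes {..<r + n}" and i: "i < r" and x: "\<And>a. a < n \<Longrightarrow> norm (x a) < 2"
  defines "y \<equiv> \<lambda>\<tau>. append_seq r (circle_point r n \<tau>) x"
  shows "energy n (of_nat (p i) - of_nat m) * fdet n (\<lambda>j k. x j ^ p (r + k)) =
    (\<Sum>\<tau>\<in>circle_index r n. circle_coeff r n p \<tau> * vandermonde (r + n) (y \<tau>) *
      (pole_quad ({..<r + n} - {i}) (y \<tau>) (circle_point r n \<tau> i) +
        (2 - of_nat n - 2 * of_nat m) * pole_sum ({..<r + n} - {i}) (y \<tau>) (circle_point r n \<tau> i) +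
        of_nat m * (of_nat m + of_nat n - 1)))"
proof -
  let ?E = "\<lambda>k. energy n (of_nat k - of_nat m) :: complex"
  have energy: "?E k = of_nat k * (of_nat k - 1) + (2 - of_nat n - 2 * of_nat m) * of_nat k +
      of_nat m * (of_nat m + of_nat n - 1)" for k
    by (simp add: energy_def algebra_simps)
  have "(\<Prod>j<r. if j = i then ?E (p j) else 1) = ?E (p i)" using i by simp
  then have "?E (p i) * fdet n (\<lambda>j k. x j ^ p (r + k)) = (\<Sum>\<tau>\<in>circle_index r n. circle_coeff r n p \<tau> *
      fdet (r + n) (\<lambda>j k. (if j < r then if j = i then ?E k else 1 else 1) * y \<tau> j ^ k))"
    using weighted_alternant_circle_average[OF p, of "\<lambda>j k. if j = i then ?E k else 1" x]
    by (simp only: y_def)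
  also have "\<dots> = (\<Sum>\<tau>\<in>circle_index r n. circle_coeff r n p \<tau> *
      fdet (r + n) (\<lambda>j k. (if j = i then ?E k else 1) * y \<tau> j ^ k))"
    using i by (intro sum.cong refl arg_cong2[where f = "(*)"] fdet_cong) auto
  also have "\<dots> = (\<Sum>\<tau>\<in>circle_index r n. circle_coeff r n p \<tau> * (vandermonde (r + n) (y \<tau>) *
      (pole_quad ({..<r + n} - {i}) (y \<tau>) (y \<tau> i) +
        (2 - of_nat n - 2 * of_nat m) * pole_sum ({..<r + n} - {i}) (y \<tau>) (y \<tau> i) +
        of_nat m * (of_nat m + of_nat n - 1))))"
    unfolding energy
  proof (intro sum.cong refl arg_cong2[where f = "(*)"] vandermonde_quadratic_row)
    show "i < r + n" using i by simp
    fix \<tau> b assume b: "b < r + n" "b \<noteq> i"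
    show "y \<tau> i \<noteq> y \<tau> b"
    proof (cases "b < r")
      case True
      then show ?thesis using i b inj_onD[OF inj_circle_point[of r n \<tau> UNIV], of i b] by (auto simp: y_def)
    next
      case False
      then have "norm (x (b - r)) < 2" using b by (intro x) auto
      then show ?thesis using i False norm_circle_point[of r n \<tau> i] by (auto simp: y_def append_seq_def)
    qed
  qed
  finally show ?thesis using i by (simp add: mult.assoc y_def)
qed

lemma alternant_casimir_average:
  fixes m :: nat
  assumes p: "p permutes {..<r + n}" and x: "\<And>a. a < n \<Longrightarrow> norm (x a) < 2"
  shows "((\<Sum>k<n. energy n (of_nat k)) - (\<Sum>k<n. energy n (of_nat (p (r + k)) - of_nat m))) *
      fdet n (\<lambda>j k. x j ^ p (r + k)) =
    (\<Sum>\<tau>\<in>circle_index r n. circle_coeff r n p \<tau> *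
      vandermonde (r + n) (append_seq r (circle_point r n \<tau>) x) * casimir_defect n m r (circle_point r n \<tau>) x)"
proof -
  let ?A = "fdet n (\<lambda>j k. x j ^ p (r + k))" and ?T = "circle_index r n" and ?w = "circle_point r n"
    and ?E = "\<lambda>k. energy n (of_nat k - of_nat m) :: complex"
  define F where "F = (\<lambda>\<tau>. circle_coeff r n p \<tau> * vandermonde (r + n) (append_seq r (?w \<tau>) x))"
  define K where "K = (\<Sum>k<r+n. ?E k) - (\<Sum>k<n. energy n (of_nat k))"
  have disjoint: "?w \<tau> i \<noteq> x a" if "a < n" for \<tau> i a
    using norm_circle_point[of r n \<tau> i] x[OF that] by auto
  have "(\<Sum>k<r+n. ?E k) = (\<Sum>k<r+n. ?E (p k))"
    by (rule sum.permute[OF p, unfolded o_def])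
  also have "\<dots> = (\<Sum>i<r. ?E (p i)) + (\<Sum>k<n. ?E (p (r + k)))"
    unfolding lessThan_add_eq by (subst sum.union_disjoint) (auto simp: sum.reindex)
  finally have "((\<Sum>k<n. energy n (of_nat k)) - (\<Sum>k<n. ?E (p (r + k)))) * ?A =
      (\<Sum>i<r. ?E (p i)) * ?A - K * ?A"
    by (simp add: K_def algebra_simps)
  also have "(\<Sum>i<r. ?E (p i)) * ?A = (\<Sum>i<r. \<Sum>\<tau>\<in>?T. F \<tau> *
      (pole_quad ({..<r + n} - {i}) (append_seq r (?w \<tau>) x) (?w \<tau> i) +
        (2 - of_nat n - 2 * of_nat m) * pole_sum ({..<r + n} - {i}) (append_seq r (?w \<tau>) x) (?w \<tau> i) +
        of_nat m * (of_nat m + of_nat n - 1)))"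
    unfolding sum_distrib_right F_def
    by (intro sum.cong refl energy_row_circle_average p x) simp_all
  also have "\<dots> = (\<Sum>\<tau>\<in>?T. F \<tau> * (K + casimir_defect n m r (?w \<tau>) x))"
  proof (subst sum.swap, rule sum.cong[OF refl])
    fix \<tau>
    show "(\<Sum>i<r. F \<tau> * (pole_quad ({..<r + n} - {i}) (append_seq r (?w \<tau>) x) (?w \<tau> i) +
        (2 - of_nat n - 2 * of_nat m) * pole_sum ({..<r + n} - {i}) (append_seq r (?w \<tau>) x) (?w \<tau> i) +
        of_nat m * (of_nat m + of_nat n - 1))) = F \<tau> * (K + casimir_defect n m r (?w \<tau>) x)"
      unfolding sum_distrib_left[symmetric] K_def
      by (rule arg_cong[OF sum_energy_poles[OF inj_circle_point]]) (rule disjoint)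
  qed
  also have "\<dots> - K * ?A = (\<Sum>\<tau>\<in>?T. F \<tau> * casimir_defect n m r (?w \<tau>) x)"
    unfolding alternant_circle_average[OF p] F_def[symmetric] sum_distrib_left sum_subtractf[symmetric]
    by (rule sum.cong) (simp_all add: algebra_simps)
  finally show ?thesis by (simp only: F_def)
qed

subsection \<open>Schur functions at coinciding variables\<close>

lemma tendsto_coordinate:
  fixes x :: "'i \<Rightarrow> 'a::topological_space"
  shows "((\<lambda>y. y a) \<longlongrightarrow> x a) (at x within S)"
proof -
  have "continuous_on UNIV (\<lambda>y :: 'i \<Rightarrow> 'a. y a)" by simp
  then have "((\<lambda>y. y a) \<longlongrightarrow> x a) (at x)" by (simp add: continuous_on_def)
  then show ?thesis by (rule tendsto_within_subset) simp
qed

lemma eventually_coordinates_in_open: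
  fixes x :: "nat \<Rightarrow> 'a::topological_space"
  assumes "open U" "\<And>a. a < n \<Longrightarrow> x a \<in> U"
  shows "\<forall>\<^sub>F y in at x within S. \<forall>a<n. y a \<in> U"
proof -
  have "\<forall>\<^sub>F y in at x within S. \<forall>a\<in>{..<n}. y a \<in> U"
    using assms by (intro eventually_ball_finite ballI topological_tendstoD[OF tendsto_coordinate]) auto
  then show ?thesis by (simp only: Ball_def lessThan_iff)
qed

lemma eventually_inj_perturbation:
  fixes x :: "nat \<Rightarrow> complex"
  shows "\<forall>\<^sub>F \<epsilon> in at (0::real). inj_on (\<lambda>j. x j + of_real \<epsilon> * of_nat j) {..<n}"
proof -
  define Bad where "Bad = (\<lambda>(i, j). Re ((x i - x j) / (of_nat j - of_nat i))) ` ({..<n} \<times> {..<n})"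
  have "finite Bad" by (simp add: Bad_def)
  then have "\<forall>\<^sub>F \<epsilon> in at 0. \<epsilon> \<notin> Bad"
    using islimpt_finite[of Bad 0] by (simp add: islimpt_iff_eventually)
  then show ?thesis
  proof eventually_elim
    case (elim \<epsilon>)
    have "i = j" if ij: "i < n" "j < n" and eq: "x i + of_real \<epsilon> * of_nat i = x j + of_real \<epsilon> * of_nat j" for i j
    proof (rule ccontr)
      assume "i \<noteq> j"
      then have "of_nat j - of_nat i \<noteq> (0 :: complex)" by simp
      moreover have "x i - x j = of_real \<epsilon> * (of_nat j - of_nat i)"
        using eq by (simp add: algebra_simps)
      ultimately have "(x i - x j) / (of_nat j - of_nat i) = of_real \<epsilon>" by simp
      then have "\<epsilon> = Re ((x i - x j) / (of_nat j - of_nat i))" by (metis Re_complex_of_real)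
      then have "\<epsilon> \<in> Bad" unfolding Bad_def using ij by (intro image_eqI[of _ _ "(i, j)"]) auto
      then show False using elim by simp
    qed
    then show ?case by (auto simp: inj_on_def)
  qed
qed

lemma inj_points_accumulate:
  fixes x :: "nat \<Rightarrow> complex"
  assumes "\<not> inj_on x {..<n}"
  shows "at x within {y. inj_on y {..<n}} \<noteq> bot"
proof -
  define h where "h = (\<lambda>(\<epsilon>::real) j. x j + of_real \<epsilon> * of_nat j)"
  have "continuous_on UNIV h"
    unfolding h_def by (intro continuous_on_coordinatewise_then_product continuous_intros)
  then have "(h \<longlongrightarrow> h 0) (at 0)" by (simp add: continuous_on_def)
  moreover have "\<forall>\<^sub>F \<epsilon> in at 0. inj_on (h \<epsilon>) {..<n} \<and> h \<epsilon> \<noteq> x"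
    using eventually_inj_perturbation[of x n] unfolding h_def by eventually_elim (use assms in auto)
  ultimately have "filterlim h (at x within {y. inj_on y {..<n}}) (at 0)"
    by (simp add: filterlim_at h_def)
  then show ?thesis
    unfolding filterlim_def by (auto simp: bot_unique filtermap_bot_iff)
qed

lemma eventually_at_inj: "\<forall>\<^sub>F y in at x within {y. inj_on y {..<n}}. inj_on y {..<n}"
  by (simp add: eventually_at_filter)

lemma eq_by_density_of_inj:
  fixes f g :: "(nat \<Rightarrow> complex) \<Rightarrow> complex"
  assumes lim: "(f \<longlongrightarrow> f x) (at x)" "(g \<longlongrightarrow> g x) (at x)"
    and U: "open U" "\<And>a. a < n \<Longrightarrow> x a \<in> U"
    and eq: "\<And>y. inj_on y {..<n} \<Longrightarrow> (\<And>a. a < n \<Longrightarrow> y a \<in> U) \<Longrightarrow> f y = g y"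
  shows "f x = g x"
proof (cases "inj_on x {..<n}")
  case True
  then show ?thesis using eq U by blast
next
  case False
  let ?F = "at x within {y. inj_on y {..<n}}"
  have "\<forall>\<^sub>F y in ?F. \<forall>a<n. y a \<in> U" using U by (rule eventually_coordinates_in_open)
  with eventually_at_inj have "\<forall>\<^sub>F y in ?F. f y = g y" by eventually_elim (use eq in auto)
  then have "(g \<longlongrightarrow> f x) ?F"
    by (rule Lim_transform_eventually[OF tendsto_within_subset[OF lim(1)], rotated]) auto
  moreover have "(g \<longlongrightarrow> g x) ?F"
    by (rule tendsto_within_subset[OF lim(2)]) auto
  ultimately show ?thesis
    using tendsto_unique[OF inj_points_accumulate[OF False]] by blast
qed

lemma schur_eqI:
  assumes n: "length l = n" and U: "open U" "\<And>a. a < n \<Longrightarrow> x a \<in> U"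
    and lim: "(f \<longlongrightarrow> f x) (at x)"
    and eq: "\<And>y. inj_on y {..<n} \<Longrightarrow> (\<And>a. a < n \<Longrightarrow> y a \<in> U) \<Longrightarrow> schur_num l y = schur_den n y * f y"
  shows "schur l x = f x"
proof (cases "inj_on x {..<n}")
  case True
  then show ?thesis
    using eq[OF True U(2)] schur_den_nonzero[OF True] n by (simp add: schur_def)
next
  case False
  let ?F = "at x within {y. inj_on y {..<n}}"
  have "\<forall>\<^sub>F y in ?F. \<forall>a<n. y a \<in> U" using U by (rule eventually_coordinates_in_open)
  with eventually_at_inj have "\<forall>\<^sub>F y in ?F. f y = schur_num l y / schur_den n y"
    by eventually_elim (use eq schur_den_nonzero in auto)
  then have "((\<lambda>y. schur_num l y / schur_den n y) \<longlongrightarrow> f x) ?F"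
    by (rule Lim_transform_eventually[OF tendsto_within_subset[OF lim], rotated]) auto
  then have "Lim ?F (\<lambda>y. schur_num l y / schur_den n y) = f x"
    using inj_points_accumulate[OF False] by (intro tendsto_Lim) auto
  then show ?thesis using False n by (simp add: schur_def)
qed

lemma schur_constant:
  assumes "length l = n" "\<And>y. schur_num l y = schur_den n y * c"
  shows "schur l x = c"
  by (rule schur_eqI[OF assms(1), where f = "\<lambda>_. c" and U = UNIV]) (auto simp: assms(2))

lemma schur_not_inj:
  assumes "\<not> inj_on (\<lambda>k. staircase (length l) k + l ! k) {..<length l}"
  shows "schur l x = 0"
  by (rule schur_constant[OF refl]) (simp add: schur_num_alternant alternant_not_inj[OF assms])

subsection \<open>Schur functions as combinations of products over the variables\<close>

definition root_factor :: "nat \<Rightarrow> nat \<Rightarrow> (nat \<Rightarrow> complex) \<Rightarrow> complex \<Rightarrow> complex" where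
  "root_factor m r w z = inverse z ^ m * (\<Prod>i<r. w i - z)"

definition root_factor_coeff :: "nat \<Rightarrow> nat \<Rightarrow> (nat \<Rightarrow> nat) \<Rightarrow> (nat \<Rightarrow> nat) \<Rightarrow> complex" where
  "root_factor_coeff r n p \<tau> = signof (reversal n) * (-1) ^ (r * n) *
     circle_coeff r n p \<tau> * vandermonde r (circle_point r n \<tau>)"

lemma tendsto_root_factor [tendsto_intros]:
  assumes "(f \<longlongrightarrow> z) F" "z \<noteq> 0"
  shows "((\<lambda>y. root_factor m r w (f y)) \<longlongrightarrow> root_factor m r w z) F"
  unfolding root_factor_def by (intro tendsto_intros assms)

lemma circle_coeff_vandermonde:
  "(\<Prod>a<n. inverse (x a) ^ m) *
      (circle_coeff r n p \<tau> * vandermonde (r + n) (append_seq r (circle_point r n \<tau>) x)) =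
    schur_den n x * (root_factor_coeff r n p \<tau> * (\<Prod>a<n. root_factor m r (circle_point r n \<tau>) (x a)))"
proof -
  have "(\<Prod>a<n. \<Prod>i<r. x a - circle_point r n \<tau> i) = (\<Prod>a<n. \<Prod>i<r. (-1) * (circle_point r n \<tau> i - x a))"
    by simp
  also have "\<dots> = (-1) ^ (r * n) * (\<Prod>a<n. \<Prod>i<r. circle_point r n \<tau> i - x a)"
    unfolding prod.distrib by (simp add: power_mult)
  finally show ?thesis
    by (simp add: vandermonde_append schur_den_vandermonde root_factor_coeff_def root_factor_def
        prod.distrib sign_def)
qed

lemma exponents_extend_to_permutation:
  fixes e :: "nat \<Rightarrow> int"
  assumes "inj_on e {..<n}"
  obtains p m r where "p permutes {..<r + n}" "\<And>k. k < n \<Longrightarrow> int (p (r + k)) = e k + int m"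
proof -
  define m where "m = (\<Sum>k<n. nat \<bar>e k\<bar>)"
  have bound: "\<bar>e k\<bar> \<le> int m" if "k < n" for k
  proof -
    have "nat \<bar>e k\<bar> \<le> m" unfolding m_def by (rule member_le_sum) (use that in auto)
    then show ?thesis by simp
  qed
  define E where "E = (\<lambda>k. nat (e k + int m))"
  have E: "int (E k) = e k + int m" if "k < n" for k
    using bound[OF that] by (simp add: E_def)
  have "inj_on E {..<n}"
    by (rule inj_onI) (use E inj_onD[OF assms] in \<open>metis add_right_cancel lessThan_iff\<close>)
  moreover have "E k < 2 * m + n" if "k < n" for k
    using bound[OF that] that by (simp add: E_def)
  then have "E ` {..<n} \<subseteq> {..<2 * m + n}" by auto
  ultimately obtain p where "p permutes {..<2 * m + n}" "\<And>k. k < n \<Longrightarrow> p (2 * m + k) = E k"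
    by (rule permutes_extending_inj) (rule that)
  then show ?thesis using E by (intro that[of p "2 * m" m]) simp_all
qed

lemma alternant_shift:
  assumes "\<And>a. a < n \<Longrightarrow> x a \<noteq> 0" "\<And>k. k < n \<Longrightarrow> int (q k) = e k + int m"
  shows "alternant n e x = (\<Prod>a<n. inverse (x a) ^ m) * fdet n (\<lambda>j k. x j ^ q k)"
proof -
  have "x j powi e k = inverse (x j) ^ m * x j ^ q k" if "j < n" "k < n" for j k
  proof -
    have "x j ^ q k = x j powi (e k + int m)" using assms(2)[OF that(2)] by (metis power_int_of_nat)
    also have "\<dots> = x j powi e k * x j ^ m" using assms(1)[OF that(1)] by (simp add: power_int_add)
    finally show ?thesis using assms(1)[OF that(1)] by (simp add: field_simps)
  qed
  then show ?thesis unfolding alternant_def fdet_scale_rows[symmetric] by (rule fdet_cong)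
qed

lemma schur_root_factors:
  assumes n: "length l = n" and p: "p permutes {..<r + n}"
    and exponents: "\<And>k. k < n \<Longrightarrow> int (p (r + k)) = staircase n k + l ! k + int m"
    and x: "\<And>a. a < n \<Longrightarrow> x a \<noteq> 0"
  shows "schur l x = (\<Sum>\<tau>\<in>circle_index r n.
    root_factor_coeff r n p \<tau> * (\<Prod>a<n. root_factor m r (circle_point r n \<tau>) (x a)))"
proof (rule schur_eqI[OF n, where U = "- {0}"])
  show "((\<lambda>x. \<Sum>\<tau>\<in>circle_index r n. root_factor_coeff r n p \<tau> *
        (\<Prod>a<n. root_factor m r (circle_point r n \<tau>) (x a))) \<longlongrightarrow>
      (\<Sum>\<tau>\<in>circle_index r n. root_factor_coeff r n p \<tau> *
        (\<Prod>a<n. root_factor m r (circle_point r n \<tau>) (x a)))) (at x)"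
    by (intro tendsto_intros tendsto_coordinate) (use x in auto)
  fix y :: "nat \<Rightarrow> complex" assume "\<And>a. a < n \<Longrightarrow> y a \<in> - {0}"
  then show "schur_num l y = schur_den n y * (\<Sum>\<tau>\<in>circle_index r n.
      root_factor_coeff r n p \<tau> * (\<Prod>a<n. root_factor m r (circle_point r n \<tau>) (y a)))"
    unfolding schur_num_alternant n
    by (subst alternant_shift[OF _ exponents])
      (auto simp: alternant_circle_average[OF p] sum_distrib_left circle_coeff_vandermonde)
qed (use x in auto)

lemma tendsto_schur:
  assumes n: "length l = n" and x: "\<And>a. a < n \<Longrightarrow> x a \<noteq> 0"
  shows "(schur l \<longlongrightarrow> schur l x) (at x)"
proof (cases "inj_on (\<lambda>k. staircase n k + l ! k) {..<n}")
  case True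
  then obtain p m r where p: "p permutes {..<r + n}"
    "\<And>k. k < n \<Longrightarrow> int (p (r + k)) = staircase n k + l ! k + int m"
    by (rule exponents_extend_to_permutation) (rule that)
  have "\<forall>\<^sub>F y in at x. \<forall>a<n. y a \<in> - {0}"
    using x by (intro eventually_coordinates_in_open) auto
  then have "\<forall>\<^sub>F y in at x. (\<Sum>\<tau>\<in>circle_index r n.
      root_factor_coeff r n p \<tau> * (\<Prod>a<n. root_factor m r (circle_point r n \<tau>) (y a))) = schur l y"
    by eventually_elim (simp add: schur_root_factors[OF n p])
  moreover have "((\<lambda>y. \<Sum>\<tau>\<in>circle_index r n. root_factor_coeff r n p \<tau> *
        (\<Prod>a<n. root_factor m r (circle_point r n \<tau>) (y a))) \<longlongrightarrow> schur l x) (at x)"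
    by (subst schur_root_factors[OF n p x]) (use x in \<open>auto intro!: tendsto_intros tendsto_coordinate\<close>)
  ultimately show ?thesis by (rule Lim_transform_eventually[rotated])
next
  case False
  then show ?thesis by (simp add: schur_not_inj n tendsto_eventually)
qed

lemma tendsto_casimir_defect:
  assumes "\<And>a i. a < n \<Longrightarrow> i < r \<Longrightarrow> w i \<noteq> x a"
  shows "(casimir_defect n m r w \<longlongrightarrow> casimir_defect n m r w x) (at x)"
  unfolding casimir_defect_def Let_def pole_ratio_def
  by (intro tendsto_intros tendsto_coordinate) (use assms in auto)

lemma schur_casimir:
  assumes n: "length l = n" and p: "p permutes {..<r + n}"
    and exponents: "\<And>k. k < n \<Longrightarrow> int (p (r + k)) = staircase n k + l ! k + int m"
    and x: "\<And>a. a < n \<Longrightarrow> x a \<noteq> 0 \<and> norm (x a) < 2"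
  shows "of_int ((\<Sum>k<n. energy n (int k)) - (\<Sum>k<n. energy n (staircase n k + l ! k))) * schur l x =
    (\<Sum>\<tau>\<in>circle_index r n. root_factor_coeff r n p \<tau> *
      (\<Prod>a<n. root_factor m r (circle_point r n \<tau>) (x a)) * casimir_defect n m r (circle_point r n \<tau>) x)"
  (is "?D * _ = ?f x")
proof (rule eq_by_density_of_inj[where f = "\<lambda>x. ?D * schur l x" and g = ?f
      and U = "ball 0 2 - {0}" and n = n])
  have circle_disjoint: "circle_point r n \<tau> i \<noteq> x a" if "a < n" for \<tau> i a
    using norm_circle_point[of r n \<tau> i] x[OF that] by auto
  show "((\<lambda>x. ?D * schur l x) \<longlongrightarrow> ?D * schur l x) (at x)"
    by (intro tendsto_intros tendsto_schur[OF n]) (use x in auto)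
  show "(?f \<longlongrightarrow> ?f x) (at x)"
    by (intro tendsto_intros tendsto_coordinate tendsto_casimir_defect) (use x circle_disjoint in auto)
  show "open (ball 0 2 - {0 :: complex})" by (intro open_Diff) auto
  show "x a \<in> ball 0 2 - {0}" if "a < n" for a using x[OF that] by simp
  fix y :: "nat \<Rightarrow> complex" assume y: "inj_on y {..<n}" "\<And>a. a < n \<Longrightarrow> y a \<in> ball 0 2 - {0}"
  have y_bounds: "y a \<noteq> 0" "norm (y a) < 2" if "a < n" for a using y(2)[OF that] by auto
  have D: "?D = (\<Sum>k<n. energy n (of_nat k)) - (\<Sum>k<n. energy n (of_nat (p (r + k)) - of_nat m))"
  proof -
    have "of_nat (p (r + k)) - of_nat m = (of_int (staircase n k + l ! k) :: complex)" if "k < n" for k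
      using arg_cong[OF exponents[OF that], of "of_int :: int \<Rightarrow> complex"] by simp
    then show ?thesis by (simp add: of_int_energy del: of_int_add)
  qed
  have "?D * schur_num l y = (\<Prod>a<n. inverse (y a) ^ m) * (?D * fdet n (\<lambda>j k. y j ^ p (r + k)))"
    unfolding schur_num_alternant n
    by (subst alternant_shift[OF y_bounds(1) exponents]) (simp_all only: mult.left_commute)
  also have "\<dots> = (\<Sum>\<tau>\<in>circle_index r n. (\<Prod>a<n. inverse (y a) ^ m) * (circle_coeff r n p \<tau> *
      vandermonde (r + n) (append_seq r (circle_point r n \<tau>) y)) * casimir_defect n m r (circle_point r n \<tau>) y)"
    unfolding D by (subst alternant_casimir_average[OF p y_bounds(2)]) (simp_all only: sum_distrib_left mult.assoc)
  also have "\<dots> = schur_den n y * ?f y"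
    unfolding circle_coeff_vandermonde sum_distrib_left by (simp only: mult.assoc)
  finally have "?D * schur_num l y = schur_den n y * ?f y" .
  then show "?D * schur l y = ?f y"
    using y(1) schur_den_nonzero[OF y(1)] by (simp add: schur_def n field_simps)
qed

subsection \<open>Determinants of matrices over a finite type\<close>

abbreviation smat :: "'a::zero \<Rightarrow> 'a^'n^'n" where "smat \<equiv> Finite_Cartesian_Product.mat"
abbreviation mdet :: "'a::comm_ring_1^'n^'n \<Rightarrow> 'a" where "mdet \<equiv> Determinants.det"

lemma smat_nth: "smat c $ i $ j = (if i = j then c else 0)"
  by (simp add: Finite_Cartesian_Product.mat_def)

lemma smat_mult_nth [simp]: "(smat c ** (A :: 'a::semiring_1^'n^'m)) $ i $ j = c * A $ i $ j"
  by (simp add: matrix_matrix_mult_def smat_nth if_distrib if_distribR sum.delta cong: if_cong)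

lemma mult_smat_nth [simp]: "((A :: 'a::comm_semiring_1^'n^'m) ** smat c) $ i $ j = c * A $ i $ j"
  by (simp add: matrix_matrix_mult_def smat_nth if_distrib if_distribR sum.delta mult.commute cong: if_cong)

lemma matrix_add_rdistrib: "(A + B) ** C = A ** C + B ** (C :: 'a::semiring_1^'n^'m)"
  by (simp add: matrix_matrix_mult_def vec_eq_iff distrib_right sum.distrib)

lemma matrix_diff_ldistrib: "A ** (B - C) = A ** B - A ** (C :: 'a::ring_1^'n^'m)"
  by (simp add: matrix_matrix_mult_def vec_eq_iff right_diff_distrib sum_subtractf)

lemma matrix_diff_rdistrib: "(A - B) ** C = A ** C - B ** (C :: 'a::ring_1^'n^'m)"
  by (simp add: matrix_matrix_mult_def vec_eq_iff left_diff_distrib sum_subtractf)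

lemma mdet_smat_mult: "mdet (smat c ** (A :: 'a::comm_ring_1^'n^'n)) = c ^ CARD('n) * mdet A"
  by (simp add: Determinants.det_def prod.distrib sum_distrib_left mult_ac)

lemma mdet_identity_replace_row:
  fixes y :: "'a::field^'n"
  shows "mdet (\<chi> i. if i = k then y else axis i 1) = y $ k"
proof -
  have row: "Finite_Cartesian_Product.row i (smat 1 :: 'a^'n^'n) = axis i 1" for i
    by (auto simp: Finite_Cartesian_Product.row_def axis_def smat_nth vec_eq_iff)
  show ?thesis
    using cramer_lemma_transpose[of k y "smat 1 :: 'a^'n^'n"] unfolding row basis_expansion by simp
qed

definition outer :: "'a::times^'m \<Rightarrow> 'a^'n \<Rightarrow> 'a^'n^'m" where
  "outer u y = (\<chi> i j. u $ i * y $ j)"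

lemma outer_nth [simp]: "outer u y $ i $ j = u $ i * y $ j"
  by (simp add: outer_def)

lemma outer_matrix_mult: "outer u y ** A = outer u (y v* (A :: 'a::comm_semiring_1^'n^'m))"
  by (simp add: vec_eq_iff matrix_matrix_mult_def vector_matrix_mult_def sum_distrib_left mult_ac)

lemma matrix_outer_mult: "A ** outer u y = outer (A *v u) (y :: 'a::comm_semiring_1^'n)"
  by (simp add: vec_eq_iff matrix_matrix_mult_def matrix_vector_mult_def sum_distrib_left sum_distrib_right mult_ac)

text \<open>If \<open>u $ k \<noteq> 0\<close>, conjugation with the identity matrix with \<open>k\<close>-th column \<open>u\<close> replaces \<open>u\<close> by
  the \<open>k\<close>-th unit vector.\<close>

lemma mdet_identity_plus_outer:
  fixes u y :: "'a::field^'n"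
  shows "mdet (smat 1 + outer u y) = 1 + (\<Sum>i\<in>UNIV. u $ i * y $ i)"
proof (cases "u = 0")
  case True
  then have "outer u y = 0" by (simp add: vec_eq_iff)
  with True show ?thesis by simp
next
  case False
  then obtain k where k: "u $ k \<noteq> 0" by (auto simp: vec_eq_iff)
  define P where "P = transpose (\<chi> i. if i = k then u else axis i 1)"
  define z where "z = y v* P"
  have mdet_P: "mdet P = u $ k"
    by (simp add: P_def Determinants.det_transpose mdet_identity_replace_row)
  have "(P *v axis k 1) $ i = P $ i $ k" for i
    by (simp add: matrix_vector_mult_def axis_def if_distrib[of "\<lambda>x. _ * x"] cong: if_cong)
  then have "P *v axis k 1 = u" by (simp add: vec_eq_iff P_def transpose_def)
  then have "(smat 1 + outer u y) ** P = P ** (smat 1 + outer (axis k 1) z)"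
    by (simp add: matrix_add_rdistrib matrix_add_ldistrib outer_matrix_mult matrix_outer_mult z_def)
  then have "mdet (smat 1 + outer u y) * mdet P = mdet P * mdet (smat 1 + outer (axis k 1) z)"
    by (metis det_mul)
  then have "mdet (smat 1 + outer u y) = mdet (smat 1 + outer (axis k 1) z)"
    using k by (simp add: mdet_P mult.commute)
  also have "smat 1 + outer (axis k 1) z = (\<chi> i. if i = k then axis k 1 + z else axis i 1)"
    by (auto simp: vec_eq_iff smat_nth axis_def)
  also have "mdet \<dots> = 1 + z $ k" by (simp add: mdet_identity_replace_row)
  also have "z $ k = (\<Sum>i\<in>UNIV. u $ i * y $ i)"
    by (simp add: z_def P_def vector_matrix_mult_def transpose_def mult.commute)
  finally show ?thesis .
qed

lemma poly_mdet: "poly (mdet M) x = mdet (\<chi> i j. poly (M $ i $ j) x)"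
  by (simp add: Determinants.det_def poly_sum poly_prod of_int_poly)

lemma pderiv_mdet:
  fixes A :: "'a::idom poly^'n^'n"
  shows "pderiv (mdet A) = (\<Sum>k\<in>UNIV. mdet (\<chi> i. if i = k then \<chi> j. pderiv (A $ i $ j) else A $ i))"
proof -
  have row: "(\<Prod>i\<in>UNIV. (\<chi> i. if i = k then \<chi> j. pderiv (A $ i $ j) else A $ i) $ i $ p i) =
      (\<Prod>i\<in>UNIV - {k}. A $ i $ p i) * pderiv (A $ k $ p k)" for k and p :: "'n \<Rightarrow> 'n"
    by (subst prod.remove[of _ k]) (auto simp: mult.commute intro!: prod.cong)
  have "pderiv (mdet A) = (\<Sum>p | p permutes UNIV. \<Sum>k\<in>UNIV.
      of_int (sign p) * ((\<Prod>i\<in>UNIV - {k}. A $ i $ p i) * pderiv (A $ k $ p k)))"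
    unfolding Determinants.det_def pderiv_sum
    by (rule sum.cong) (auto simp: pderiv_mult pderiv_prod sum_distrib_left sign_def pderiv_minus sum_negf)
  also have "\<dots> = (\<Sum>k\<in>UNIV. mdet (\<chi> i. if i = k then \<chi> j. pderiv (A $ i $ j) else A $ i))"
    unfolding Determinants.det_def row by (rule sum.swap)
  finally show ?thesis .
qed

lemma pderiv_mdet_identity_plus:
  fixes A :: "'a::field^'n^'n"
  shows "poly (pderiv (mdet (\<chi> i j. [:of_bool (i = j), A $ i $ j:]))) 0 = trace A"
proof -
  define M where "M = (\<chi> i j. [:of_bool (i = j), A $ i $ j:])"
  have "(\<chi> i j. poly ((\<chi> i. if i = k then \<chi> j. pderiv (M $ i $ j) else M $ i) $ i $ j) 0) =
      (\<chi> i. if i = k then A $ k else axis i 1)" for k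
    by (auto simp: M_def vec_eq_iff axis_def pderiv_pCons)
  then show ?thesis
    unfolding M_def[symmetric] pderiv_mdet poly_sum poly_mdet
    by (simp only: mdet_identity_replace_row trace_def)
qed

subsection \<open>Eigenvalues\<close>

definition char_poly_mat :: "complex^'n^'n \<Rightarrow> complex poly" where
  "char_poly_mat g = mdet (smat [:0, 1:] - (\<chi> i j. [:g $ i $ j:]))"

lemma poly_char_poly_mat: "poly (char_poly_mat g) x = mdet (smat x - g)"
proof -
  have "(\<chi> i j. poly ((smat [:0, 1:] - (\<chi> i j. [:g $ i $ j:])) $ i $ j) x) = smat x - g"
    by (simp add: vec_eq_iff smat_nth)
  then show ?thesis by (simp add: char_poly_mat_def poly_mdet)
qed

lemma monic_char_poly_mat:
  fixes g :: "complex^'n^'n"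
  shows "degree (char_poly_mat g) = CARD('n)" "lead_coeff (char_poly_mat g) = 1"
proof -
  define A :: "complex poly^'n^'n" where "A = smat [:0, 1:] - (\<chi> i j. [:g $ i $ j:])"
  have entry: "A $ i $ j = (if i = j then [:- g $ i $ j, 1:] else [:- g $ i $ j:])" for i j
    by (simp add: A_def smat_nth)
  define diagonal where "diagonal = (\<Prod>i\<in>UNIV. A $ i $ i)"
  define rest where "rest = (\<Sum>p \<in> {p. p permutes UNIV} - {id}. of_int (sign p) * (\<Prod>i\<in>UNIV. A $ i $ p i))"
  have sum: "char_poly_mat g = diagonal + rest"
    unfolding char_poly_mat_def A_def[symmetric] Determinants.det_def diagonal_def rest_def
    by (subst sum.remove[of _ id]) (auto simp: permutes_id)
  have degree: "degree diagonal = CARD('n)"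
    unfolding diagonal_def entry by (subst degree_prod_eq_sum_degree) auto
  have lead: "lead_coeff diagonal = 1" unfolding diagonal_def entry lead_coeff_prod by simp
  have "degree (of_int (sign p) * (\<Prod>i\<in>UNIV. A $ i $ p i)) < CARD('n)"
    if "p \<in> {p. p permutes UNIV} - {id}" for p
  proof -
    from that obtain k where k: "p k \<noteq> k" by (auto simp: fun_eq_iff)
    have "degree (of_int (sign p) * (\<Prod>i\<in>UNIV. A $ i $ p i)) \<le> degree (\<Prod>i\<in>UNIV. A $ i $ p i)"
      by (simp add: sign_def)
    also have "\<dots> \<le> (\<Sum>i\<in>UNIV. degree (A $ i $ p i))"
      using degree_prod_sum_le[of UNIV "\<lambda>i. A $ i $ p i"] by (simp add: o_def)
    also have "\<dots> = (\<Sum>i\<in>UNIV - {k}. degree (A $ i $ p i))"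
      using k by (subst sum.remove[of _ k]) (auto simp: entry)
    also have "\<dots> \<le> (\<Sum>i\<in>UNIV - {k}. 1)"
      by (rule sum_mono) (simp add: entry)
    also have "\<dots> < CARD('n)" by (simp add: card_Diff_singleton card_gt_0_iff)
    finally show ?thesis .
  qed
  then have "degree rest < CARD('n)"
    unfolding rest_def by (intro degree_sum_less) auto
  then show "degree (char_poly_mat g) = CARD('n)" "lead_coeff (char_poly_mat g) = 1"
    using degree lead by (simp_all add: sum degree_add_eq_left coeff_eq_0)
qed

definition eigs :: "complex^'n^'n \<Rightarrow> nat \<Rightarrow> complex" where
  "eigs g = (!) (SOME ts. mset ts = eigenvalue_mset g)"

lemma schur_eigenvalues_eigs: "schur_eigenvalues l g = schur l (eigs g)"
  by (simp add: schur_eigenvalues_def eigs_def)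

lemma mdet_smat_minus:
  fixes g :: "complex^'n^'n"
  shows "mdet (smat x - g) = (\<Prod>a<CARD('n). x - eigs g a)"
proof -
  define ts where "ts = (SOME ts. mset ts = eigenvalue_mset g)"
  have ts: "mset ts = proots (char_poly_mat g)"
    unfolding ts_def using someI_ex[OF ex_mset[of "eigenvalue_mset g"]]
    by (simp add: eigenvalue_mset_def char_poly_mat_def)
  have length: "length ts = CARD('n)"
    using arg_cong[OF ts, of size] by (simp add: size_proots_complex monic_char_poly_mat)
  have "char_poly_mat g = (\<Prod>t\<in>#mset ts. [:- t, 1:])"
    using complex_poly_decompose_multiset[of "char_poly_mat g"]
    unfolding monic_char_poly_mat(2) ts by simp
  then have "mdet (smat x - g) = poly (\<Prod>t\<in>#mset ts. [:- t, 1:]) x"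
    by (simp flip: poly_char_poly_mat)
  also have "\<dots> = (\<Prod>t\<leftarrow>ts. x - t)"
    by (induction ts) (simp_all add: left_diff_distrib)
  also have "\<dots> = (\<Prod>a<length ts. x - ts ! a)"
    by (simp add: prod.list_conv_set_nth atLeast0LessThan)
  finally show ?thesis by (simp add: length eigs_def ts_def[symmetric])
qed

lemma mdet_smat_minus_smat_mult:
  fixes g :: "complex^'n^'n"
  shows "mdet (smat x - smat c ** g) = (\<Prod>a<CARD('n). x - c * eigs g a)"
proof (cases "c = 0")
  case True
  then have "smat x - smat c ** g = smat x ** smat 1" by (simp add: vec_eq_iff smat_nth)
  then show ?thesis using True by (simp only: mdet_smat_mult) simp
next
  case False
  then have "smat x - smat c ** g = smat c ** (smat (x / c) - g)"
    by (simp add: vec_eq_iff smat_nth algebra_simps)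
  then have "mdet (smat x - smat c ** g) = c ^ CARD('n) * (\<Prod>a<CARD('n). x / c - eigs g a)"
    by (simp only: mdet_smat_mult mdet_smat_minus)
  also have "\<dots> = (\<Prod>a<CARD('n). c * (x / c - eigs g a))"
    unfolding prod.distrib by simp
  finally show ?thesis using False by (simp add: algebra_simps)
qed

lemma mdet_eigs:
  fixes g :: "complex^'n^'n"
  shows "mdet g = (\<Prod>a<CARD('n). eigs g a)"
proof -
  have "smat 0 - smat (-1) ** g = g" by (simp add: vec_eq_iff smat_nth)
  then show ?thesis using mdet_smat_minus_smat_mult[of 0 "-1" g] by simp
qed

subsection \<open>Resolvents\<close>

lemma matrix_inv_nonsingular:
  fixes M :: "'a::field^'n^'n"
  assumes "mdet M \<noteq> 0"
  shows "M ** matrix_inv M = smat 1" "matrix_inv M ** M = smat 1"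
proof -
  have "\<exists>B. M ** B = smat 1 \<and> B ** M = smat 1"
    using assms by (simp add: invertible_det_nz[symmetric] invertible_def)
  then have "M ** matrix_inv M = smat 1 \<and> matrix_inv M ** M = smat 1"
    unfolding matrix_inv_def by (rule someI_ex)
  then show "M ** matrix_inv M = smat 1" "matrix_inv M ** M = smat 1" by auto
qed

definition gres :: "complex \<Rightarrow> complex^'n^'n \<Rightarrow> complex^'n^'n" where
  "gres w g = g ** matrix_inv (smat w - g)"

lemma gres_cancel:
  assumes "mdet (smat w - g) \<noteq> 0"
  shows "gres w g ** (smat w - g) = g" "(smat w - g) ** gres w g = g"
proof -
  show "gres w g ** (smat w - g) = g"
    by (simp add: gres_def matrix_mul_assoc[symmetric] matrix_inv_nonsingular[OF assms])
  have "(smat w - g) ** g = g ** (smat w - g)"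
    by (simp add: matrix_diff_ldistrib matrix_diff_rdistrib vec_eq_iff)
  then show "(smat w - g) ** gres w g = g"
    by (simp add: gres_def matrix_mul_assoc) (simp add: matrix_mul_assoc[symmetric] matrix_inv_nonsingular[OF assms])
qed

lemma resolvent_identity:
  assumes nonsingular: "mdet (smat w - g) \<noteq> 0" "mdet (smat w' - g) \<noteq> 0"
  shows "smat (w - w') ** (gres w g ** gres w' g) = smat w' ** gres w' g - smat w ** gres w g"
    (is "?X = ?Y")
proof -
  let ?M = "smat w - g" and ?M' = "smat w' - g"
  have scalar_left_commute: "A ** (smat c ** B) = smat c ** (A ** B)" for c and A B :: "complex^'n^'n"
    by (simp add: vec_eq_iff matrix_matrix_mult_def smat_nth sum_distrib_left if_distrib if_distribR
        mult.left_commute cong: if_cong)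
  have "?M ** ?X ** ?M' = smat (w - w') ** ((?M ** gres w g) ** (gres w' g ** ?M'))"
    by (simp only: scalar_left_commute matrix_mul_assoc[symmetric])
  also have "\<dots> = smat (w - w') ** (g ** g)"
    by (simp only: gres_cancel(2)[OF nonsingular(1)] gres_cancel(1)[OF nonsingular(2)])
  also have "\<dots> = smat w' ** (?M ** g) - smat w ** (g ** ?M')"
    by (simp add: matrix_diff_ldistrib matrix_diff_rdistrib vec_eq_iff algebra_simps)
  also have "\<dots> = smat w' ** (?M ** (gres w' g ** ?M')) - smat w ** ((?M ** gres w g) ** ?M')"
    by (simp only: gres_cancel(2)[OF nonsingular(1)] gres_cancel(1)[OF nonsingular(2)])
  also have "\<dots> = ?M ** ?Y ** ?M'"
    by (simp only: matrix_diff_ldistrib[of ?M] matrix_diff_rdistrib[of _ _ ?M'] scalar_left_commute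
        matrix_mul_assoc[symmetric])
  finally have "matrix_inv ?M ** (?M ** ?X ** ?M') ** matrix_inv ?M' =
      matrix_inv ?M ** (?M ** ?Y ** ?M') ** matrix_inv ?M'" by simp
  moreover have "matrix_inv ?M ** (?M ** A ** ?M') ** matrix_inv ?M' = A" for A
    by (metis matrix_inv_nonsingular nonsingular matrix_mul_assoc matrix_mul_lid matrix_mul_rid)
  ultimately show ?thesis by simp
qed

lemma trace_gres:
  fixes g :: "complex^'n^'n"
  assumes nonsingular: "mdet (smat w - g) \<noteq> 0"
  shows "trace (gres w g) = (\<Sum>a<CARD('n). eigs g a / (w - eigs g a))"
proof -
  let ?M = "smat w - g" and ?s = "\<lambda>a. eigs g a / (w - eigs g a)"
  define D where "D = mdet (\<chi> i j. [:of_bool (i = j), (- gres w g) $ i $ j:])"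
  have nonzero: "w - eigs g a \<noteq> 0" if "a < CARD('n)" for a
    using nonsingular that by (auto simp: mdet_smat_minus)
  have "poly D y = poly (\<Prod>a<CARD('n). [:1, - ?s a:]) y" for y
  proof -
    have "(\<chi> i j. poly ([:of_bool (i = j), (- gres w g) $ i $ j:]) y) = smat 1 - smat y ** gres w g"
      by (simp add: vec_eq_iff smat_nth)
    then have "poly D y * mdet ?M = mdet ((smat 1 - smat y ** gres w g) ** ?M)"
      by (simp add: D_def poly_mdet det_mul)
    also have "(smat 1 - smat y ** gres w g) ** ?M = smat w - smat (1 + y) ** g"
      by (simp add: matrix_diff_rdistrib matrix_mul_assoc[symmetric] gres_cancel[OF nonsingular])
        (simp add: vec_eq_iff algebra_simps)
    also have "mdet \<dots> = (\<Prod>a<CARD('n). (1 - y * ?s a) * (w - eigs g a))"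
      unfolding mdet_smat_minus_smat_mult
      by (rule prod.cong) (use nonzero in \<open>auto simp: field_simps\<close>)
    also have "\<dots> = (\<Prod>a<CARD('n). 1 - y * ?s a) * mdet ?M"
      by (simp add: prod.distrib mdet_smat_minus)
    finally show ?thesis using nonsingular by (simp add: poly_prod)
  qed
  then have "D = (\<Prod>a<CARD('n). [:1, - ?s a:])" by (simp add: poly_eq_poly_eq_iff[symmetric] fun_eq_iff)
  then have "poly (pderiv D) 0 = - (\<Sum>a<CARD('n). ?s a)"
    using pderiv_prod_linear(1)[of "{..<CARD('n)}" "\<lambda>_. 1" "\<lambda>a. - ?s a" 0]
    by (simp add: poly_prod sum_negf)
  moreover have "poly (pderiv D) 0 = - trace (gres w g)"
    unfolding D_def pderiv_mdet_identity_plus by (simp add: trace_def sum_negf)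
  ultimately show ?thesis by simp
qed

lemma trace_gres_mult:
  fixes g :: "complex^'n^'n"
  assumes nonsingular: "mdet (smat w - g) \<noteq> 0" "mdet (smat w' - g) \<noteq> 0" and "w \<noteq> w'"
  shows "trace (gres w g ** gres w' g) =
    (\<Sum>a<CARD('n). eigs g a / (w - eigs g a) * (eigs g a / (w' - eigs g a)))"
proof -
  have trace_smat: "trace (smat c ** A) = c * trace A" for c and A :: "complex^'n^'n"
    by (simp add: trace_def sum_distrib_left)
  have nonzero: "w - eigs g a \<noteq> 0" "w' - eigs g a \<noteq> 0" if "a < CARD('n)" for a
    using nonsingular that by (auto simp: mdet_smat_minus)
  have "(w - w') * trace (gres w g ** gres w' g) = w' * trace (gres w' g) - w * trace (gres w g)"
    using arg_cong[OF resolvent_identity[OF nonsingular], of trace] by (simp add: trace_sub trace_smat)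
  also have "\<dots> = (\<Sum>a<CARD('n). w' * (eigs g a / (w' - eigs g a)) - w * (eigs g a / (w - eigs g a)))"
    by (simp only: trace_gres[OF nonsingular(1)] trace_gres[OF nonsingular(2)] sum_subtractf sum_distrib_left)
  also have "\<dots> = (\<Sum>a<CARD('n). (w - w') * (eigs g a / (w - eigs g a) * (eigs g a / (w' - eigs g a))))"
    by (rule sum.cong) (use nonzero in \<open>auto simp: divide_simps\<close>, simp add: algebra_simps)
  also have "\<dots> = (w - w') * (\<Sum>a<CARD('n). eigs g a / (w - eigs g a) * (eigs g a / (w' - eigs g a)))"
    by (simp only: sum_distrib_left)
  finally show ?thesis using \<open>w \<noteq> w'\<close> by simp
qed

subsection \<open>The unitary group\<close>

lemma conj_transpose_nth [simp]: "conj_transpose A $ i $ j = cnj (A $ j $ i)"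
  by (simp add: conj_transpose_def)

lemma conj_transpose_conj_transpose [simp]: "conj_transpose (conj_transpose A) = A"
  by (simp add: vec_eq_iff)

lemma conj_transpose_mult: "conj_transpose (A ** B) = conj_transpose B ** conj_transpose A"
  by (simp add: vec_eq_iff matrix_matrix_mult_def mult.commute)

lemma unitary_mult: "g \<in> unitary_group \<Longrightarrow> h \<in> unitary_group \<Longrightarrow> g ** h \<in> unitary_group"
  unfolding unitary_group_def mem_Collect_eq conj_transpose_mult
  by (metis matrix_mul_assoc matrix_mul_lid)

lemma unitary_conj_transpose: "g \<in> unitary_group \<Longrightarrow> conj_transpose g \<in> unitary_group"
  by (simp add: unitary_group_def)

lemma unitary_groupI: "g ** conj_transpose g = smat 1 \<Longrightarrow> g \<in> unitary_group"
  by (simp add: unitary_group_def matrix_left_right_inverse)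

lemma norm_one_mult_cnj: "norm z = 1 \<Longrightarrow> z * cnj z = 1"
  by (simp add: complex_norm_square[symmetric])

lemma unitary_smat: "norm z = 1 \<Longrightarrow> (smat z :: complex^'n^'n) \<in> unitary_group"
  by (rule unitary_groupI) (simp add: vec_eq_iff smat_nth norm_one_mult_cnj)

lemma sum_mult_cnj:
  fixes v :: "complex^'n"
  shows "(\<Sum>a\<in>UNIV. v $ a * cnj (v $ a)) = (of_real (norm v))\<^sup>2"
proof -
  have "(norm v)\<^sup>2 = (\<Sum>a\<in>UNIV. (norm (v $ a))\<^sup>2)"
    by (simp add: norm_vec_def L2_set_def sum_nonneg)
  then show ?thesis by (simp only: of_real_sum complex_norm_square flip: of_real_power)
qed

definition reflection :: "complex^'n \<Rightarrow> complex \<Rightarrow> complex^'n^'n" where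
  "reflection v z = smat 1 + outer v (\<chi> b. (z - 1) / (of_real (norm v))\<^sup>2 * cnj (v $ b))"

lemma unitary_reflection:
  fixes v :: "complex^'n"
  assumes v: "v \<noteq> 0" and z: "norm z = 1"
  shows "reflection v z \<in> unitary_group"
proof (rule unitary_groupI)
  let ?h = "reflection v z" and ?\<nu> = "(of_real (norm v))\<^sup>2 :: complex"
  define c where "c = (z - 1) / ?\<nu>"
  have "?\<nu> \<noteq> 0" using v by simp
  then have "(c + cnj c + c * cnj c * ?\<nu>) * ?\<nu> = z * cnj z - 1"
    by (simp add: c_def field_simps power2_eq_square)
  then have coefficient: "c + cnj c + c * cnj c * ?\<nu> = 0"
    using \<open>?\<nu> \<noteq> 0\<close> by (simp add: norm_one_mult_cnj[OF z])
  have h: "?h $ i $ j = (if i = j then 1 else 0) + c * (v $ i * cnj (v $ j))" for i j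
    by (simp add: reflection_def smat_nth c_def mult_ac)
  have "(\<Sum>k\<in>UNIV. ?h $ i $ k * cnj (?h $ j $ k)) = (if i = j then 1 else 0)" for i j
  proof -
    have "?h $ i $ k * cnj (?h $ j $ k) =
        (if i = k then if j = k then 1 else 0 else 0) + (if i = k then cnj c * (cnj (v $ j) * v $ k) else 0) +
        (if j = k then c * (v $ i * cnj (v $ k)) else 0) +
        (c * cnj c) * (v $ i * cnj (v $ j)) * (v $ k * cnj (v $ k))" for k
      by (simp add: h algebra_simps)
    then have "(\<Sum>k\<in>UNIV. ?h $ i $ k * cnj (?h $ j $ k)) =
       (if i = j then 1 else 0) + (c + cnj c + c * cnj c * ?\<nu>) * (v $ i * cnj (v $ j))"
      by (simp add: sum.distrib sum_distrib_left[symmetric] sum_mult_cnj) (simp add: algebra_simps)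
    then show ?thesis by (simp add: coefficient)
  qed
  then show "?h ** conj_transpose ?h = smat 1"
    by (simp add: vec_eq_iff matrix_matrix_mult_def smat_nth)
qed

lemma mdet_reflection:
  assumes "v \<noteq> 0"
  shows "mdet (reflection v z) = z"
proof -
  have "(\<Sum>b\<in>UNIV. v $ b * ((z - 1) / (of_real (norm v))\<^sup>2 * cnj (v $ b))) =
      (z - 1) / (of_real (norm v))\<^sup>2 * (\<Sum>b\<in>UNIV. v $ b * cnj (v $ b))"
    unfolding sum_distrib_left by (rule sum.cong) (simp_all only: mult.left_commute)
  then show ?thesis
    using assms by (simp add: reflection_def mdet_identity_plus_outer sum_mult_cnj)
qed

definition hform :: "complex^'n \<Rightarrow> complex^'n^'n \<Rightarrow> complex" where
  "hform v A = (\<Sum>a\<in>UNIV. \<Sum>b\<in>UNIV. cnj (v $ a) * A $ a $ b * v $ b)"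

lemma hform_identity: "hform v (smat 1) = (of_real (norm v))\<^sup>2"
  by (simp add: hform_def smat_nth if_distrib if_distribR mult.commute flip: sum_mult_cnj cong: if_cong)

lemma mdet_smat_minus_reflection_mult:
  assumes nonsingular: "mdet (smat w - g) \<noteq> 0"
  shows "mdet (smat w - reflection v z ** g) =
    mdet (smat w - g) * (1 - (z - 1) * (hform v (gres w g) / (of_real (norm v))\<^sup>2))"
proof -
  let ?M = "smat w - g"
  define y where "y = (\<chi> b. (z - 1) / (of_real (norm v))\<^sup>2 * cnj (v $ b))"
  define u where "u = y v* gres w g"
  have "reflection v z ** g = g + outer v (u v* ?M)"
    unfolding reflection_def y_def[symmetric]
    by (simp add: u_def matrix_add_rdistrib outer_matrix_mult vector_matrix_mul_assoc gres_cancel[OF nonsingular])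
  then have "smat w - reflection v z ** g = (smat 1 + outer (- v) u) ** ?M"
    by (simp add: matrix_add_rdistrib outer_matrix_mult vec_eq_iff)
  then have "mdet (smat w - reflection v z ** g) = mdet ?M * (1 + (\<Sum>b\<in>UNIV. (- v) $ b * u $ b))"
    by (simp only: det_mul mdet_identity_plus_outer mult.commute)
  also have "(\<Sum>b\<in>UNIV. (- v) $ b * u $ b) = (\<Sum>b\<in>UNIV. \<Sum>a\<in>UNIV.
      - ((z - 1) / (of_real (norm v))\<^sup>2) * (cnj (v $ a) * gres w g $ a $ b * v $ b))"
    by (simp add: u_def y_def vector_matrix_mult_def sum_distrib_left sum_negf mult_ac)
  also have "\<dots> = - ((z - 1) / (of_real (norm v))\<^sup>2) * hform v (gres w g)"
    unfolding hform_def sum_distrib_left by (rule sum.swap)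
  finally show ?thesis by simp
qed

lemma norm_unitary_mult:
  assumes g: "g \<in> unitary_group"
  shows "norm (g *v x) = norm x"
proof -
  have orthonormal: "(\<Sum>i\<in>UNIV. cnj (g $ i $ j) * g $ i $ k) = (if j = k then 1 else 0)" for j k
    using g by (simp add: unitary_group_def vec_eq_iff matrix_matrix_mult_def smat_nth)
  have "(of_real (norm (g *v x)))\<^sup>2 =
      (\<Sum>i\<in>UNIV. \<Sum>k\<in>UNIV. \<Sum>j\<in>UNIV. x $ k * cnj (x $ j) * (cnj (g $ i $ j) * g $ i $ k))"
    unfolding sum_mult_cnj[symmetric] by (simp add: matrix_vector_mult_def sum_product mult_ac)
  also have "\<dots> = (\<Sum>k\<in>UNIV. \<Sum>j\<in>UNIV. \<Sum>i\<in>UNIV. x $ k * cnj (x $ j) * (cnj (g $ i $ j) * g $ i $ k))"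
    by (subst sum.swap, rule sum.cong[OF refl], subst sum.swap) simp
  also have "\<dots> = (\<Sum>k\<in>UNIV. x $ k * cnj (x $ k))"
    by (simp add: orthonormal if_distrib cong: if_cong flip: sum_distrib_left)
  finally have "((of_real (norm (g *v x)))\<^sup>2 :: complex) = (of_real (norm x))\<^sup>2" by (simp only: sum_mult_cnj)
  then show ?thesis by (simp only: of_real_eq_iff power2_eq_iff_nonneg norm_ge_zero flip: of_real_power)
qed

lemma unitary_eigenvalue_norm:
  fixes g :: "complex^'n^'n"
  assumes g: "g \<in> unitary_group" and singular: "mdet (smat c - g) = 0"
  shows "norm c = 1"
proof -
  have "\<not> invertible (smat c - g)" using singular by (simp add: invertible_det_nz)
  then have "\<not> (\<exists>B. B ** (smat c - g) = smat 1)"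
    unfolding invertible_def using matrix_left_right_inverse by blast
  then obtain x where x: "(smat c - g) *v x = 0" "x \<noteq> 0"
    unfolding matrix_left_invertible_ker by blast
  have "smat c *v x = c *s x"
    by (simp add: vec_eq_iff matrix_vector_mult_def smat_nth if_distrib if_distribR cong: if_cong)
  then have "g *v x = c *s x"
    using x(1) by (simp add: matrix_vector_mult_diff_rdistrib)
  then have "norm (c *s x) = norm x" using norm_unitary_mult[OF g, of x] by simp
  moreover have "norm (c *s x) = norm c * norm x"
    by (simp add: norm_vec_def L2_set_def norm_mult power_mult_distrib real_sqrt_mult flip: sum_distrib_left)
  ultimately show ?thesis using x(2) by simp
qed

lemma norm_eigs:
  fixes g :: "complex^'n^'n"
  assumes "g \<in> unitary_group" "a < CARD('n)"
  shows "norm (eigs g a) = 1"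
  by (rule unitary_eigenvalue_norm[OF assms(1)]) (use assms(2) in \<open>auto simp: mdet_smat_minus\<close>)

lemma eigs_nonzero:
  fixes g :: "complex^'n^'n"
  assumes "g \<in> unitary_group" "a < CARD('n)"
  shows "eigs g a \<noteq> 0"
  using norm_eigs[OF assms] by auto

lemma mdet_unitary_nonzero: "g \<in> unitary_group \<Longrightarrow> mdet g \<noteq> 0"
  by (auto simp: mdet_eigs eigs_nonzero)

lemma mdet_smat_minus_nonzero:
  "g \<in> unitary_group \<Longrightarrow> norm w \<noteq> 1 \<Longrightarrow> mdet (smat w - g) \<noteq> 0"
  using unitary_eigenvalue_norm by blast

lemma mdet_one_minus_conj_transpose:
  fixes g :: "complex^'n^'n"
  assumes g: "g \<in> unitary_group"
  shows "mdet (smat 1 - smat \<alpha> ** conj_transpose g) = (\<Prod>a<CARD('n). 1 - \<alpha> * inverse (eigs g a))"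
proof -
  have "g ** (smat \<alpha> ** conj_transpose g) = smat \<alpha> ** (g ** conj_transpose g)"
    by (simp add: vec_eq_iff matrix_matrix_mult_def smat_nth sum_distrib_left if_distrib if_distribR
        mult.left_commute cong: if_cong)
  then have "g ** (smat 1 - smat \<alpha> ** conj_transpose g) = smat (- \<alpha>) - smat (-1) ** g"
    using g by (simp add: matrix_diff_ldistrib unitary_group_def vec_eq_iff smat_nth)
  then have "mdet g * mdet (smat 1 - smat \<alpha> ** conj_transpose g) = mdet (smat (- \<alpha>) - smat (-1) ** g)"
    by (metis det_mul)
  also have "\<dots> = (\<Prod>a<CARD('n). eigs g a * (1 - \<alpha> * inverse (eigs g a)))"
    unfolding mdet_smat_minus_smat_mult
    by (rule prod.cong) (simp_all add: eigs_nonzero[OF g] algebra_simps)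
  finally show ?thesis
    using mdet_unitary_nonzero[OF g] by (simp add: prod.distrib flip: mdet_eigs)
qed

subsection \<open>Haar measure\<close>

lemma continuous_on_mdet:
  fixes M :: "'a::topological_space \<Rightarrow> complex^'n^'n"
  assumes "\<And>i j. continuous_on S (\<lambda>x. M x $ i $ j)"
  shows "continuous_on S (\<lambda>x. mdet (M x))"
  unfolding Determinants.det_def by (intro continuous_intros assms)

lemma continuous_on_matrix_mult_left: "continuous_on S (\<lambda>g :: complex^'n^'m. h ** g)"
  unfolding matrix_matrix_mult_def by (intro continuous_intros)

lemma compact_unitary_group: "compact (unitary_group :: (complex^'n^'n) set)"
proof -
  have "unitary_group = (\<Inter>i j. {g :: complex^'n^'n. (g ** conj_transpose g) $ i $ j = smat 1 $ i $ j} \<inter>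
      {g. (conj_transpose g ** g) $ i $ j = smat 1 $ i $ j})"
    by (auto simp: unitary_group_def vec_eq_iff)
  moreover have "closed \<dots>"
    unfolding matrix_matrix_mult_def conj_transpose_def vec_lambda_beta
    by (intro closed_INT ballI closed_Int closed_Collect_eq continuous_intros)
  moreover have "norm g \<le> (\<Sum>i\<in>(UNIV :: 'n set). 1)" if g: "g \<in> unitary_group" for g :: "complex^'n^'n"
  proof -
    have "norm (g $ i) = 1" for i
    proof -
      have "(g ** conj_transpose g) $ i $ i = 1" using g by (simp add: unitary_group_def smat_nth)
      then have "(of_real (norm (g $ i)))\<^sup>2 = (1 :: complex)"
        by (simp add: matrix_matrix_mult_def flip: sum_mult_cnj)
      then show ?thesis
        using norm_ge_zero[of "g $ i"] by (auto simp: power2_eq_1_iff simp flip: of_real_power)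
    qed
    then show ?thesis
      unfolding norm_vec_def[of g] using L2_set_le_sum[of UNIV "\<lambda>i. norm (g $ i)"] by simp
  qed
  then have "bounded (unitary_group :: (complex^'n^'n) set)" unfolding bounded_iff by blast
  ultimately show ?thesis by (simp add: compact_eq_bounded_closed)
qed

locale haar_unitary =
  fixes \<mu> :: "(complex^'n^'n) measure"
  assumes haar: "haar_prob_measure \<mu>"
begin

lemma sets_haar: "sets \<mu> = sets (restrict_space borel unitary_group)"
  using haar by (simp add: haar_prob_measure_def)

lemma space_haar: "space \<mu> = unitary_group"
  using sets_eq_imp_space_eq[OF sets_haar] by (simp add: space_restrict_space)

sublocale finite_measure \<mu>
  by (rule finite_measureI) (use haar in \<open>simp add: haar_prob_measure_def\<close>)

lemma haar_integral_const: "(LINT g|\<mu>. (c :: complex)) = c"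
  using haar by (simp add: haar_prob_measure_def measure_def)

lemma integral_haar_cong:
  fixes f f' :: "complex^'n^'n \<Rightarrow> complex"
  assumes "\<And>g. g \<in> unitary_group \<Longrightarrow> f g = f' g"
  shows "integrable \<mu> f \<longleftrightarrow> integrable \<mu> f'" and "(LINT g|\<mu>. f g) = (LINT g|\<mu>. f' g)"
  by (rule Bochner_Integration.integrable_cong Bochner_Integration.integral_cong;
      simp add: space_haar assms)+

lemma measurable_continuous:
  fixes f :: "complex^'n^'n \<Rightarrow> 'b::topological_space"
  assumes "continuous_on unitary_group f"
  shows "f \<in> borel_measurable \<mu>"
  using borel_measurable_continuous_on_restrict[OF assms] measurable_cong_sets[OF sets_haar refl] by blast

lemma integrable_continuous_on_unitary_group:
  fixes f :: "complex^'n^'n \<Rightarrow> complex"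
  assumes "continuous_on unitary_group f"
  shows "integrable \<mu> f"
proof -
  have "bounded (f ` unitary_group)"
    by (rule compact_imp_bounded[OF compact_continuous_image[OF assms compact_unitary_group]])
  then obtain B where "\<And>g. g \<in> unitary_group \<Longrightarrow> norm (f g) \<le> B"
    by (auto simp: bounded_iff)
  then show ?thesis
    by (intro integrable_const_bound[of _ B] AE_I2 measurable_continuous assms) (simp add: space_haar)
qed

lemma measurable_left_translation:
  assumes h: "h \<in> unitary_group"
  shows "(\<lambda>g. h ** g) \<in> measurable \<mu> \<mu>"
proof -
  have "(\<lambda>g. h ** g) \<in> borel_measurable \<mu>"
    by (rule measurable_continuous) (rule continuous_on_matrix_mult_left)
  then have "(\<lambda>g. h ** g) \<in> measurable \<mu> (restrict_space borel unitary_group)"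
    by (intro measurable_restrict_space2) (auto simp: space_haar unitary_mult[OF h])
  then show ?thesis
    using measurable_cong_sets[OF refl sets_haar] by blast
qed

lemma distr_translation:
  assumes h: "h \<in> unitary_group"
  shows "distr \<mu> \<mu> (\<lambda>g. h ** g) = \<mu>"
proof (rule measure_eqI)
  have inverse: "h ** conj_transpose h = smat 1" "conj_transpose h ** h = smat 1"
    using h by (auto simp: unitary_group_def)
  fix E assume "E \<in> sets (distr \<mu> \<mu> (\<lambda>g. h ** g))"
  then have E: "E \<in> sets \<mu>" by simp
  then have sub: "E \<subseteq> unitary_group" using sets.sets_into_space[of E \<mu>] by (simp add: space_haar)
  have "(\<lambda>g. h ** g) -` E \<inter> space \<mu> = (\<lambda>g. conj_transpose h ** g) ` E"
  proof (intro equalityI subsetI)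
    fix g assume "g \<in> (\<lambda>g. h ** g) -` E \<inter> space \<mu>"
    then have "h ** g \<in> E" "g = conj_transpose h ** (h ** g)"
      by (auto simp: matrix_mul_assoc inverse)
    then show "g \<in> (\<lambda>g. conj_transpose h ** g) ` E" by blast
  next
    fix g assume "g \<in> (\<lambda>g. conj_transpose h ** g) ` E"
    then show "g \<in> (\<lambda>g. h ** g) -` E \<inter> space \<mu>"
      using sub unitary_mult[OF unitary_conj_transpose[OF h]]
      by (auto simp: matrix_mul_assoc inverse space_haar)
  qed
  then have "emeasure (distr \<mu> \<mu> (\<lambda>g. h ** g)) E = emeasure \<mu> ((\<lambda>g. conj_transpose h ** g) ` E)"
    by (simp add: emeasure_distr[OF measurable_left_translation[OF h] E])
  also have "\<dots> = emeasure \<mu> E"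
    using haar unitary_conj_transpose[OF h] E by (simp add: haar_prob_measure_def)
  finally show "emeasure (distr \<mu> \<mu> (\<lambda>g. h ** g)) E = emeasure \<mu> E" .
qed simp

lemma integrable_translation:
  fixes f :: "complex^'n^'n \<Rightarrow> complex"
  assumes h: "h \<in> unitary_group" and f: "continuous_on unitary_group f"
  shows "integrable \<mu> (\<lambda>g. f (h ** g))"
  by (intro integrable_continuous_on_unitary_group continuous_on_compose2[OF f] continuous_on_matrix_mult_left)
    (auto simp: unitary_mult[OF h])

lemma integral_translation:
  fixes f :: "complex^'n^'n \<Rightarrow> complex"
  assumes h: "h \<in> unitary_group" and f: "continuous_on unitary_group f"
  shows "(LINT g|\<mu>. f (h ** g)) = (LINT g|\<mu>. f g)"
  using integral_distr[OF measurable_left_translation[OF h] measurable_continuous[OF f]]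
  by (simp add: distr_translation[OF h])

text \<open>Coefficients are averages of values on the unit circle, so no differentiation under the
  integral is needed.\<close>

lemma orbit_poly_coeff:
  fixes p :: "complex^'n^'n \<Rightarrow> complex poly"
  assumes f: "continuous_on unitary_group f"
    and degree: "\<And>g. g \<in> unitary_group \<Longrightarrow> degree (p g) \<le> d"
    and orbit: "\<And>z. norm z = 1 \<Longrightarrow> \<exists>h\<in>unitary_group. \<forall>g\<in>unitary_group. poly (p g) z = z ^ k * f (h ** g)"
  shows "integrable \<mu> (\<lambda>g. coeff (p g) j)"
    and "(LINT g|\<mu>. coeff (p g) j) = of_bool (k = j) * (LINT g|\<mu>. f g)"
proof -
  define M where "M = Suc (max d (max j k))"
  have M: "d < M" "j < M" "k < M" by (auto simp: M_def)
  obtain h where h: "\<And>s. h s \<in> unitary_group"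
    "\<And>s g. g \<in> unitary_group \<Longrightarrow> poly (p g) (unit_root M s) = unit_root M s ^ k * f (h s ** g)"
    using orbit[OF norm_unit_root] by metis
  have coeff: "coeff (p g) j = (\<Sum>s<M. unit_root M s ^ k / unit_root M s ^ j / of_nat M * f (h s ** g))"
    if "g \<in> unitary_group" for g
    using coeff_circle_average[of "p g" M j] degree[OF that] M h(2)[OF that]
    by (simp add: sum_divide_distrib)
  have average: "integrable \<mu> (\<lambda>g. coeff (p g) j) \<longleftrightarrow>
      integrable \<mu> (\<lambda>g. \<Sum>s<M. unit_root M s ^ k / unit_root M s ^ j / of_nat M * f (h s ** g))"
    "(LINT g|\<mu>. coeff (p g) j) =
      (LINT g|\<mu>. (\<Sum>s<M. unit_root M s ^ k / unit_root M s ^ j / of_nat M * f (h s ** g)))"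
    by (rule integral_haar_cong; rule coeff; assumption)+
  show "integrable \<mu> (\<lambda>g. coeff (p g) j)"
    unfolding average(1) by (simp add: integrable_translation[OF h(1) f])
  have "(LINT g|\<mu>. coeff (p g) j) = (\<Sum>s<M. unit_root M s ^ k / unit_root M s ^ j / of_nat M * (LINT g|\<mu>. f g))"
    unfolding average(2) by (simp add: integrable_translation[OF h(1) f] integral_translation[OF h(1) f])
  also have "\<dots> = (\<Sum>s<M. unit_root M s ^ k / unit_root M s ^ j) / of_nat M * (LINT g|\<mu>. f g)"
    by (simp add: sum_divide_distrib sum_distrib_right)
  also have "(\<Sum>s<M. unit_root M s ^ k / unit_root M s ^ j) / of_nat M = of_bool (k = j)"
    using unit_root_average[of 1 k M j] M by simp
  finally show "(LINT g|\<mu>. coeff (p g) j) = of_bool (k = j) * (LINT g|\<mu>. f g)" .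
qed

lemma orbit_product_moments:
  fixes f :: "complex^'n^'n \<Rightarrow> complex" and q :: "complex^'n^'n \<Rightarrow> 't \<Rightarrow> complex"
  assumes f: "continuous_on unitary_group f" and T: "finite T"
    and orbit: "\<And>z. norm z = 1 \<Longrightarrow> \<exists>h\<in>unitary_group. \<forall>g\<in>unitary_group.
      f g * (\<Prod>t\<in>T. 1 - (z - 1) * q g t) = z ^ k * f (h ** g)"
  shows "integrable \<mu> (\<lambda>g. f g * (\<Sum>t\<in>T. q g t))"
    and "(LINT g|\<mu>. f g * (\<Sum>t\<in>T. q g t)) = - of_nat k * (LINT g|\<mu>. f g)"
    and "integrable \<mu> (\<lambda>g. f g * ((\<Sum>t\<in>T. q g t)\<^sup>2 - (\<Sum>t\<in>T. (q g t)\<^sup>2)))"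
    and "(LINT g|\<mu>. f g * ((\<Sum>t\<in>T. q g t)\<^sup>2 - (\<Sum>t\<in>T. (q g t)\<^sup>2))) =
      of_nat k * (of_nat k - 1) * (LINT g|\<mu>. f g)"
proof -
  define p where "p = (\<lambda>g. smult (f g) (\<Prod>t\<in>T. [:1 + q g t, - q g t:]))"
  define M where "M = Suc (max (card T) k)"
  have degree: "degree (p g) \<le> card T" for g
  proof -
    have "degree (p g) \<le> (\<Sum>t\<in>T. degree [:1 + q g t, - q g t:])"
      unfolding p_def using degree_prod_sum_le[OF T, of "\<lambda>t. [:1 + q g t, - q g t:]"]
      by (intro order_trans[OF degree_smult_le]) (simp add: o_def)
    also have "\<dots> \<le> (\<Sum>t\<in>T. 1)" by (rule sum_mono) simp
    finally show ?thesis by simp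
  qed
  have "\<exists>h\<in>unitary_group. \<forall>g\<in>unitary_group. poly (p g) z = z ^ k * f (h ** g)" if "norm z = 1" for z
    using orbit[OF that] by (simp add: p_def poly_prod algebra_simps)
  note coeff = orbit_poly_coeff[OF f degree this]
  have M: "degree (p g) < M" "k < M" for g using degree[of g] by (auto simp: M_def)
  have derivs: "f g * (\<Sum>t\<in>T. q g t) = - poly (pderiv (p g)) 1"
    "f g * ((\<Sum>t\<in>T. q g t)\<^sup>2 - (\<Sum>t\<in>T. (q g t)\<^sup>2)) = poly (pderiv (pderiv (p g))) 1" for g
    using pderiv_prod_linear[of T "\<lambda>t. 1 + q g t" "\<lambda>t. - q g t" 1]
    by (simp_all add: p_def pderiv_smult poly_prod sum_negf)
  have euler: "poly (pderiv (p g)) 1 = (\<Sum>j<M. of_nat j * coeff (p g) j)"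
    "poly (pderiv (pderiv (p g))) 1 = (\<Sum>j<M. of_nat j * (of_nat j - 1) * coeff (p g) j)" for g
    using euler_operator_poly[OF M(1)[of g], of 1] by simp_all
  have moment: "integrable \<mu> (\<lambda>g. \<Sum>j<M. c j * coeff (p g) j)"
    "(LINT g|\<mu>. (\<Sum>j<M. c j * coeff (p g) j)) = c k * (LINT g|\<mu>. f g)" for c
    using M(2) by (simp_all add: coeff(1) coeff(2) of_bool_def if_distrib if_distribR cong: if_cong)
  show "integrable \<mu> (\<lambda>g. f g * (\<Sum>t\<in>T. q g t))"
    "(LINT g|\<mu>. f g * (\<Sum>t\<in>T. q g t)) = - of_nat k * (LINT g|\<mu>. f g)"
    unfolding derivs(1) euler(1) sum_negf[symmetric] mult_minus_left[symmetric] by (rule moment)+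
  show "integrable \<mu> (\<lambda>g. f g * ((\<Sum>t\<in>T. q g t)\<^sup>2 - (\<Sum>t\<in>T. (q g t)\<^sup>2)))"
    "(LINT g|\<mu>. f g * ((\<Sum>t\<in>T. q g t)\<^sup>2 - (\<Sum>t\<in>T. (q g t)\<^sup>2))) =
      of_nat k * (of_nat k - 1) * (LINT g|\<mu>. f g)"
    unfolding derivs(2) euler(2) by (rule moment)+
qed

end

subsection \<open>Moments of products of characteristic polynomials\<close>

text \<open>Writing \<open>v = axis a 1 + \<omega> *s axis b 1\<close>, the values at \<open>\<omega> = 0\<close> and at the fourth roots of unity \<open>\<omega>\<close>
  determine the symmetrised bilinear form.\<close>

lemma trace_polarization:
  obtains T :: "('n::finite \<times> 'n \<times> complex) set" and c :: "'n \<times> 'n \<times> complex \<Rightarrow> complex"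
    and v :: "'n \<times> 'n \<times> complex \<Rightarrow> complex^'n"
  where "finite T" "\<And>A B. trace A * trace B + trace (A ** B) = (\<Sum>t\<in>T. c t * (hform (v t) A * hform (v t) B))"
proof
  let ?\<Omega> = "{0, 1, \<i>, -1, -\<i>} :: complex set"
  let ?v = "\<lambda>(a :: 'n, b :: 'n, \<omega>). axis a 1 + \<omega> *s axis b 1 :: complex^'n"
  let ?c = "\<lambda>(a :: 'n, b :: 'n, \<omega>). if \<omega> = 0 then -1 else 1 / 8 :: complex"
  show "finite (UNIV \<times> UNIV \<times> ?\<Omega> :: ('n \<times> 'n \<times> complex) set)" by simp
  fix A B :: "complex^'n^'n"
  have hform_v: "hform (?v (a, b, \<omega>)) A = A $ a $ a + \<omega> * cnj \<omega> * A $ b $ b + \<omega> * A $ a $ b + cnj \<omega> * A $ b $ a"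
    for a b \<omega> and A :: "complex^'n^'n"
  proof -
    have "hform (?v (a, b, \<omega>)) A = (\<Sum>i\<in>UNIV. \<Sum>j\<in>UNIV.
        (if j = a then if i = a then A $ i $ j else 0 else 0) +
        (if j = b then if i = b then \<omega> * cnj \<omega> * A $ i $ j else 0 else 0) +
        (if j = b then if i = a then \<omega> * A $ i $ j else 0 else 0) +
        (if j = a then if i = b then cnj \<omega> * A $ i $ j else 0 else 0))"
      unfolding hform_def by (intro sum.cong refl) (auto simp: axis_def algebra_simps)
    then show ?thesis by (simp add: sum.distrib)
  qed
  have quadrature: "(\<Sum>\<omega>\<in>?\<Omega>. ?c (a, b, \<omega>) * (hform (?v (a, b, \<omega>)) A * hform (?v (a, b, \<omega>)) B)) =
      (A $ b $ b * B $ b $ b - A $ a $ a * B $ a $ a + A $ a $ a * B $ b $ b + A $ b $ b * B $ a $ a +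
        A $ a $ b * B $ b $ a + A $ b $ a * B $ a $ b) / 2" for a b
    unfolding hform_v by (simp add: complex_eq_iff) (simp add: field_simps)
  have "(\<Sum>t\<in>UNIV \<times> UNIV \<times> ?\<Omega>. ?c t * (hform (?v t) A * hform (?v t) B)) =
      (\<Sum>a\<in>UNIV. \<Sum>b\<in>UNIV. \<Sum>\<omega>\<in>?\<Omega>. ?c (a, b, \<omega>) * (hform (?v (a, b, \<omega>)) A * hform (?v (a, b, \<omega>)) B))"
    by (simp only: sum.cartesian_product) (simp add: split_def)
  also have "\<dots> = (\<Sum>a\<in>UNIV. \<Sum>b\<in>UNIV. (A $ b $ b * B $ b $ b - A $ a $ a * B $ a $ a) / 2 +
      (A $ a $ a * B $ b $ b + A $ b $ b * B $ a $ a) / 2 + (A $ a $ b * B $ b $ a + A $ b $ a * B $ a $ b) / 2)"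
    unfolding quadrature by (simp add: add_divide_distrib diff_divide_distrib add.assoc)
  also have "\<dots> = trace A * trace B + trace (A ** B)"
  proof -
    have "(\<Sum>a\<in>UNIV. \<Sum>b\<in>UNIV. A $ b $ b * B $ a $ a) = (\<Sum>a\<in>UNIV. \<Sum>b\<in>UNIV. A $ a $ a * B $ b $ b)"
      "(\<Sum>a\<in>UNIV. \<Sum>b\<in>UNIV. A $ b $ a * B $ a $ b) = (\<Sum>a\<in>UNIV. \<Sum>b\<in>UNIV. A $ a $ b * B $ b $ a)"
      by (rule sum.swap)+
    then show ?thesis
      by (simp add: trace_def matrix_matrix_mult_def sum_product sum.distrib sum_subtractf
          flip: sum_divide_distrib sum_distrib_left)
  qed
  finally show "trace A * trace B + trace (A ** B) =
      (\<Sum>t\<in>UNIV \<times> UNIV \<times> ?\<Omega>. ?c t * (hform (?v t) A * hform (?v t) B))" ..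
qed

definition char_prod :: "nat \<Rightarrow> nat \<Rightarrow> (nat \<Rightarrow> complex) \<Rightarrow> complex^'n^'n \<Rightarrow> complex" where
  "char_prod m r w g = (\<Prod>i<r. mdet (smat (w i) - g)) * inverse (mdet g) ^ m"

lemma char_prod_eigs:
  fixes g :: "complex^'n^'n"
  shows "char_prod m r w g = (\<Prod>a<CARD('n). root_factor m r w (eigs g a))"
proof -
  have "(\<Prod>i<r. mdet (smat (w i) - g)) = (\<Prod>a<CARD('n). \<Prod>i<r. w i - eigs g a)"
    unfolding mdet_smat_minus by (rule prod.swap)
  moreover have "inverse (mdet g) ^ m = (\<Prod>a<CARD('n). inverse (eigs g a) ^ m)"
    by (simp only: mdet_eigs prod_inversef[unfolded o_def, symmetric] prod_power_distrib)
  ultimately show ?thesis by (simp add: char_prod_def root_factor_def prod.distrib mult.commute)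
qed

lemma casimir_defect_eigs:
  fixes g :: "complex^'n^'n" and m :: nat
  assumes g: "g \<in> unitary_group" and w: "\<And>i. i < r \<Longrightarrow> norm (w i) \<noteq> 1" and inj: "inj_on w {..<r}"
  defines "s \<equiv> pole_ratio w (eigs g)"
  shows "casimir_defect CARD('n) m r w (eigs g) =
    ((\<Sum>i<r. \<Sum>a<CARD('n). s i a)\<^sup>2 - (\<Sum>i<r. \<Sum>a<CARD('n). (s i a)\<^sup>2)) -
    (\<Sum>i<r. \<Sum>j\<in>{..<r} - {i}. trace (gres (w i) g) * trace (gres (w j) g) +
      trace (gres (w i) g ** gres (w j) g)) +
    (of_nat CARD('n) - 2 * of_nat m) * (\<Sum>i<r. \<Sum>a<CARD('n). s i a) - of_nat (m\<^sup>2 * CARD('n))"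
proof -
  have "trace (gres (w i) g) * trace (gres (w j) g) + trace (gres (w i) g ** gres (w j) g) =
      (\<Sum>a<CARD('n). s i a) * (\<Sum>a<CARD('n). s j a) + (\<Sum>a<CARD('n). s i a * s j a)"
    if "i < r" "j < r" "i \<noteq> j" for i j
  proof -
    have "mdet (smat (w i) - g) \<noteq> 0" "mdet (smat (w j) - g) \<noteq> 0"
      using that by (auto intro!: mdet_smat_minus_nonzero[OF g] w)
    moreover have "w i \<noteq> w j" using inj that by (auto dest: inj_onD)
    ultimately show ?thesis by (simp add: trace_gres trace_gres_mult s_def pole_ratio_def)
  qed
  then show ?thesis by (simp add: casimir_defect_def Let_def s_def)
qed

lemma char_prod_smat_mult:
  fixes g :: "complex^'n^'n"
  assumes g: "g \<in> unitary_group" and w: "\<And>i. i < r \<Longrightarrow> norm (w i) \<noteq> 1" and z: "norm z = 1"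
  shows "char_prod m r w g * (\<Prod>i<r. \<Prod>a<CARD('n). 1 - (z - 1) * pole_ratio w (eigs g) i a) =
    z ^ (m * CARD('n)) * char_prod m r w (smat z ** g)"
proof -
  let ?N = "CARD('n)" and ?q = "pole_ratio w (eigs g)"
  have factor: "(w i - eigs g a) * (1 - (z - 1) * ?q i a) = w i - z * eigs g a"
    if "i < r" "a < ?N" for i a
  proof -
    have "w i - eigs g a \<noteq> 0" using norm_eigs[OF g that(2)] w[OF that(1)] by auto
    then show ?thesis by (simp add: pole_ratio_def field_simps)
  qed
  have "(\<Prod>i<r. mdet (smat (w i) - g)) * (\<Prod>i<r. \<Prod>a<?N. 1 - (z - 1) * ?q i a) =
      (\<Prod>i<r. \<Prod>a<?N. (w i - eigs g a) * (1 - (z - 1) * ?q i a))"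
    unfolding mdet_smat_minus prod.distrib ..
  also have "\<dots> = (\<Prod>i<r. mdet (smat (w i) - smat z ** g))"
    unfolding mdet_smat_minus_smat_mult by (intro prod.cong refl factor) auto
  finally have "(\<Prod>i<r. mdet (smat (w i) - g)) * (\<Prod>i<r. \<Prod>a<?N. 1 - (z - 1) * ?q i a) =
      (\<Prod>i<r. mdet (smat (w i) - smat z ** g))" .
  moreover have "inverse (mdet g) ^ m = z ^ (m * ?N) * inverse (mdet (smat z ** g)) ^ m"
  proof -
    have "z \<noteq> 0" using z by auto
    then show ?thesis
      by (simp add: mdet_smat_mult power_mult_distrib power_inverse power_mult[symmetric] mult.commute[of m])
  qed
  ultimately show ?thesis by (simp add: char_prod_def mult_ac)
qed

lemma char_prod_reflection_mult:
  fixes v :: "complex^'n"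
  assumes v: "v \<noteq> 0" and g: "g \<in> unitary_group" and w: "\<And>i. i < r \<Longrightarrow> norm (w i) \<noteq> 1"
    and z: "norm z = 1"
  shows "char_prod m r w g * (\<Prod>i<r. 1 - (z - 1) * (hform v (gres (w i) g) / (of_real (norm v))\<^sup>2)) =
    z ^ m * char_prod m r w (reflection v z ** g)"
proof -
  have "(\<Prod>i<r. mdet (smat (w i) - reflection v z ** g)) =
      (\<Prod>i<r. mdet (smat (w i) - g)) * (\<Prod>i<r. 1 - (z - 1) * (hform v (gres (w i) g) / (of_real (norm v))\<^sup>2))"
    unfolding prod.distrib[symmetric]
    by (intro prod.cong refl mdet_smat_minus_reflection_mult mdet_smat_minus_nonzero g w) simp
  moreover have "z ^ m * inverse (mdet (reflection v z ** g)) ^ m = inverse (mdet g) ^ m"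
  proof -
    have "z \<noteq> 0" using z by auto
    then show ?thesis
      by (simp add: det_mul mdet_reflection[OF v] power_mult_distrib field_simps)
  qed
  ultimately show ?thesis by (simp add: char_prod_def mult_ac)
qed

lemma continuous_on_char_prod: "continuous_on unitary_group (char_prod m r w :: complex^'n^'n \<Rightarrow> complex)"
  unfolding char_prod_def[abs_def]
  by (intro continuous_intros continuous_on_mdet) (auto simp: mdet_unitary_nonzero intro!: continuous_intros)

context haar_unitary
begin

lemma char_prod_eigs_moments:
  fixes m :: nat
  assumes w: "\<And>i. i < r \<Longrightarrow> norm (w i) \<noteq> 1"
  defines "s \<equiv> \<lambda>g. pole_ratio w (eigs (g :: complex^'n^'n))"
  shows "integrable \<mu> (\<lambda>g. char_prod m r w g * (\<Sum>i<r. \<Sum>a<CARD('n). s g i a))"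
    and "(LINT g|\<mu>. char_prod m r w g * (\<Sum>i<r. \<Sum>a<CARD('n). s g i a)) =
      - of_nat (m * CARD('n)) * (LINT g|\<mu>. char_prod m r w g)"
    and "integrable \<mu> (\<lambda>g. char_prod m r w g *
      ((\<Sum>i<r. \<Sum>a<CARD('n). s g i a)\<^sup>2 - (\<Sum>i<r. \<Sum>a<CARD('n). (s g i a)\<^sup>2)))"
    and "(LINT g|\<mu>. char_prod m r w g *
      ((\<Sum>i<r. \<Sum>a<CARD('n). s g i a)\<^sup>2 - (\<Sum>i<r. \<Sum>a<CARD('n). (s g i a)\<^sup>2))) =
      of_nat (m * CARD('n)) * (of_nat (m * CARD('n)) - 1) * (LINT g|\<mu>. char_prod m r w g)"
proof -
  let ?N = "CARD('n)" and ?T = "{..<r} \<times> {..<CARD('n)}"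
  let ?q = "\<lambda>g (i, a). s g i a"
  have orbit: "\<exists>h\<in>unitary_group. \<forall>g\<in>unitary_group.
      char_prod m r w g * (\<Prod>t\<in>?T. 1 - (z - 1) * ?q g t) = z ^ (m * ?N) * char_prod m r w (h ** g)"
    if z: "norm z = 1" for z
    using char_prod_smat_mult[OF _ w z]
    by (intro bexI[of _ "smat z"] ballI unitary_smat z) (simp add: s_def prod.cartesian_product split_def)
  have sums: "(\<Sum>i<r. \<Sum>a<?N. s g i a) = (\<Sum>t\<in>?T. ?q g t)"
    "(\<Sum>i<r. \<Sum>a<?N. (s g i a)\<^sup>2) = (\<Sum>t\<in>?T. (?q g t)\<^sup>2)" for g
    by (simp_all add: sum.cartesian_product split_def)
  show "integrable \<mu> (\<lambda>g. char_prod m r w g * (\<Sum>i<r. \<Sum>a<?N. s g i a))"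
    "(LINT g|\<mu>. char_prod m r w g * (\<Sum>i<r. \<Sum>a<?N. s g i a)) =
      - of_nat (m * ?N) * (LINT g|\<mu>. char_prod m r w g)"
    "integrable \<mu> (\<lambda>g. char_prod m r w g *
      ((\<Sum>i<r. \<Sum>a<?N. s g i a)\<^sup>2 - (\<Sum>i<r. \<Sum>a<?N. (s g i a)\<^sup>2)))"
    "(LINT g|\<mu>. char_prod m r w g *
      ((\<Sum>i<r. \<Sum>a<?N. s g i a)\<^sup>2 - (\<Sum>i<r. \<Sum>a<?N. (s g i a)\<^sup>2))) =
      of_nat (m * ?N) * (of_nat (m * ?N) - 1) * (LINT g|\<mu>. char_prod m r w g)"
    unfolding sums by (rule orbit_product_moments[OF continuous_on_char_prod _ orbit]; simp)+
qed

lemma char_prod_hform_moments: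
  fixes v :: "complex^'n"
  assumes w: "\<And>i. i < r \<Longrightarrow> norm (w i) \<noteq> 1"
  defines "H \<equiv> \<lambda>g i. hform v (gres (w i) g)"
  shows "integrable \<mu> (\<lambda>g. char_prod m r w g * (\<Sum>i<r. \<Sum>j\<in>{..<r} - {i}. H g i * H g j))" (is ?integrable)
    and "(LINT g|\<mu>. char_prod m r w g * (\<Sum>i<r. \<Sum>j\<in>{..<r} - {i}. H g i * H g j)) =
      of_nat m * (of_nat m - 1) * (hform v (smat 1))\<^sup>2 * (LINT g|\<mu>. char_prod m r w g)" (is ?moment)
proof -
  have "?integrable \<and> ?moment"
  proof (cases "v = 0")
    case True
    then have "H g i = 0" "hform v (smat 1) = 0" for g i by (simp_all add: H_def hform_def)
    then show ?thesis by simp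
  next
    case False
    let ?\<nu> = "(of_real (norm v))\<^sup>2 :: complex"
    let ?q = "\<lambda>g i. H g i / ?\<nu>"
    have "?\<nu> \<noteq> 0" using False by simp
    have orbit: "\<exists>h\<in>unitary_group. \<forall>g\<in>unitary_group.
        char_prod m r w g * (\<Prod>i<r. 1 - (z - 1) * ?q g i) = z ^ m * char_prod m r w (h ** g)"
      if z: "norm z = 1" for z
      unfolding H_def using char_prod_reflection_mult[OF False _ w z]
      by (intro bexI[of _ "reflection v z"] ballI unitary_reflection False z)
    have off_diagonal: "(\<Sum>i<r. \<Sum>j\<in>{..<r} - {i}. H g i * H g j) =
        ?\<nu>\<^sup>2 * ((\<Sum>i<r. ?q g i)\<^sup>2 - (\<Sum>i<r. (?q g i)\<^sup>2))" for g
    proof -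
      have "(\<Sum>i<r. \<Sum>j\<in>{..<r} - {i}. H g i * H g j) = (\<Sum>i<r. H g i)\<^sup>2 - (\<Sum>i<r. (H g i)\<^sup>2)"
        by (simp add: sum_off_diagonal sum_product power2_eq_square)
      then show ?thesis
        using \<open>?\<nu> \<noteq> 0\<close> by (simp add: right_diff_distrib power_divide flip: sum_divide_distrib)
    qed
    show ?thesis
      unfolding off_diagonal mult.left_commute[of _ "?\<nu>\<^sup>2"] hform_identity
      using orbit_product_moments(3,4)[OF continuous_on_char_prod finite_lessThan orbit] by simp
  qed
  then show ?integrable ?moment by auto
qed

lemma char_prod_trace_moments:
  assumes w: "\<And>i. i < r \<Longrightarrow> norm (w i) \<noteq> 1"
  defines "tr \<equiv> \<lambda>g i j. trace (gres (w i) g) * trace (gres (w j) g) +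
    trace (gres (w i) g ** gres (w j) (g :: complex^'n^'n))"
  shows "integrable \<mu> (\<lambda>g. char_prod m r w g * (\<Sum>i<r. \<Sum>j\<in>{..<r} - {i}. tr g i j))"
    and "(LINT g|\<mu>. char_prod m r w g * (\<Sum>i<r. \<Sum>j\<in>{..<r} - {i}. tr g i j)) =
      of_nat m * (of_nat m - 1) * of_nat CARD('n) * (of_nat CARD('n) + 1) * (LINT g|\<mu>. char_prod m r w g)"
proof -
  obtain T :: "('n \<times> 'n \<times> complex) set" and c v where T: "finite T" and polarization:
    "\<And>A B :: complex^'n^'n. trace A * trace B + trace (A ** B) = (\<Sum>t\<in>T. c t * (hform (v t) A * hform (v t) B))"
    by (rule trace_polarization) (rule that)
  define Q where "Q = (\<lambda>t g. char_prod m r w g *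
      (\<Sum>i<r. \<Sum>j\<in>{..<r} - {i}. hform (v t) (gres (w i) g) * hform (v t) (gres (w j) g)))"
  have Q: "char_prod m r w g * (\<Sum>i<r. \<Sum>j\<in>{..<r} - {i}. tr g i j) = (\<Sum>t\<in>T. c t * Q t g)" for g
    unfolding tr_def polarization Q_def
    by (simp add: sum_distrib_left sum.swap[of _ T] mult.left_commute)
  have moments: "integrable \<mu> (Q t)" "(LINT g|\<mu>. Q t g) =
      of_nat m * (of_nat m - 1) * (hform (v t) (smat 1))\<^sup>2 * (LINT g|\<mu>. char_prod m r w g)" for t
    unfolding Q_def by (rule char_prod_hform_moments, rule w, assumption)+
  show "integrable \<mu> (\<lambda>g. char_prod m r w g * (\<Sum>i<r. \<Sum>j\<in>{..<r} - {i}. tr g i j))"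
    unfolding Q by (simp add: moments)
  have "(LINT g|\<mu>. (\<Sum>t\<in>T. c t * Q t g)) =
      of_nat m * (of_nat m - 1) * (\<Sum>t\<in>T. c t * (hform (v t) (smat 1))\<^sup>2) * (LINT g|\<mu>. char_prod m r w g)"
    by (simp add: moments sum_distrib_left sum_distrib_right mult_ac)
  also have "(\<Sum>t\<in>T. c t * (hform (v t) (smat 1))\<^sup>2) = of_nat CARD('n) * (of_nat CARD('n) + 1)"
    unfolding power2_eq_square polarization[symmetric] by (simp add: trace_I algebra_simps)
  finally show "(LINT g|\<mu>. char_prod m r w g * (\<Sum>i<r. \<Sum>j\<in>{..<r} - {i}. tr g i j)) =
      of_nat m * (of_nat m - 1) * of_nat CARD('n) * (of_nat CARD('n) + 1) * (LINT g|\<mu>. char_prod m r w g)"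
    unfolding Q by (simp only: mult_ac)
qed

lemma casimir_defect_moment:
  fixes m :: nat
  assumes w: "\<And>i. i < r \<Longrightarrow> norm (w i) \<noteq> 1" and inj: "inj_on w {..<r}"
  shows "integrable \<mu> (\<lambda>g. char_prod m r w g * casimir_defect CARD('n) m r w (eigs g))"
    and "(LINT g|\<mu>. char_prod m r w g * casimir_defect CARD('n) m r w (eigs g)) = 0"
proof -
  let ?N = "CARD('n)"
  define F :: "complex^'n^'n \<Rightarrow> complex" where "F = char_prod m r w"
  define s where "s = (\<lambda>g :: complex^'n^'n. pole_ratio w (eigs g))"
  define S where "S = (\<lambda>g. \<Sum>i<r. \<Sum>a<?N. s g i a)"
  define Q where "Q = (\<lambda>g. (\<Sum>i<r. \<Sum>a<?N. s g i a)\<^sup>2 - (\<Sum>i<r. \<Sum>a<?N. (s g i a)\<^sup>2))"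
  define R where "R = (\<lambda>g :: complex^'n^'n. \<Sum>i<r. \<Sum>j\<in>{..<r} - {i}.
    trace (gres (w i) g) * trace (gres (w j) g) + trace (gres (w i) g ** gres (w j) g))"
  let ?split = "\<lambda>g. F g * Q g - F g * R g + (of_nat ?N - 2 * of_nat m) * (F g * S g) - of_nat (m\<^sup>2 * ?N) * F g"
  have integrable: "integrable \<mu> F" "integrable \<mu> (\<lambda>g. F g * S g)" "integrable \<mu> (\<lambda>g. F g * Q g)"
      "integrable \<mu> (\<lambda>g. F g * R g)"
    unfolding F_def S_def Q_def R_def s_def
    by (rule integrable_continuous_on_unitary_group continuous_on_char_prod
        char_prod_eigs_moments char_prod_trace_moments | rule w, assumption)+
  have moments: "(LINT g|\<mu>. F g * S g) = - of_nat (m * ?N) * (LINT g|\<mu>. F g)"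
    "(LINT g|\<mu>. F g * Q g) = of_nat (m * ?N) * (of_nat (m * ?N) - 1) * (LINT g|\<mu>. F g)"
    "(LINT g|\<mu>. F g * R g) = of_nat m * (of_nat m - 1) * of_nat ?N * (of_nat ?N + 1) * (LINT g|\<mu>. F g)"
    unfolding F_def S_def Q_def R_def s_def
    by (rule char_prod_eigs_moments char_prod_trace_moments | rule w, assumption)+
  have split: "char_prod m r w g * casimir_defect ?N m r w (eigs g) = ?split g" if "g \<in> unitary_group" for g
  proof -
    have defect: "casimir_defect ?N m r w (eigs g) =
        Q g - R g + (of_nat ?N - 2 * of_nat m) * S g - of_nat (m\<^sup>2 * ?N)"
      unfolding S_def Q_def R_def s_def by (rule casimir_defect_eigs[OF that w inj])
    show ?thesis unfolding defect F_def by (simp add: algebra_simps)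
  qed
  show "integrable \<mu> (\<lambda>g. char_prod m r w g * casimir_defect ?N m r w (eigs g))"
    by (rule integral_haar_cong(1)[THEN iffD2, OF split]) (use integrable in auto)
  have "(LINT g|\<mu>. char_prod m r w g * casimir_defect ?N m r w (eigs g)) = (LINT g|\<mu>. ?split g)"
    by (rule integral_haar_cong(2)[OF split])
  also have "\<dots> = (of_nat (m * ?N) * (of_nat (m * ?N) - 1) - of_nat m * (of_nat m - 1) * of_nat ?N * (of_nat ?N + 1) -
      (of_nat ?N - 2 * of_nat m) * of_nat (m * ?N) - of_nat (m\<^sup>2 * ?N)) * (LINT g|\<mu>. F g)"
    using integrable by (simp add: moments) (simp add: algebra_simps)
  also have "of_nat (m * ?N) * (of_nat (m * ?N) - 1) - of_nat m * (of_nat m - 1) * of_nat ?N * (of_nat ?N + 1) -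
      (of_nat ?N - 2 * of_nat m) * of_nat (m * ?N) - of_nat (m\<^sup>2 * ?N) = (0 :: complex)"
    by (simp add: power2_eq_square algebra_simps)
  finally show "(LINT g|\<mu>. char_prod m r w g * casimir_defect ?N m r w (eigs g)) = 0" by simp
qed

end

subsection \<open>Haar integrals of Schur functions\<close>

lemma staircase_image: "staircase n ` {..<n} = {0..<int n}"
proof (intro equalityI subsetI)
  fix x assume "x \<in> {0..<int n}"
  then show "x \<in> staircase n ` {..<n}"
    by (intro image_eqI[of _ _ "n - 1 - nat x"]) (auto simp: staircase_def)
qed (auto simp: staircase_def)

lemma inj_staircase: "inj_on (staircase n) {..<n}"
  by (auto simp: inj_on_def staircase_def)

text \<open>\<open>energy n\<close> is nonpositive on \<open>{0..<n}\<close> and positive at all other integers, so \<open>{0..<n}\<close> is the only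
  set of \<open>n\<close> integers with its total energy.\<close>

lemma energy_determines_interval:
  fixes e :: "nat \<Rightarrow> int"
  assumes inj: "inj_on e {..<n}" and energy: "(\<Sum>k<n. energy n (e k)) = (\<Sum>k<n. energy n (int k))"
  shows "e ` {..<n} = {0..<int n}"
proof -
  let ?E = "e ` {..<n}" and ?I = "{0..<int n}"
  have "?I = int ` {..<n}" by (simp add: image_int_atLeastLessThan lessThan_atLeast0)
  then have "(\<Sum>x\<in>?E. energy n x) = (\<Sum>x\<in>?I. energy n x)"
    using energy by (simp add: sum.reindex[OF inj] sum.reindex)
  then have "(\<Sum>x\<in>?E - ?I. energy n x) = (\<Sum>x\<in>?I - ?E. energy n x)"
    using sum.Int_Diff[of ?E "energy n" ?I] sum.Int_Diff[of ?I "energy n" ?E] by (simp add: Int_commute)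
  also have "\<dots> \<le> 0"
    by (rule sum_nonpos) (auto simp: energy_def mult_le_0_iff)
  finally have "(\<Sum>x\<in>?E - ?I. energy n x) \<le> 0" .
  moreover have "energy n x > 0" if "x \<in> ?E - ?I" for x
    using that by (auto simp: energy_def zero_less_mult_iff)
  ultimately have "?E - ?I = {}"
    using sum_pos[of "?E - ?I" "energy n"] by fastforce
  then show ?thesis
    by (intro card_subset_eq) (auto simp: card_image[OF inj])
qed

lemma interval_eq_staircase_permutation:
  assumes "inj_on e {..<n}" "e ` {..<n} = {0..<int n}"
  obtains p where "p permutes {..<n}" "\<And>k. k < n \<Longrightarrow> e k = staircase n (p k)"
proof -
  have "image_mset e (mset_set {..<n}) = image_mset (staircase n) (mset_set {..<n})"
    by (simp add: image_mset_mset_set assms inj_staircase staircase_image)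
  then obtain p where "p permutes {..<n}" "\<forall>k\<in>{..<n}. e k = staircase n (p k)"
    by (rule image_mset_eq_implies_permutes[OF finite_lessThan])
  then show ?thesis by (intro that) auto
qed

lemma staircase_not_covered:
  assumes "\<not> (inj_on e {..<n} \<and> e ` {..<n} = {0..<int n})"
  obtains j where "j < n" "staircase n j \<notin> e ` {..<n}"
proof (rule ccontr)
  assume "\<not> thesis"
  then have "{0..<int n} \<subseteq> e ` {..<n}" unfolding staircase_image[symmetric] using that by auto
  moreover have "card (e ` {..<n}) \<le> card {0..<int n}"
    using card_image_le[of "{..<n}" e] by simp
  ultimately have "{0..<int n} = e ` {..<n}" by (intro card_seteq) auto
  moreover from this have "inj_on e {..<n}" by (intro eq_card_imp_inj_on) (auto simp flip: \<open>_ = e ` _\<close>)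
  ultimately show False using assms by simp
qed

lemma schur_permuted_staircase:
  assumes p: "p permutes {..<length l}"
    and l: "\<And>k. k < length l \<Longrightarrow> staircase (length l) k + l ! k = staircase (length l) (p k)"
  shows "schur l x = signof p"
proof (rule schur_constant[OF refl])
  fix x
  have "schur_num l x = fdet (length l) (\<lambda>j k. x j powi staircase (length l) (p k))"
    unfolding schur_num_alternant alternant_def by (rule fdet_cong) (simp add: l)
  then show "schur_num l x = schur_den (length l) x * signof p"
    using fdet_permute_cols[OF p, of "\<lambda>j k. x j powi staircase (length l) k"]
    by (simp add: schur_den_alternant alternant_def)
qed

context haar_unitary
begin

lemma schur_eigs_moments:
  assumes l: "length l = CARD('n)"
  shows "integrable \<mu> (\<lambda>g. schur l (eigs g))"
    and "of_int ((\<Sum>k<CARD('n). energy CARD('n) (int k)) -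
        (\<Sum>k<CARD('n). energy CARD('n) (staircase CARD('n) k + l ! k))) *
      (LINT g|\<mu>. schur l (eigs g)) = 0"
proof -
  let ?N = "CARD('n)"
  let ?D = "(\<Sum>k<?N. energy ?N (int k)) - (\<Sum>k<?N. energy ?N (staircase ?N k + l ! k))"
  have "integrable \<mu> (\<lambda>g. schur l (eigs g)) \<and> of_int ?D * (LINT g|\<mu>. schur l (eigs g)) = 0"
  proof (cases "inj_on (\<lambda>k. staircase ?N k + l ! k) {..<?N}")
    case False
    then show ?thesis by (simp add: schur_not_inj l)
  next
    case True
    then obtain p m r where p: "p permutes {..<r + ?N}"
      "\<And>k. k < ?N \<Longrightarrow> int (p (r + k)) = staircase ?N k + l ! k + int m"
      by (rule exponents_extend_to_permutation) (rule that)
    let ?T = "circle_index r ?N" and ?w = "circle_point r ?N"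
    let ?c = "root_factor_coeff r ?N p"
    have w: "norm (?w \<tau> i) \<noteq> 1" for \<tau> i by (simp add: norm_circle_point)
    have schur: "schur l (eigs g) = (\<Sum>\<tau>\<in>?T. ?c \<tau> * char_prod m r (?w \<tau>) g)"
      if "g \<in> unitary_group" for g :: "complex^'n^'n"
      using schur_root_factors[OF l p, of "eigs g"] eigs_nonzero[OF that] by (simp add: char_prod_eigs)
    have casimir: "of_int ?D * schur l (eigs g) =
        (\<Sum>\<tau>\<in>?T. ?c \<tau> * (char_prod m r (?w \<tau>) g * casimir_defect ?N m r (?w \<tau>) (eigs g)))"
      if "g \<in> unitary_group" for g :: "complex^'n^'n"
      using schur_casimir[OF l p, of "eigs g"] eigs_nonzero[OF that] norm_eigs[OF that]
      by (simp add: char_prod_eigs mult.assoc)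
    have "integrable \<mu> (\<lambda>g. schur l (eigs g))"
      by (rule integral_haar_cong(1)[THEN iffD2, OF schur], assumption)
        (intro integrable_continuous_on_unitary_group continuous_intros continuous_on_char_prod)
    moreover have "of_int ?D * (LINT g|\<mu>. schur l (eigs g)) = 0"
    proof -
      have "of_int ?D * (LINT g|\<mu>. schur l (eigs g)) = (LINT g|\<mu>. of_int ?D * schur l (eigs g))"
        by simp
      also have "\<dots> = (LINT g|\<mu>. (\<Sum>\<tau>\<in>?T. ?c \<tau> * (char_prod m r (?w \<tau>) g * casimir_defect ?N m r (?w \<tau>) (eigs g))))"
        by (rule integral_haar_cong(2)[OF casimir])
      also have "\<dots> = 0"
        by (simp add: casimir_defect_moment[OF w inj_circle_point])
      finally show ?thesis .
    qed
    ultimately show ?thesis ..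
  qed
  then show "integrable \<mu> (\<lambda>g. schur l (eigs g))" "of_int ?D * (LINT g|\<mu>. schur l (eigs g)) = 0"
    by auto
qed

lemma schur_eigs_integral_eq_0:
  assumes l: "length l = CARD('n)"
    and not_permuted: "\<not> (inj_on (\<lambda>k. staircase CARD('n) k + l ! k) {..<CARD('n)} \<and>
      (\<lambda>k. staircase CARD('n) k + l ! k) ` {..<CARD('n)} = {0..<int CARD('n)})"
  shows "(LINT g|\<mu>. schur l (eigs g)) = 0"
proof (cases "inj_on (\<lambda>k. staircase CARD('n) k + l ! k) {..<CARD('n)}")
  case True
  then have "(\<Sum>k<CARD('n). energy CARD('n) (int k)) \<noteq>
      (\<Sum>k<CARD('n). energy CARD('n) (staircase CARD('n) k + l ! k))"
    using not_permuted energy_determines_interval[OF True] by auto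
  then show ?thesis
    using schur_eigs_moments(2)[OF l] unfolding mult_eq_0_iff of_int_eq_0_iff by simp
qed (simp add: schur_not_inj l)

lemma schur_eigs_integral:
  assumes l: "length l = CARD('n)"
  shows "(LINT g|\<mu>. schur l (eigs g)) =
    fdet CARD('n) (\<lambda>j k. of_bool (staircase CARD('n) j = staircase CARD('n) k + l ! k))"
proof -
  let ?N = "CARD('n)" and ?\<rho> = "staircase CARD('n)"
  define e where "e = (\<lambda>k. ?\<rho> k + l ! k)"
  have "(LINT g|\<mu>. schur l (eigs g)) = fdet ?N (\<lambda>j k. of_bool (?\<rho> j = e k))"
  proof (cases "inj_on e {..<?N} \<and> e ` {..<?N} = {0..<int ?N}")
    case True
    then obtain p where p: "p permutes {..<?N}" "\<And>k. k < ?N \<Longrightarrow> e k = ?\<rho> (p k)"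
      using interval_eq_staircase_permutation[of e ?N] by blast
    then have "schur l x = signof p" for x
      by (intro schur_permuted_staircase) (simp_all add: l e_def)
    then have "(LINT g|\<mu>. schur l (eigs g)) = signof p" by (simp only: haar_integral_const)
    also have "\<dots> = signof p * fdet ?N (\<lambda>j k. of_bool (j = k))"
      by (simp add: fdet_identity)
    also have "\<dots> = fdet ?N (\<lambda>j k. of_bool (j = p k))"
      by (rule fdet_permute_cols[OF p(1), symmetric])
    also have "\<dots> = fdet ?N (\<lambda>j k. of_bool (?\<rho> j = e k))"
      by (rule fdet_cong)
        (use permutes_less[OF p(1)] in \<open>auto simp: p(2) dest: inj_onD[OF inj_staircase]\<close>)
    finally show ?thesis .
  next
    case False
    then obtain j where "j < ?N" "?\<rho> j \<notin> e ` {..<?N}" by (rule staircase_not_covered)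
    then have "fdet ?N (\<lambda>j k. of_bool (?\<rho> j = e k)) = (0 :: complex)"
      by (intro fdet_zero_row[of j]) auto
    moreover have "(LINT g|\<mu>. schur l (eigs g)) = 0"
      using False by (intro schur_eigs_integral_eq_0 l) (simp add: e_def)
    ultimately show ?thesis by simp
  qed
  then show ?thesis by (simp add: e_def)
qed

end

subsection \<open>The Cauchy--Binet formula\<close>

definition strict_lists :: "nat \<Rightarrow> 'a::linorder set \<Rightarrow> 'a list set" where
  "strict_lists n W = {s. length s = n \<and> sorted_wrt (>) s \<and> set s \<subseteq> W}"

lemma finite_strict_lists: "finite W \<Longrightarrow> finite (strict_lists n W)"
  unfolding strict_lists_def
  by (rule finite_subset[OF _ finite_lists_length_eq[of W n]]) auto

lemma strict_list_distinct: "sorted_wrt (>) s \<Longrightarrow> distinct s" for s :: "'a::linorder list"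
  by (induction s) auto

lemma strict_list_eqI:
  fixes s s' :: "'a::linorder list"
  assumes "sorted_wrt (>) s" "sorted_wrt (>) s'" "set s = set s'"
  shows "s = s'"
proof -
  have "rev s = rev s'"
    using assms by (intro strict_sorted_equal) (simp_all add: sorted_wrt_rev)
  then show ?thesis by simp
qed

lemma strict_lists_nth_eq_iff:
  assumes "s \<in> strict_lists n W" "i < n" "k < n"
  shows "s ! i = s ! k \<longleftrightarrow> i = k"
  using assms strict_list_distinct[of s] by (simp add: strict_lists_def nth_eq_iff_index_eq)

lemma strict_lists_image_permuted:
  assumes s: "s \<in> strict_lists n W" and p: "p permutes {..<n}"
  shows "(\<lambda>k. s ! p k) ` {..<n} = set s"
proof -
  have "(\<lambda>k. s ! p k) ` {..<n} = (!) s ` (p ` {..<n})" by (simp add: image_image)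
  then show ?thesis
    using s by (auto simp: permutes_image[OF p] strict_lists_def set_conv_nth)
qed

lemma inj_eq_permuted_strict_list:
  fixes W :: "'a::linorder set"
  assumes \<phi>: "\<phi> \<in> PiE {..<n} (\<lambda>_. W)" "inj_on \<phi> {..<n}"
  obtains s p where "s \<in> strict_lists n W" "p permutes {..<n}" "\<phi> = restrict (\<lambda>k. s ! p k) {..<n}"
proof -
  define s where "s = rev (sorted_list_of_set (\<phi> ` {..<n}))"
  have "length s = n" using \<phi> by (simp add: s_def card_image)
  then have s: "s \<in> strict_lists n W" using \<phi> by (auto simp: strict_lists_def s_def sorted_wrt_rev)
  have "mset s = mset_set (\<phi> ` {..<n})"
    unfolding s_def mset_rev by (metis mset_sorted_list_of_multiset sorted_list_of_mset_set)
  then have "image_mset \<phi> (mset_set {..<n}) = mset s"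
    using \<phi> by (simp add: image_mset_mset_set)
  also have "mset s = image_mset ((!) s) (mset_set {..<n})"
    using \<open>length s = n\<close> by (metis atLeast0LessThan map_nth mset_map mset_upt)
  finally obtain p where p: "p permutes {..<n}" "\<forall>k\<in>{..<n}. \<phi> k = s ! p k"
    by (rule image_mset_eq_implies_permutes[OF finite_lessThan])
  have "\<phi> = restrict (\<lambda>k. s ! p k) {..<n}"
    using \<phi> p(2) by (auto simp: fun_eq_iff PiE_def extensional_def)
  with s p(1) show ?thesis by (rule that)
qed

lemma bij_betw_strict_lists_permutations:
  fixes W :: "'a::linorder set"
  shows "bij_betw (\<lambda>(s, p). restrict (\<lambda>k. s ! p k) {..<n})
     (strict_lists n W \<times> {p. p permutes {..<n}})
     {\<phi> \<in> PiE {..<n} (\<lambda>_. W). inj_on \<phi> {..<n}}" (is "bij_betw ?\<Phi> ?D ?R")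
proof (rule bij_betw_imageI)
  show "inj_on ?\<Phi> ?D"
  proof (rule inj_onI, clarsimp)
    fix s p s' p'
    assume s: "s \<in> strict_lists n W" "s' \<in> strict_lists n W"
      and p: "p permutes {..<n}" "p' permutes {..<n}"
      and eq: "restrict (\<lambda>k. s ! p k) {..<n} = restrict (\<lambda>k. s' ! p' k) {..<n}"
    have nth_eq: "s ! p k = s' ! p' k" if "k < n" for k
      using fun_cong[OF eq, of k] that by simp
    then have "set s = set s'"
      unfolding strict_lists_image_permuted[OF s(1) p(1), symmetric]
        strict_lists_image_permuted[OF s(2) p(2), symmetric] by (intro image_cong) auto
    then have "s = s'" using s by (intro strict_list_eqI) (auto simp: strict_lists_def)
    moreover from this have "p k = p' k" for k
      using nth_eq strict_lists_nth_eq_iff[OF s(1) permutes_less[OF p(1)] permutes_less[OF p(2)]]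
        permutes_not_in[OF p(1), of k] permutes_not_in[OF p(2), of k]
      by (cases "k < n") auto
    ultimately show "s = s' \<and> p = p'" by auto
  qed
  show "?\<Phi> ` ?D = ?R"
  proof (intro equalityI subsetI)
    fix \<phi> assume "\<phi> \<in> ?\<Phi> ` ?D"
    then obtain s p where \<phi>: "\<phi> = restrict (\<lambda>k. s ! p k) {..<n}"
      and s: "s \<in> strict_lists n W" and p: "p permutes {..<n}" by auto
    have "\<phi> \<in> PiE {..<n} (\<lambda>_. W)"
      using s strict_lists_image_permuted[OF s p] by (auto simp: \<phi> strict_lists_def)
    moreover have "inj_on \<phi> {..<n}"
      by (rule inj_onI)
        (auto simp: \<phi> strict_lists_nth_eq_iff[OF s permutes_less[OF p] permutes_less[OF p]]
          dest: injD[OF permutes_inj[OF p]])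
    ultimately show "\<phi> \<in> ?R" by simp
  next
    fix \<phi> assume "\<phi> \<in> ?R"
    then show "\<phi> \<in> ?\<Phi> ` ?D" by (force elim: inj_eq_permuted_strict_list)
  qed
qed

lemma sum_inj_functions:
  fixes h :: "(nat \<Rightarrow> 't::linorder) \<Rightarrow> 'a::comm_monoid_add"
  assumes W: "finite W" and not_inj: "\<And>\<phi>. \<phi> \<in> PiE {..<n} (\<lambda>_. W) \<Longrightarrow> \<not> inj_on \<phi> {..<n} \<Longrightarrow> h \<phi> = 0"
  shows "(\<Sum>\<phi>\<in>PiE {..<n} (\<lambda>_. W). h \<phi>) =
    (\<Sum>s\<in>strict_lists n W. \<Sum>p | p permutes {..<n}. h (restrict (\<lambda>k. s ! p k) {..<n}))"
proof -
  let ?P = "PiE {..<n} (\<lambda>_. W)"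
  have "(\<Sum>\<phi>\<in>?P. h \<phi>) = (\<Sum>\<phi>\<in>{\<phi> \<in> ?P. inj_on \<phi> {..<n}}. h \<phi>)"
    using W not_inj by (intro sum.mono_neutral_right finite_PiE) auto
  also have "\<dots> = (\<Sum>x\<in>strict_lists n W \<times> {p. p permutes {..<n}}.
      h ((\<lambda>(s, p). restrict (\<lambda>k. s ! p k) {..<n}) x))"
    by (rule sum.reindex_bij_betw[OF bij_betw_strict_lists_permutations, symmetric])
  also have "\<dots> = (\<Sum>s\<in>strict_lists n W. \<Sum>p | p permutes {..<n}. h (restrict (\<lambda>k. s ! p k) {..<n}))"
    by (simp add: sum.cartesian_product split_def)
  finally show ?thesis .
qed

lemma cauchy_binet:
  fixes A :: "nat \<Rightarrow> 't::linorder \<Rightarrow> 'a::comm_ring_1" and B :: "'t \<Rightarrow> nat \<Rightarrow> 'a"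
  assumes W: "finite W"
  shows "fdet n (\<lambda>j k. \<Sum>t\<in>W. A j t * B t k) =
    (\<Sum>s\<in>strict_lists n W. fdet n (\<lambda>j k. A j (s ! k)) * fdet n (\<lambda>j k. B (s ! j) k))"
proof -
  define h where "h = (\<lambda>\<phi>. (\<Prod>k<n. B (\<phi> k) k) * fdet n (\<lambda>j k. A j (\<phi> k)))"
  have h_not_inj: "h \<phi> = 0" if "\<not> inj_on \<phi> {..<n}" for \<phi>
  proof -
    from that obtain i k where "i < n" "k < n" "i \<noteq> k" "\<phi> i = \<phi> k" by (auto simp: inj_on_def)
    then have "fdet n (\<lambda>j k. A j (\<phi> k)) = 0" by (intro fdet_identical_cols[of i n k]) auto
    then show ?thesis by (simp add: h_def)
  qed
  have h_permuted: "h (restrict (\<lambda>k. s ! p k) {..<n}) =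
      fdet n (\<lambda>j k. A j (s ! k)) * (signof p * (\<Prod>k<n. B (s ! p k) k))" if "p permutes {..<n}" for s p
  proof -
    have "fdet n (\<lambda>j k. A j (restrict (\<lambda>k. s ! p k) {..<n} k)) = fdet n (\<lambda>j k. A j (s ! p k))"
      by (rule fdet_cong) simp
    then show ?thesis
      using fdet_permute_cols[OF that, of "\<lambda>j k. A j (s ! k)"] by (simp add: h_def mult_ac)
  qed
  have "fdet n (\<lambda>j k. \<Sum>t\<in>W. A j t * B t k) = fdet n (\<lambda>j k. \<Sum>t\<in>W. B t k * A j t)"
    by (simp only: mult.commute)
  also have "\<dots> = (\<Sum>\<phi>\<in>PiE {..<n} (\<lambda>_. W). fdet n (\<lambda>j k. B (\<phi> k) k * A j (\<phi> k)))"
    using W by (intro fdet_sum_cols)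
  also have "\<dots> = (\<Sum>\<phi>\<in>PiE {..<n} (\<lambda>_. W). h \<phi>)" unfolding h_def by (simp only: fdet_scale_cols)
  also have "\<dots> = (\<Sum>s\<in>strict_lists n W. \<Sum>p | p permutes {..<n}. h (restrict (\<lambda>k. s ! p k) {..<n}))"
    by (rule sum_inj_functions[OF W h_not_inj])
  also have "\<dots> = (\<Sum>s\<in>strict_lists n W. fdet n (\<lambda>j k. A j (s ! k)) * fdet n (\<lambda>j k. B (s ! j) k))"
  proof (rule sum.cong[OF refl])
    fix s
    show "(\<Sum>p | p permutes {..<n}. h (restrict (\<lambda>k. s ! p k) {..<n})) =
        fdet n (\<lambda>j k. A j (s ! k)) * fdet n (\<lambda>j k. B (s ! j) k)"
      unfolding fdet_transpose[of n "\<lambda>j k. B (s ! j) k", symmetric] fdet_leibniz[of n "\<lambda>j k. B (s ! k) j"]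
        sum_distrib_left by (rule sum.cong[OF refl]) (simp add: h_permuted)
  qed
  finally show ?thesis .
qed

definition shifted_weight :: "nat \<Rightarrow> int list \<Rightarrow> int list" where
  "shifted_weight n l = map (\<lambda>k. staircase n k + l ! k) [0..<n]"

lemma shifted_weight_nth [simp]: "k < n \<Longrightarrow> shifted_weight n l ! k = staircase n k + l ! k"
  by (simp add: shifted_weight_def)

lemma bij_betw_shifted_weight:
  "bij_betw (shifted_weight n) {l \<in> dominant_weights n. set (shifted_weight n l) \<subseteq> W} (strict_lists n W)"
    (is "bij_betw _ ?D _")
proof (rule bij_betw_byWitness)
  let ?unshift = "\<lambda>s. map (\<lambda>k. s ! k - staircase n k) [0..<n]"
  have staircase_step: "staircase n k = staircase n (Suc k) + 1" if "Suc k < n" for k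
    using that by (simp add: staircase_def)
  have transp: "transp ((\<ge>) :: int \<Rightarrow> _)" "transp ((>) :: int \<Rightarrow> _)" by (auto simp: transp_def)
  show "\<forall>l\<in>?D. ?unshift (shifted_weight n l) = l"
    by (auto simp: dominant_weights_def intro!: nth_equalityI)
  show unshift: "\<forall>s\<in>strict_lists n W. shifted_weight n (?unshift s) = s"
    by (auto simp: shifted_weight_def strict_lists_def intro!: nth_equalityI)
  have "sorted_wrt (>) (shifted_weight n l)" if "l \<in> dominant_weights n" for l
    unfolding sorted_wrt_iff_nth_Suc_transp[OF transp(2)]
  proof (intro allI impI)
    fix i assume "Suc i < length (shifted_weight n l)"
    then have i: "Suc i < n" by (simp add: shifted_weight_def)
    then have "l ! i \<ge> l ! Suc i"
      using that sorted_wrt_nth_less[of "(\<ge>)" l i "Suc i"] by (simp add: dominant_weights_def)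
    then show "shifted_weight n l ! i > shifted_weight n l ! Suc i" using i staircase_step[OF i] by simp
  qed
  then show "shifted_weight n ` ?D \<subseteq> strict_lists n W"
    by (auto simp: strict_lists_def shifted_weight_def)
  have "sorted_wrt (\<ge>) (?unshift s)" if "s \<in> strict_lists n W" for s
    unfolding sorted_wrt_iff_nth_Suc_transp[OF transp(1)]
  proof (intro allI impI)
    fix i assume "Suc i < length (?unshift s)"
    then have i: "Suc i < n" by simp
    then have "s ! i > s ! Suc i"
      using that sorted_wrt_nth_less[of "(>)" s i "Suc i"] by (simp add: strict_lists_def)
    then show "?unshift s ! i \<ge> ?unshift s ! Suc i" using i staircase_step[OF i] by simp
  qed
  then show "?unshift ` strict_lists n W \<subseteq> ?D"
    using unshift by (auto simp: dominant_weights_def strict_lists_def)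
qed

lemma cauchy_binet_dominant_weights:
  fixes A :: "nat \<Rightarrow> int \<Rightarrow> 'a::{comm_ring_1, t2_space}" and B :: "int \<Rightarrow> nat \<Rightarrow> 'a"
  assumes W: "finite W" and support: "\<And>j t. j < n \<Longrightarrow> t \<notin> W \<Longrightarrow> A j t = 0"
  defines "f \<equiv> \<lambda>l. fdet n (\<lambda>j k. A j (shifted_weight n l ! k)) * fdet n (\<lambda>j k. B (shifted_weight n l ! j) k)"
  shows "finite {l \<in> dominant_weights n. f l \<noteq> 0}"
    and "(\<Sum>\<^sub>\<infinity>l\<in>dominant_weights n. f l) = fdet n (\<lambda>j k. \<Sum>t\<in>W. A j t * B t k)"
proof -
  define D where "D = {l \<in> dominant_weights n. set (shifted_weight n l) \<subseteq> W}"
  have finite: "finite D"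
    using bij_betw_finite[OF bij_betw_shifted_weight[of n W]] finite_strict_lists[OF W] by (simp add: D_def)
  have zero: "f l = 0" if "l \<in> dominant_weights n - D" for l
  proof -
    from that have "\<exists>k<n. shifted_weight n l ! k \<notin> W"
      by (auto simp: D_def shifted_weight_def)
    then obtain k where "k < n" "shifted_weight n l ! k \<notin> W" by blast
    then have "fdet n (\<lambda>j k. A j (shifted_weight n l ! k)) = 0"
      by (intro fdet_zero_col[of k]) (auto simp: support simp del: shifted_weight_nth)
    then show ?thesis by (simp add: f_def)
  qed
  show "finite {l \<in> dominant_weights n. f l \<noteq> 0}"
    by (rule finite_subset[OF _ finite]) (use zero in blast)
  have "(\<Sum>\<^sub>\<infinity>l\<in>dominant_weights n. f l) = (\<Sum>\<^sub>\<infinity>l\<in>D. f l)"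
    by (rule infsum_cong_neutral) (use zero in \<open>auto simp: D_def\<close>)
  also have "\<dots> = (\<Sum>l\<in>D. f l)" using finite by (rule infsum_finite)
  also have "\<dots> = (\<Sum>s\<in>strict_lists n W. fdet n (\<lambda>j k. A j (s ! k)) * fdet n (\<lambda>j k. B (s ! j) k))"
    unfolding D_def f_def by (rule sum.reindex_bij_betw[OF bij_betw_shifted_weight])
  also have "\<dots> = fdet n (\<lambda>j k. \<Sum>t\<in>W. A j t * B t k)"
    by (rule cauchy_binet[OF W, symmetric])
  finally show "(\<Sum>\<^sub>\<infinity>l\<in>dominant_weights n. f l) = fdet n (\<lambda>j k. \<Sum>t\<in>W. A j t * B t k)" .
qed

subsection \<open>Twisted moments as Toeplitz minors\<close>

definition laurent_poly :: "complex multiset \<Rightarrow> complex multiset \<Rightarrow> complex poly" where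
  "laurent_poly A B = (\<Prod>\<alpha>\<in>#A. [:- \<alpha>, 1:]) * (\<Prod>\<beta>\<in>#B. [:1, - \<beta>:])"

text \<open>The coefficient of \<open>x powi s\<close> in the product of all \<open>1 - \<alpha> / x\<close> and \<open>1 - \<beta> * x\<close>.\<close>

definition laurent_coeff :: "complex multiset \<Rightarrow> complex multiset \<Rightarrow> int \<Rightarrow> complex" where
  "laurent_coeff A B s =
     (if s + int (size A) \<ge> 0 then coeff (laurent_poly A B) (nat (s + int (size A))) else 0)"

lemma degree_laurent_poly: "degree (laurent_poly A B) \<le> size A + size B"
proof -
  have "degree (\<Prod>\<alpha>\<in>#A. [:- \<alpha>, 1:]) \<le> size A"
  proof (induction A)
    case (add a A)
    then show ?case using degree_mult_le[of "[:- a, 1:]" "\<Prod>\<alpha>\<in>#A. [:- \<alpha>, 1:]"] by simp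
  qed simp
  moreover have "degree (\<Prod>\<beta>\<in>#B. [:1, - \<beta>:]) \<le> size B"
  proof (induction B)
    case (add b B)
    have "degree [:1, - b:] \<le> 1" by simp
    with add show ?case using degree_mult_le[of "[:1, - b:]" "\<Prod>\<beta>\<in>#B. [:1, - \<beta>:]"] by (simp del: mult_pCons_left)
  qed simp
  ultimately show ?thesis
    unfolding laurent_poly_def by (intro order_trans[OF degree_mult_le] add_mono)
qed

lemma laurent_coeff_support:
  assumes "s \<notin> {- int (size A)..int (size B)}"
  shows "laurent_coeff A B s = 0"
proof (cases "s + int (size A) \<ge> 0")
  case True
  then have "nat (s + int (size A)) > size A + size B" using assms by auto
  then have "nat (s + int (size A)) > degree (laurent_poly A B)" using degree_laurent_poly[of A B] by simp
  then show ?thesis by (simp add: laurent_coeff_def coeff_eq_0)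
qed (simp add: laurent_coeff_def)

lemma laurent_expansion:
  assumes x: "x \<noteq> 0"
  shows "(\<Prod>\<alpha>\<in>#A. 1 - \<alpha> * inverse x) * (\<Prod>\<beta>\<in>#B. 1 - \<beta> * x) =
    (\<Sum>s\<in>{- int (size A)..int (size B)}. laurent_coeff A B s * x powi s)"
proof -
  have "(\<Prod>\<alpha>\<in>#A. 1 - \<alpha> * inverse x) = inverse x ^ size A * poly (\<Prod>\<alpha>\<in>#A. [:- \<alpha>, 1:]) x"
    by (induction A) (use x in \<open>auto simp: field_simps\<close>)
  moreover have "(\<Prod>\<beta>\<in>#B. 1 - \<beta> * x) = poly (\<Prod>\<beta>\<in>#B. [:1, - \<beta>:]) x"
    by (induction B) (auto simp: algebra_simps)
  ultimately have "(\<Prod>\<alpha>\<in>#A. 1 - \<alpha> * inverse x) * (\<Prod>\<beta>\<in>#B. 1 - \<beta> * x) =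
      inverse x ^ size A * poly (laurent_poly A B) x"
    by (simp add: laurent_poly_def)
  also have "poly (laurent_poly A B) x = (\<Sum>k\<le>size A + size B. coeff (laurent_poly A B) k * x ^ k)"
    unfolding poly_altdef
    by (rule sum.mono_neutral_left) (use degree_laurent_poly[of A B] in \<open>auto simp: coeff_eq_0\<close>)
  also have "inverse x ^ size A * \<dots> =
      (\<Sum>k\<le>size A + size B. coeff (laurent_poly A B) k * x powi (int k - int (size A)))"
    unfolding sum_distrib_left
    by (rule sum.cong) (use x in \<open>auto simp: power_int_diff field_simps\<close>)
  also have "\<dots> = (\<Sum>s\<in>{- int (size A)..int (size B)}. laurent_coeff A B s * x powi s)"
    by (rule sum.reindex_bij_witness[of _ "\<lambda>s. nat (s + int (size A))" "\<lambda>k. int k - int (size A)"])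
      (auto simp: laurent_coeff_def)
  finally show ?thesis .
qed

lemma laurent_coeff_convolution:
  assumes W: "finite W" "\<And>t. laurent_coeff A\<^sub>1 B\<^sub>1 (a - t) \<noteq> 0 \<Longrightarrow> t \<in> W"
  shows "(\<Sum>t\<in>W. laurent_coeff A\<^sub>1 B\<^sub>1 (a - t) * laurent_coeff A\<^sub>2 B\<^sub>2 (t - b)) =
    laurent_coeff (A\<^sub>1 + A\<^sub>2) (B\<^sub>1 + B\<^sub>2) (a - b)"
proof -
  let ?f = "\<lambda>t. laurent_coeff A\<^sub>1 B\<^sub>1 (a - t) * laurent_coeff A\<^sub>2 B\<^sub>2 (t - b)"
  define K where "K = a - b + int (size A\<^sub>1) + int (size A\<^sub>2)"
  define R where "R = {t. 0 \<le> a - t + int (size A\<^sub>1) \<and> 0 \<le> t - b + int (size A\<^sub>2)}"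
  have finR: "finite R"
    by (rule finite_subset[of _ "{b - int (size A\<^sub>2)..a + int (size A\<^sub>1)}"]) (auto simp: R_def)
  have "(\<Sum>t\<in>W. ?f t) = (\<Sum>t\<in>W \<inter> R. ?f t)"
    by (rule sum.mono_neutral_right) (use W in \<open>auto simp: R_def laurent_coeff_def\<close>)
  also have "\<dots> = (\<Sum>t\<in>R. ?f t)"
    by (rule sum.mono_neutral_left) (use W finR in auto)
  also have "\<dots> = laurent_coeff (A\<^sub>1 + A\<^sub>2) (B\<^sub>1 + B\<^sub>2) (a - b)"
  proof (cases "K \<ge> 0")
    case True
    have P: "laurent_poly (A\<^sub>1 + A\<^sub>2) (B\<^sub>1 + B\<^sub>2) = laurent_poly A\<^sub>1 B\<^sub>1 * laurent_poly A\<^sub>2 B\<^sub>2"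
      by (simp add: laurent_poly_def mult_ac)
    have "(\<Sum>t\<in>R. ?f t) =
        (\<Sum>i\<le>nat K. coeff (laurent_poly A\<^sub>1 B\<^sub>1) i * coeff (laurent_poly A\<^sub>2 B\<^sub>2) (nat K - i))"
    proof (rule sum.reindex_bij_witness[of _ "\<lambda>i. a + int (size A\<^sub>1) - int i" "\<lambda>t. nat (a - t + int (size A\<^sub>1))"])
      fix t assume t: "t \<in> R"
      then have "nat K - nat (a - t + int (size A\<^sub>1)) = nat (t - b + int (size A\<^sub>2))"
        by (simp add: R_def K_def nat_diff_distrib[symmetric] flip: nat_diff_distrib)
      then show "coeff (laurent_poly A\<^sub>1 B\<^sub>1) (nat (a - t + int (size A\<^sub>1))) *
          coeff (laurent_poly A\<^sub>2 B\<^sub>2) (nat K - nat (a - t + int (size A\<^sub>1))) = ?f t"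
        using t by (simp add: laurent_coeff_def R_def)
    qed (use True in \<open>auto simp: R_def K_def\<close>)
    also have "\<dots> = coeff (laurent_poly (A\<^sub>1 + A\<^sub>2) (B\<^sub>1 + B\<^sub>2)) (nat K)"
      by (simp add: P coeff_mult)
    finally show ?thesis using True by (simp add: laurent_coeff_def K_def add.assoc)
  next
    case False
    then have "R = {}" by (auto simp: R_def K_def)
    then show ?thesis using False by (simp add: laurent_coeff_def K_def)
  qed
  finally show ?thesis .
qed

lemma prod_mset_prod_swap:
  "(\<Prod>\<alpha>\<in>#A. \<Prod>a\<in>I. f \<alpha> a :: 'a::comm_monoid_mult) = (\<Prod>a\<in>I. \<Prod>\<alpha>\<in>#A. f \<alpha> a)"
  by (induction A) (simp_all add: prod.distrib)

definition add_exponents :: "nat \<Rightarrow> int list \<Rightarrow> (nat \<Rightarrow> int) \<Rightarrow> int list" where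
  "add_exponents n l \<phi> = map (\<lambda>k. l ! k + \<phi> k) [0..<n]"

lemma length_add_exponents [simp]: "length (add_exponents n l \<phi>) = n"
  by (simp add: add_exponents_def)

lemma schur_num_mult_expansion:
  assumes n: "length l = n" and S: "finite S" and y: "\<And>a. a < n \<Longrightarrow> y a \<noteq> 0"
  shows "(\<Prod>a<n. \<Sum>s\<in>S. q s * y a powi s) * schur_num l y =
    (\<Sum>\<phi>\<in>PiE {..<n} (\<lambda>_. S). (\<Prod>k<n. q (\<phi> k)) * schur_num (add_exponents n l \<phi>) y)"
proof -
  define e where "e = (\<lambda>k. staircase n k + l ! k)"
  have "(\<Prod>a<n. \<Sum>s\<in>S. q s * y a powi s) * schur_num l y =
      fdet n (\<lambda>j k. (\<Sum>s\<in>S. q s * y j powi s) * y j powi e k)"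
    unfolding schur_num_alternant n alternant_def e_def by (rule fdet_scale_rows[symmetric])
  also have "\<dots> = fdet n (\<lambda>j k. \<Sum>s\<in>S. q s * y j powi (e k + s))"
    by (rule fdet_cong) (simp add: sum_distrib_left power_int_add y mult_ac)
  also have "\<dots> = (\<Sum>\<phi>\<in>PiE {..<n} (\<lambda>_. S). fdet n (\<lambda>j k. q (\<phi> k) * y j powi (e k + \<phi> k)))"
    using S by (intro fdet_sum_cols)
  also have "\<dots> = (\<Sum>\<phi>\<in>PiE {..<n} (\<lambda>_. S). (\<Prod>k<n. q (\<phi> k)) * schur_num (add_exponents n l \<phi>) y)"
  proof (rule sum.cong[OF refl])
    fix \<phi>
    have "fdet n (\<lambda>j k. y j powi (e k + \<phi> k)) = schur_num (add_exponents n l \<phi>) y"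
      unfolding schur_num_alternant length_add_exponents alternant_def
      by (rule fdet_cong) (simp add: e_def add_exponents_def add.assoc)
    then show "fdet n (\<lambda>j k. q (\<phi> k) * y j powi (e k + \<phi> k)) =
        (\<Prod>k<n. q (\<phi> k)) * schur_num (add_exponents n l \<phi>) y"
      by (simp add: fdet_scale_cols)
  qed
  finally show ?thesis .
qed

lemma schur_mult_expansion:
  assumes n: "length l = n" and S: "finite S" and x: "\<And>a. a < n \<Longrightarrow> x a \<noteq> 0"
  shows "(\<Prod>a<n. \<Sum>s\<in>S. q s * x a powi s) * schur l x =
    (\<Sum>\<phi>\<in>PiE {..<n} (\<lambda>_. S). (\<Prod>k<n. q (\<phi> k)) * schur (add_exponents n l \<phi>) x)"
    (is "?f x = ?g x")
proof (rule eq_by_density_of_inj[where f = ?f and g = ?g and U = "- {0}" and n = n])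
  show "(?f \<longlongrightarrow> ?f x) (at x)"
    by (intro tendsto_intros tendsto_coordinate tendsto_schur[OF n]) (use x in auto)
  show "(?g \<longlongrightarrow> ?g x) (at x)"
    by (intro tendsto_intros tendsto_schur[OF length_add_exponents]) (use x in auto)
  fix y :: "nat \<Rightarrow> complex" assume y: "inj_on y {..<n}" and "\<And>a. a < n \<Longrightarrow> y a \<in> - {0}"
  then have "(\<Prod>a<n. \<Sum>s\<in>S. q s * y a powi s) * schur_num l y / schur_den n y =
      (\<Sum>\<phi>\<in>PiE {..<n} (\<lambda>_. S). (\<Prod>k<n. q (\<phi> k)) * schur_num (add_exponents n l \<phi>) y) / schur_den n y"
    by (subst schur_num_mult_expansion[OF n S]) auto
  then show "?f y = ?g y"
    using y by (simp add: schur_def n sum_divide_distrib)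
qed (use x in auto)

context haar_unitary
begin

lemma integral_eigs_prod_mult_schur:
  assumes l: "length l = CARD('n)" and S: "finite S"
  shows "(LINT g|\<mu>. (\<Prod>a<CARD('n). \<Sum>s\<in>S. q s * eigs g a powi s) * schur l (eigs g)) =
    fdet CARD('n) (\<lambda>j k. \<Sum>s\<in>S. q s * of_bool (staircase CARD('n) j = staircase CARD('n) k + l ! k + s))"
proof -
  let ?N = "CARD('n)" and ?P = "PiE {..<CARD('n)} (\<lambda>_. S)"
  have "(LINT g|\<mu>. (\<Prod>a<?N. \<Sum>s\<in>S. q s * eigs g a powi s) * schur l (eigs g)) =
      (LINT g|\<mu>. (\<Sum>\<phi>\<in>?P. (\<Prod>k<?N. q (\<phi> k)) * schur (add_exponents ?N l \<phi>) (eigs g)))"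
    by (rule integral_haar_cong(2), rule schur_mult_expansion[OF l S], rule eigs_nonzero)
  also have "\<dots> = (\<Sum>\<phi>\<in>?P. (\<Prod>k<?N. q (\<phi> k)) * (LINT g|\<mu>. schur (add_exponents ?N l \<phi>) (eigs g)))"
    by (simp add: schur_eigs_moments(1))
  also have "\<dots> = (\<Sum>\<phi>\<in>?P. fdet ?N (\<lambda>j k. q (\<phi> k) *
      of_bool (staircase ?N j = staircase ?N k + l ! k + \<phi> k)))"
  proof (rule sum.cong[OF refl])
    fix \<phi>
    have "fdet ?N (\<lambda>j k. of_bool (staircase ?N j = staircase ?N k + add_exponents ?N l \<phi> ! k)) =
        fdet ?N (\<lambda>j k. of_bool (staircase ?N j = staircase ?N k + l ! k + \<phi> k) :: complex)"
      by (rule fdet_cong) (simp add: add_exponents_def add.assoc)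
    then show "(\<Prod>k<?N. q (\<phi> k)) * (LINT g|\<mu>. schur (add_exponents ?N l \<phi>) (eigs g)) =
        fdet ?N (\<lambda>j k. q (\<phi> k) * of_bool (staircase ?N j = staircase ?N k + l ! k + \<phi> k))"
      by (simp add: schur_eigs_integral fdet_scale_cols)
  qed
  also have "\<dots> = fdet ?N (\<lambda>j k. \<Sum>s\<in>S. q s * of_bool (staircase ?N j = staircase ?N k + l ! k + s))"
    using S by (intro fdet_sum_cols[symmetric])
  finally show ?thesis .
qed

lemma twisted_moment_toeplitz:
  assumes l: "length l = CARD('n)"
  shows "twisted_moment \<mu> A B l =
    fdet CARD('n) (\<lambda>j k. laurent_coeff A B (staircase CARD('n) j - shifted_weight CARD('n) l ! k))"
proof -
  let ?N = "CARD('n)" and ?q = "laurent_coeff A B" and ?S = "{- int (size A)..int (size B)}"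
  have "twisted_moment \<mu> A B l =
      (LINT g|\<mu>. (\<Prod>a<?N. \<Sum>s\<in>?S. ?q s * eigs g a powi s) * schur l (eigs g))"
    unfolding twisted_moment_def schur_eigenvalues_eigs
  proof (rule integral_haar_cong(2), rule arg_cong2[where f = "(*)", OF _ refl])
    fix g :: "complex^'n^'n" assume g: "g \<in> unitary_group"
    show "(\<Prod>\<alpha>\<in>#A. mdet (smat 1 - smat \<alpha> ** conj_transpose g)) * (\<Prod>\<beta>\<in>#B. mdet (smat 1 - smat \<beta> ** g)) =
        (\<Prod>a<?N. \<Sum>s\<in>?S. ?q s * eigs g a powi s)"
      unfolding mdet_one_minus_conj_transpose[OF g] mdet_smat_minus_smat_mult[where g = g] prod_mset_prod_swap
        prod.distrib[symmetric]
      by (intro prod.cong refl laurent_expansion eigs_nonzero g) simp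
  qed
  also have "\<dots> = fdet ?N (\<lambda>j k. \<Sum>s\<in>?S. ?q s * of_bool (staircase ?N j = staircase ?N k + l ! k + s))"
    by (rule integral_eigs_prod_mult_schur[OF l]) simp
  also have "\<dots> = fdet ?N (\<lambda>j k. ?q (staircase ?N j - shifted_weight ?N l ! k))"
  proof (rule fdet_cong)
    fix j k assume "k < ?N"
    let ?d = "staircase ?N j - shifted_weight ?N l ! k"
    have "(\<Sum>s\<in>?S. ?q s * of_bool (staircase ?N j = staircase ?N k + l ! k + s)) =
        (\<Sum>s\<in>?S. if s = ?d then ?q ?d else 0)"
      by (rule sum.cong) (use \<open>k < ?N\<close> in auto)
    also have "\<dots> = ?q ?d" using laurent_coeff_support[of ?d A B] by auto
    finally show "(\<Sum>s\<in>?S. ?q s * of_bool (staircase ?N j = staircase ?N k + l ! k + s)) = ?q ?d" .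
  qed
  finally show ?thesis .
qed

lemma twisted_moment_neg_weight_toeplitz:
  assumes l: "length l = CARD('n)"
  shows "twisted_moment \<mu> A B (neg_weight l) =
    fdet CARD('n) (\<lambda>j k. laurent_coeff A B (shifted_weight CARD('n) l ! j - staircase CARD('n) k))"
proof -
  let ?N = "CARD('n)" and ?p = "reversal CARD('n)"
  define f where "f = (\<lambda>j k. laurent_coeff A B (shifted_weight ?N l ! j - staircase ?N k))"
  have exponent: "staircase ?N j - shifted_weight ?N (neg_weight l) ! k =
      shifted_weight ?N l ! ?p k - staircase ?N (?p j)" if "j < ?N" "k < ?N" for j k
    using that l by (simp add: neg_weight_def rev_nth reversal_def staircase_def)
  have "twisted_moment \<mu> A B (neg_weight l) =
      fdet ?N (\<lambda>j k. laurent_coeff A B (staircase ?N j - shifted_weight ?N (neg_weight l) ! k))"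
    by (rule twisted_moment_toeplitz) (simp add: neg_weight_def l)
  also have "\<dots> = fdet ?N (\<lambda>j k. f (?p k) (?p j))"
    by (rule fdet_cong) (simp only: exponent f_def)
  also have "\<dots> = fdet ?N (\<lambda>j k. f (?p j) (?p k))" by (rule fdet_transpose)
  also have "\<dots> = signof ?p * (signof ?p * fdet ?N f)"
    by (simp only: fdet_permute_rows[OF reversal_permutes, of _ "\<lambda>j k. f j (?p k)"]
        fdet_permute_cols[OF reversal_permutes])
  also have "\<dots> = fdet ?N f" by (simp add: sign_def)
  finally show ?thesis by (simp add: f_def)
qed

end

theorem theorem1p1:
  fixes \<mu> :: "(complex^'n^'n) measure"
    and A B A\<^sub>1 A\<^sub>2 B\<^sub>1 B\<^sub>2 :: "complex multiset"
  assumes "haar_prob_measure \<mu>"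
    and "A = A\<^sub>1 + A\<^sub>2"
    and "B = B\<^sub>1 + B\<^sub>2"
  shows "finite {l \<in> dominant_weights CARD('n).
           twisted_moment \<mu> A\<^sub>1 B\<^sub>1 l * twisted_moment \<mu> A\<^sub>2 B\<^sub>2 (neg_weight l) \<noteq> 0} \<and>
         twisted_moment \<mu> A B (replicate CARD('n) 0) =
           (\<Sum>\<^sub>\<infinity>l\<in>dominant_weights CARD('n).
              twisted_moment \<mu> A\<^sub>1 B\<^sub>1 l * twisted_moment \<mu> A\<^sub>2 B\<^sub>2 (neg_weight l))"
proof -
  interpret haar_unitary \<mu> by unfold_locales (rule assms(1))
  let ?N = "CARD('n)" and ?\<rho> = "staircase CARD('n)"
  let ?P = "\<lambda>j t. laurent_coeff A\<^sub>1 B\<^sub>1 (?\<rho> j - t)" and ?Q = "\<lambda>t k. laurent_coeff A\<^sub>2 B\<^sub>2 (t - ?\<rho> k)"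
  define f where "f = (\<lambda>l. fdet ?N (\<lambda>j k. ?P j (shifted_weight ?N l ! k)) *
    fdet ?N (\<lambda>j k. ?Q (shifted_weight ?N l ! j) k))"
  define W where "W = (\<Union>j<?N. {?\<rho> j - int (size B\<^sub>1)..?\<rho> j + int (size A\<^sub>1)})"
  have W: "finite W" by (simp add: W_def)
  have support: "?P j t = 0" if "j < ?N" "t \<notin> W" for j t
    using that by (intro laurent_coeff_support) (force simp: W_def)
  have product: "twisted_moment \<mu> A\<^sub>1 B\<^sub>1 l * twisted_moment \<mu> A\<^sub>2 B\<^sub>2 (neg_weight l) = f l"
    if "l \<in> dominant_weights ?N" for l
    using that by (simp add: dominant_weights_def f_def twisted_moment_toeplitz twisted_moment_neg_weight_toeplitz)
  have "twisted_moment \<mu> A B (replicate ?N 0) = fdet ?N (\<lambda>j k. laurent_coeff A B (?\<rho> j - ?\<rho> k))"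
    by (subst twisted_moment_toeplitz) (auto intro!: fdet_cong)
  also have "\<dots> = fdet ?N (\<lambda>j k. \<Sum>t\<in>W. ?P j t * ?Q t k)"
    unfolding assms(2,3) by (intro fdet_cong laurent_coeff_convolution[symmetric] W) (use support in blast)
  also have "\<dots> = (\<Sum>\<^sub>\<infinity>l\<in>dominant_weights ?N. f l)"
    unfolding f_def by (rule cauchy_binet_dominant_weights(2)[OF W support, symmetric])
  finally show ?thesis
    using cauchy_binet_dominant_weights(1)[where A = ?P and B = ?Q, OF W support]
    by (simp add: product f_def cong: conj_cong infsum_cong)
qed

end
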